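(* Let $k,\ell$ be kernels on a non-empty set $X$ and let $s$ be a strong Shimorin certificate for $(k,\ell)$, with $h,g$ kernels on $X$ such that $k=(1-h)s$ and $\ell=sg$, and suppose $k$ and $s$ are non-vanishing on $X\times X$. Let $\mathcal{L}_1,\mathcal{L}_2$ be Hilbert spaces and let $\Psi:X\to\mathcal{B}(\mathcal{L}_1,\mathbb{C})$ and $G:X\to\mathcal{B}(\mathcal{L}_2,\mathbb{C})$ be functions with $h(z,w)=\Psi(z)\Psi(w)^*$ and $g(z,w)=G(z)G(w)^*$ for all $z,w\in X$. Let $N\ge1$. A function $R:X\to\mathbb{M}_N$ is a contractive multiplier from $\mathcal{H}_k\otimes\mathbb{C}^N$ to $\mathcal{H}_\ell\otimes\mathbb{C}^N$ if and only if there exists a contractive multiplier $$\Phi=\begin{bmatrix}\Phi_1\\ \Phi_2\end{bmatrix}\in\mathrm{Mult}\big(\mathcal{H}_s\otimes\mathbb{C}^N,\ \mathcal{H}_s\otimes\big((\mathbb{C}^N\otimes\mathcal{L}_2)\oplus(\mathbb{C}^N\otimes\mathcal{L}_1)\big)\big)$$ satisfying $$R(z)=\big(I_{N\times N}\otimes G(z)\big)\Phi_1(z)\Big(I_{N\times N}-\big(I_{N\times N}\otimes\Psi(z)\big)\Phi_2(z)\Big)^{-1}$$ for all $z\in X$.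
   Context: A kernel on a non-empty set $X$ is a function $k:X\times X\to\mathbb{C}$ such that $[k(z_i,z_j)]_{i,j=1}^n$ is positive semi-definite for all finite choices of points; $\mathcal{H}_k$ is the reproducing kernel Hilbert space. Standing assumption: $k$ and $\ell$ do not vanish on the diagonal. $\mathbb{M}_N$ is the set of complex $N\times N$ matrices and $\mathcal{B}(\mathcal{E},\mathcal{F})$ the bounded operators between Hilbert spaces. For Hilbert spaces $\mathcal{E},\mathcal{F}$ and kernels $k,\ell$ on $X$, elements of $\mathcal{H}_k\otimes\mathcal{E}$ are regarded as $\mathcal{E}$-valued functions on $X$, and $\mathrm{Mult}(\mathcal{H}_k\otimes\mathcal{E},\mathcal{H}_\ell\otimes\mathcal{F})$ is the set of functions $\Phi:X\to\mathcal{B}(\mathcal{E},\mathcal{F})$ that multiply $\mathcal{H}_k\otimes\mathcal{E}$ into $\mathcal{H}_\ell\otimes\mathcal{F}$; $\Phi$ is contractive if the multiplication operator $M_\Phi$ is a contraction. A kernel $s$ on $X$ is a complete Pick kernel if for all $n,N\ge1$, all $z_1,\dots,z_n\in X$ and all $W_1,\dots,W_n\in\mathbb{M}_N$ with $[s(z_i,z_j)(I_{N\times N}-W_iW_j^* )]_{i,j=1}^n$ positive semi-definite, there is a contractive $\Phi\in\mathrm{Mult}(\mathcal{H}_s\otimes\mathbb{C}^N,\mathcal{H}_s\otimes\mathbb{C}^N)$ with $\Phi(z_i)=W_i$ for all $i$. A strong Shimorin certificate for $(k,\ell)$ is a complete Pick kernel $s$ on $X$ for which there are kernels $h,g$ on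 $X$ with $k=(1-h)s$ and $\ell=sg$. *)

theory Defs
  imports
    "Jordan_Normal_Form.Gauss_Jordan_Elimination"
    "Jordan_Normal_Form.Schur_Decomposition"
    "HOL-Library.Function_Algebras"
    "HOL-Library.Product_Plus"
begin

section \<open>Complex Hilbert spaces\<close>

class complex_vector = ab_group_add +
  fixes scaleC :: "complex \<Rightarrow> 'a \<Rightarrow> 'a"  (infixr \<open>*\<^sub>C\<close> 75)
  assumes scaleC_add_right: "c *\<^sub>C (x + y) = c *\<^sub>C x + c *\<^sub>C y"
    and scaleC_add_left: "(c + d) *\<^sub>C x = c *\<^sub>C x + d *\<^sub>C x"
    and scaleC_scaleC: "c *\<^sub>C d *\<^sub>C x = (c * d) *\<^sub>C x"
    and scaleC_one: "1 *\<^sub>C x = x"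

global_interpretation complex_vector: vector_space "scaleC :: complex \<Rightarrow> 'a \<Rightarrow> 'a::complex_vector"
  by unfold_locales (simp_all add: scaleC_add_right scaleC_add_left scaleC_scaleC scaleC_one)

instantiation complex :: complex_vector
begin
definition scaleC_complex_def: "c *\<^sub>C (x::complex) = c * x"
instance by standard (simp_all add: scaleC_complex_def algebra_simps)
end

instantiation "fun" :: (type, complex_vector) complex_vector
begin
definition scaleC_fun_def: "c *\<^sub>C f = (\<lambda>x. c *\<^sub>C f x)"
instance
  by standard
    (simp_all add: scaleC_fun_def fun_eq_iff scaleC_add_right scaleC_add_left scaleC_scaleC scaleC_one)
end

instantiation prod :: (complex_vector, complex_vector) complex_vector
begin
definition scaleC_prod_def: "c *\<^sub>C p = (c *\<^sub>C fst p, c *\<^sub>C snd p)"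
instance
  by standard
    (simp_all add: scaleC_prod_def prod_eq_iff scaleC_add_right scaleC_add_left scaleC_scaleC scaleC_one)
end

text \<open>
  A Hilbert space is a linear subspace of an ambient complex vector space type, together with an
  inner product of its own that is linear in the first argument. Only the values of the inner
  product on the carrier matter. Spaces of functions, of \<open>N\<close>-tuples (with \<open>N\<close> a natural number)
  and of pairs can then be treated uniformly.
\<close>

record 'a hspace = "'a partial_object" +
  cinner :: "'a \<Rightarrow> 'a \<Rightarrow> complex"

definition hnorm :: "'a hspace \<Rightarrow> 'a \<Rightarrow> real" where
  "hnorm H x = sqrt (Re (cinner H x x))"

locale hilbert_space =
  fixes H :: "'a::complex_vector hspace"
  assumes subspace: "complex_vector.subspace (carrier H)"
    and cinner_add_left: "\<lbrakk>x \<in> carrier H; y \<in> carrier H; z \<in> carrier H\<rbrakk> \<Longrightarrow>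
          cinner H (x + y) z = cinner H x z + cinner H y z"
    and cinner_scaleC_left: "\<lbrakk>x \<in> carrier H; y \<in> carrier H\<rbrakk> \<Longrightarrow>
          cinner H (c *\<^sub>C x) y = c * cinner H x y"
    and cinner_commute: "\<lbrakk>x \<in> carrier H; y \<in> carrier H\<rbrakk> \<Longrightarrow>
          cinner H x y = cnj (cinner H y x)"
    and cinner_pos: "\<lbrakk>x \<in> carrier H; x \<noteq> 0\<rbrakk> \<Longrightarrow> 0 < Re (cinner H x x)"
    and complete: "\<lbrakk>\<And>n. u n \<in> carrier H;
          \<forall>\<epsilon>>0. \<exists>M. \<forall>m\<ge>M. \<forall>n\<ge>M. hnorm H (u m - u n) < \<epsilon>\<rbrakk> \<Longrightarrow>
          \<exists>x\<in>carrier H. (\<lambda>n::nat. hnorm H (u n - x)) \<longlonglongrightarrow> 0"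

definition complex_space :: "complex hspace" where
  "complex_space = \<lparr>carrier = UNIV, cinner = (\<lambda>a b. a * cnj b)\<rparr>"

text \<open>
  \<open>tuple_space N E\<close> is \<open>\<complex>\<^sup>N \<otimes> E\<close>, identified with the \<open>N\<close>-fold direct sum of \<open>E\<close> through
  \<open>c \<otimes> x = (c\<^sub>0 x, \<dots>, c\<^sub>N\<^sub>-\<^sub>1 x)\<close>. Tuples are indexed from 0 and padded by 0.
\<close>

definition tuple_space :: "nat \<Rightarrow> 'a::complex_vector hspace \<Rightarrow> (nat \<Rightarrow> 'a) hspace" where
  "tuple_space N E =
    \<lparr>carrier = {v. (\<forall>i<N. v i \<in> carrier E) \<and> (\<forall>i\<ge>N. v i = 0)},
     cinner = (\<lambda>v w. \<Sum>i<N. cinner E (v i) (w i))\<rparr>"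

abbreviation complex_tuples :: "nat \<Rightarrow> (nat \<Rightarrow> complex) hspace"  (\<open>\<complex>^_\<close> [90] 90) where
  "\<complex>^N \<equiv> tuple_space N complex_space"

definition direct_sum :: "'a hspace \<Rightarrow> 'b hspace \<Rightarrow> ('a \<times> 'b) hspace"  (infixr \<open>\<oplus>\<^sub>H\<close> 65) where
  "E \<oplus>\<^sub>H F =
    \<lparr>carrier = carrier E \<times> carrier F,
     cinner = (\<lambda>p q. cinner E (fst p) (fst q) + cinner F (snd p) (snd q))\<rparr>"

section \<open>Bounded operators and matrices\<close>

text \<open>Operators are only constrained on the carrier of their domain.\<close>

definition bounded_ops :: "'a::complex_vector hspace \<Rightarrow> 'b::complex_vector hspace \<Rightarrow> ('a \<Rightarrow> 'b) set"
  where "bounded_ops E F =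
    {T. (\<forall>x\<in>carrier E. T x \<in> carrier F) \<and>
        (\<forall>x\<in>carrier E. \<forall>y\<in>carrier E. T (x + y) = T x + T y) \<and>
        (\<forall>c. \<forall>x\<in>carrier E. T (c *\<^sub>C x) = c *\<^sub>C T x) \<and>
        (\<exists>K. \<forall>x\<in>carrier E. hnorm F (T x) \<le> K * hnorm E x)}"

definition hadjoint :: "'a hspace \<Rightarrow> 'b hspace \<Rightarrow> ('a \<Rightarrow> 'b) \<Rightarrow> 'b \<Rightarrow> 'a" where
  "hadjoint E F T y =
    (THE x. x \<in> carrier E \<and> (\<forall>u\<in>carrier E. cinner E u x = cinner F (T u) y))"

text \<open>\<open>ampliation N T\<close> is \<open>I \<otimes> T\<close> for the identity \<open>I\<close> of \<open>\<complex>\<^sup>N\<close>.\<close>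

definition ampliation :: "nat \<Rightarrow> ('a \<Rightarrow> 'b::zero) \<Rightarrow> (nat \<Rightarrow> 'a) \<Rightarrow> (nat \<Rightarrow> 'b)" where
  "ampliation N T v = (\<lambda>i. if i < N then T (v i) else 0)"

definition op_of_mat :: "nat \<Rightarrow> complex mat \<Rightarrow> (nat \<Rightarrow> complex) \<Rightarrow> (nat \<Rightarrow> complex)" where
  "op_of_mat N A v = (\<lambda>i. if i < N then \<Sum>j<N. A $$ (i, j) * v j else 0)"

definition mat_of_op :: "nat \<Rightarrow> ((nat \<Rightarrow> complex) \<Rightarrow> (nat \<Rightarrow> complex)) \<Rightarrow> complex mat" where
  "mat_of_op N T = mat N N (\<lambda>(i, j). T (\<lambda>l. if l = j then 1 else 0) i)"

text \<open>
  The order on \<^typ>\<open>complex\<close> is that of \<^theory>\<open>HOL-Library.Complex_Order\<close>: \<open>0 \<le> z\<close> means that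
  \<open>z\<close> is real and nonnegative. Hence matrices satisfying this predicate are Hermitian.
\<close>

definition psd_mat :: "complex mat \<Rightarrow> bool" where
  "psd_mat A \<longleftrightarrow> dim_row A = dim_col A \<and> (\<forall>v\<in>carrier_vec (dim_col A). 0 \<le> (A *\<^sub>v v) \<bullet>c v)"

definition block_mat :: "nat \<Rightarrow> nat \<Rightarrow> (nat \<Rightarrow> nat \<Rightarrow> complex mat) \<Rightarrow> complex mat" where
  "block_mat n N B =
    mat (n * N) (n * N) (\<lambda>(a, b). B (a div N) (b div N) $$ (a mod N, b mod N))"

section \<open>Kernels and multipliers\<close>

text \<open>The set \<open>X\<close> is the type \<^typ>\<open>'x\<close>, which is non-empty like every type.\<close>

definition pd_kernel :: "('x \<Rightarrow> 'x \<Rightarrow> complex) \<Rightarrow> bool" where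
  "pd_kernel k \<longleftrightarrow> (\<forall>n (z :: nat \<Rightarrow> 'x). psd_mat (mat n n (\<lambda>(i, j). k (z i) (z j))))"

definition is_rkhs :: "('x \<Rightarrow> 'x \<Rightarrow> complex) \<Rightarrow> ('x \<Rightarrow> complex) hspace \<Rightarrow> bool" where
  "is_rkhs k H \<longleftrightarrow> hilbert_space H \<and>
    (\<forall>w. (\<lambda>z. k z w) \<in> carrier H) \<and>
    (\<forall>f\<in>carrier H. \<forall>w. cinner H f (\<lambda>z. k z w) = f w)"

text \<open>
  By the Moore--Aronszajn theorem the space of a kernel exists, and its carrier and the inner
  product on that carrier are unique, so that the choice below is immaterial. The same holds
  for \<open>rkhs_tensor\<close>.
\<close>

definition rkhs :: "('x \<Rightarrow> 'x \<Rightarrow> complex) \<Rightarrow> ('x \<Rightarrow> complex) hspace" where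
  "rkhs k = (SOME H. is_rkhs k H)"

definition elem_tensor :: "('x \<Rightarrow> complex) \<Rightarrow> 'e::complex_vector \<Rightarrow> ('x \<Rightarrow> 'e)" where
  "elem_tensor f e = (\<lambda>z. f z *\<^sub>C e)"

text \<open>
  \<open>T\<close> is the Hilbert space tensor product of \<open>rkhs k\<close> and \<open>E\<close>, realised as a space of \<open>E\<close>-valued
  functions: the inner product is multiplicative on elementary tensors, these span a dense
  subspace, and the value \<open>u(z)\<close> of an element \<open>u\<close> is the vector determined by
  \<open>\<langle>u(z), e\<rangle> = \<langle>u, k(\<cdot>,z) \<otimes> e\<rangle>\<close>.
\<close>

definition is_rkhs_tensor ::
    "('x \<Rightarrow> 'x \<Rightarrow> complex) \<Rightarrow> 'e::complex_vector hspace \<Rightarrow> ('x \<Rightarrow> 'e) hspace \<Rightarrow> bool" where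
  "is_rkhs_tensor k E T \<longleftrightarrow> hilbert_space T \<and>
    (\<forall>u\<in>carrier T. \<forall>z. u z \<in> carrier E) \<and>
    (\<forall>f\<in>carrier (rkhs k). \<forall>e\<in>carrier E. elem_tensor f e \<in> carrier T) \<and>
    (\<forall>f\<in>carrier (rkhs k). \<forall>f'\<in>carrier (rkhs k). \<forall>e\<in>carrier E. \<forall>e'\<in>carrier E.
       cinner T (elem_tensor f e) (elem_tensor f' e') = cinner (rkhs k) f f' * cinner E e e') \<and>
    (\<forall>u\<in>carrier T. \<forall>\<epsilon>>0.
       \<exists>v\<in>complex_vector.span {elem_tensor f e | f e. f \<in> carrier (rkhs k) \<and> e \<in> carrier E}.
         hnorm T (u - v) < \<epsilon>) \<and>
    (\<forall>u\<in>carrier T. \<forall>z. \<forall>e\<in>carrier E.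
       cinner T u (elem_tensor (\<lambda>w. k w z) e) = cinner E (u z) e)"

definition rkhs_tensor ::
    "('x \<Rightarrow> 'x \<Rightarrow> complex) \<Rightarrow> 'e::complex_vector hspace \<Rightarrow> ('x \<Rightarrow> 'e) hspace" where
  "rkhs_tensor k E = (SOME T. is_rkhs_tensor k E T)"

text \<open>\<open>multipliers k E l F\<close> is \<open>Mult(H\<^sub>k \<otimes> E, H\<^sub>l \<otimes> F)\<close>.\<close>

definition multipliers ::
    "('x \<Rightarrow> 'x \<Rightarrow> complex) \<Rightarrow> 'e::complex_vector hspace \<Rightarrow>
     ('x \<Rightarrow> 'x \<Rightarrow> complex) \<Rightarrow> 'f::complex_vector hspace \<Rightarrow> ('x \<Rightarrow> 'e \<Rightarrow> 'f) set" where
  "multipliers k E l F =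
    {\<Phi>. (\<forall>z. \<Phi> z \<in> bounded_ops E F) \<and>
        (\<forall>u\<in>carrier (rkhs_tensor k E). (\<lambda>z. \<Phi> z (u z)) \<in> carrier (rkhs_tensor l F))}"

definition contractive_multiplier ::
    "('x \<Rightarrow> 'x \<Rightarrow> complex) \<Rightarrow> 'e::complex_vector hspace \<Rightarrow>
     ('x \<Rightarrow> 'x \<Rightarrow> complex) \<Rightarrow> 'f::complex_vector hspace \<Rightarrow> ('x \<Rightarrow> 'e \<Rightarrow> 'f) \<Rightarrow> bool" where
  "contractive_multiplier k E l F \<Phi> \<longleftrightarrow> \<Phi> \<in> multipliers k E l F \<and>
    (\<forall>u\<in>carrier (rkhs_tensor k E).
       hnorm (rkhs_tensor l F) (\<lambda>z. \<Phi> z (u z)) \<le> hnorm (rkhs_tensor k E) u)"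

definition complete_pick_kernel :: "('x \<Rightarrow> 'x \<Rightarrow> complex) \<Rightarrow> bool" where
  "complete_pick_kernel s \<longleftrightarrow> pd_kernel s \<and>
    (\<forall>n\<ge>1. \<forall>N\<ge>1. \<forall>(z :: nat \<Rightarrow> 'x) W.
       (\<forall>i<n. W i \<in> carrier_mat N N) \<and>
       psd_mat (block_mat n N (\<lambda>i j. s (z i) (z j) \<cdot>\<^sub>m (1\<^sub>m N - W i * mat_adjoint (W j)))) \<longrightarrow>
       (\<exists>\<Phi>. contractive_multiplier s (\<complex>^N) s (\<complex>^N) \<Phi> \<and> (\<forall>i<n. mat_of_op N (\<Phi> (z i)) = W i)))"

definition strong_shimorin_certificate ::
    "('x \<Rightarrow> 'x \<Rightarrow> complex) \<Rightarrow> ('x \<Rightarrow> 'x \<Rightarrow> complex) \<Rightarrow> ('x \<Rightarrow> 'x \<Rightarrow> complex) \<Rightarrow> bool" where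
  "strong_shimorin_certificate k l s \<longleftrightarrow> complete_pick_kernel s \<and>
    (\<exists>h g. pd_kernel h \<and> pd_kernel g \<and>
       (\<forall>z w. k z w = (1 - h z w) * s z w) \<and> (\<forall>z w. l z w = s z w * g z w))"

end

theory Submission
  imports Defs "HOL-Analysis.Function_Topology"
begin

text \<open>
  Write \<open>A(z) = [I \<otimes> G(z), R(z) (I \<otimes> \<Psi>(z))]\<close>. A function \<open>\<Theta>\<close> is a contractive multiplier from
  \<open>H\<^sub>k \<otimes> E\<close> to \<open>H\<^sub>l \<otimes> F\<close> exactly when the operator-valued kernel
  \<open>l(z,w) I - k(z,w) \<Theta>(z) \<Theta>(w)\<^sup>*\<close> is positive semidefinite
  (\<open>contractive_multiplier_iff_psd_on\<close>), because the adjoint of the multiplication operator sends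
  \<open>l(\<cdot>,z) \<otimes> y\<close> to \<open>k(\<cdot>,z) \<otimes> \<Theta>(z)\<^sup>* y\<close>. For \<open>\<Theta> = R\<close>, the factorizations \<open>k = (1 - h) s\<close> and
  \<open>l = s g\<close> turn this kernel into \<open>s(z,w) (A(z) A(w)\<^sup>* - R(z) R(w)\<^sup>*)\<close>. On the other hand
  \<open>A \<Phi> = R\<close> says \<open>(I \<otimes> G) \<Phi>\<^sub>1 = R (I - (I \<otimes> \<Psi>) \<Phi>\<^sub>2)\<close>, and the last factor is invertible since
  \<open>\<parallel>\<Psi>(z)\<parallel>\<^sup>2 = h(z,z) < 1\<close> and \<open>\<Phi>\<^sub>2(z)\<close> is a contraction. Hence the claim is that
  \<open>s (A A\<^sup>* - R R\<^sup>*)\<close> is positive semidefinite iff \<open>A \<Phi> = R\<close> for some contractive multiplier \<open>\<Phi>\<close> of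
  \<open>H\<^sub>s\<close>. The direction from right to left sandwiches \<open>s (I - \<Phi> \<Phi>\<^sup>*)\<close> between \<open>A\<close> and \<open>A\<^sup>*\<close>. The
  other one is Leech's theorem for the complete Pick kernel \<open>s\<close> (\<open>Leech_factorization\<close>).

  The complete Pick property only speaks about full matrix values at finitely many points, while
  Leech's theorem prescribes the values of \<open>\<Phi>(z)\<^sup>*\<close> on some vectors only, at all points. The bridge
  is the positivity of \<open>1 - s(z,a) s(a,w) / (s(a,a) s(z,w))\<close> for every base point \<open>a\<close>, a theorem of
  McCullough and Quiggin (\<open>psd_on_pick_defect\<close>). It is proved by induction on the number of points,
  with interpolation data built from the defect at another base point, and makes a
  one-vector extension of the prescribed values possible (\<open>tangential_pick_one_point\<close>). Finitely many
  vectors follow by iteration, and all vectors at all points by Tychonoff's theorem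
  (\<open>tangential_pick_interpolation\<close>). The interpolating values are automatically linear, because
  positivity forces every null combination of vectors to be sent to zero; so they are
  the adjoint of the required multiplier.

  The functional analysis rests on one fact about a Hilbert space, \<open>moment_problem\<close>: prescribed inner
  products with a family of vectors are attained by some \<open>u\<close> with \<open>\<parallel>u\<parallel> \<le> C\<close> as soon as finitely many
  of them never contradict the Cauchy--Schwarz inequality for such a vector. It contains Riesz representation and
  density of spans, it describes the unit balls of reproducing kernel Hilbert spaces, and together
  with the Moore--Aronszajn theorem it gives the existence of the spaces \<open>H\<^sub>k \<otimes> E\<close>.
\<close>

section \<open>Positive semidefinite kernels\<close>

definition sesq_form :: "'i set \<Rightarrow> ('i \<Rightarrow> 'i \<Rightarrow> complex) \<Rightarrow> ('i \<Rightarrow> complex) \<Rightarrow> ('i \<Rightarrow> complex) \<Rightarrow> complex" where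
  "sesq_form S K c d = (\<Sum>i\<in>S. \<Sum>j\<in>S. cnj (c i) * K i j * d j)"

text \<open>
  The convention is \<open>K i j = \<langle>v\<^sub>j, v\<^sub>i\<rangle>\<close> for a family of vectors, so that
  \<open>sesq_form S K c c = \<parallel>\<Sum>\<^sub>j c\<^sub>j v\<^sub>j\<parallel>\<^sup>2\<close>. The index set is explicit because it will often be a carrier, for
  instance all pairs of a point and a vector of a Hilbert space.
\<close>

definition psd_on :: "'i set \<Rightarrow> ('i \<Rightarrow> 'i \<Rightarrow> complex) \<Rightarrow> bool" where
  "psd_on I K \<longleftrightarrow> (\<forall>S c. finite S \<and> S \<subseteq> I \<longrightarrow> 0 \<le> sesq_form S K c c)"

lemma cnj_mult_nonneg: "0 \<le> cnj z * (z::complex)"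
  by (simp add: less_eq_complex_def)

lemma sesq_form_add_left: "sesq_form S K (\<lambda>i. c i + d i) e = sesq_form S K c e + sesq_form S K d e"
  and sesq_form_add_right: "sesq_form S K e (\<lambda>i. c i + d i) = sesq_form S K e c + sesq_form S K e d"
  by (simp_all add: sesq_form_def algebra_simps sum.distrib)

lemma sesq_form_scale_left: "sesq_form S K (\<lambda>i. t * c i) e = cnj t * sesq_form S K c e"
  and sesq_form_scale_right: "sesq_form S K e (\<lambda>i. t * c i) = t * sesq_form S K e c"
  by (simp_all add: sesq_form_def algebra_simps sum_distrib_left)

lemma sesq_form_kernel_add:
  "sesq_form S (\<lambda>i j. K i j + L i j) c d = sesq_form S K c d + sesq_form S L c d"
  and sesq_form_kernel_diff:
  "sesq_form S (\<lambda>i j. K i j - L i j) c d = sesq_form S K c d - sesq_form S L c d"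
  by (simp_all add: sesq_form_def algebra_simps sum.distrib sum_subtractf)

lemma sesq_form_kernel_scale: "sesq_form S (\<lambda>i j. t * K i j) c d = t * sesq_form S K c d"
  by (simp add: sesq_form_def algebra_simps sum_distrib_left)

lemma sesq_form_kernel_sum:
  "sesq_form S (\<lambda>i j. \<Sum>m\<in>M. K m i j) c d = (\<Sum>m\<in>M. sesq_form S (K m) c d)"
proof -
  have "sesq_form S (\<lambda>i j. \<Sum>m\<in>M. K m i j) c d = (\<Sum>i\<in>S. \<Sum>j\<in>S. \<Sum>m\<in>M. cnj (c i) * K m i j * d j)"
    by (simp add: sesq_form_def sum_distrib_left sum_distrib_right)
  also have "\<dots> = (\<Sum>i\<in>S. \<Sum>m\<in>M. \<Sum>j\<in>S. cnj (c i) * K m i j * d j)"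
    by (intro sum.cong refl sum.swap)
  also have "\<dots> = (\<Sum>m\<in>M. sesq_form S (K m) c d)"
    unfolding sesq_form_def by (rule sum.swap)
  finally show ?thesis .
qed

lemma sesq_form_rank_one:
  "sesq_form S (\<lambda>i j. v i * w j) c d = (\<Sum>i\<in>S. cnj (c i) * v i) * (\<Sum>j\<in>S. w j * d j)"
  unfolding sesq_form_def sum_product by (intro sum.cong refl) (simp add: mult.assoc)

lemma sesq_form_delta_left:
  assumes "finite S" "b \<in> S"
  shows "sesq_form S K (\<lambda>i. if i = b then t else 0) d = cnj t * (\<Sum>j\<in>S. K b j * d j)"
proof -
  have "sesq_form S K (\<lambda>i. if i = b then t else 0) d
      = (\<Sum>i\<in>S. if i = b then cnj t * (\<Sum>j\<in>S. K b j * d j) else 0)"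
    unfolding sesq_form_def
    by (intro sum.cong refl) (simp add: sum_distrib_left algebra_simps)
  then show ?thesis using assms by simp
qed

lemma sesq_form_delta_right:
  assumes "finite S" "b \<in> S"
  shows "sesq_form S K c (\<lambda>i. if i = b then t else 0) = t * (\<Sum>i\<in>S. cnj (c i) * K i b)"
proof -
  have "sesq_form S K c (\<lambda>i. if i = b then t else 0) = (\<Sum>i\<in>S. cnj (c i) * K i b * t)"
    unfolding sesq_form_def
    by (intro sum.cong refl) (use assms in \<open>simp add: if_distrib cong: if_cong\<close>)
  then show ?thesis by (simp add: sum_distrib_left algebra_simps)
qed

lemma sesq_form_zero_extend:
  assumes "finite T" "S \<subseteq> T" "\<And>i. i \<in> T - S \<Longrightarrow> c i = 0" "\<And>i. i \<in> T - S \<Longrightarrow> d i = 0"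
  shows "sesq_form T K c d = sesq_form S K c d"
proof -
  have "sesq_form T K c d = (\<Sum>i\<in>S. \<Sum>j\<in>T. cnj (c i) * K i j * d j)"
    unfolding sesq_form_def by (rule sum.mono_neutral_right) (use assms in auto)
  also have "\<dots> = sesq_form S K c d"
    unfolding sesq_form_def
    by (intro sum.cong refl sum.mono_neutral_right) (use assms in auto)
  finally show ?thesis .
qed

lemma sesq_form_cong:
  assumes "\<And>i j. i \<in> S \<Longrightarrow> j \<in> S \<Longrightarrow> K i j = L i j"
    and "\<And>i. i \<in> S \<Longrightarrow> c i = c' i" and "\<And>i. i \<in> S \<Longrightarrow> d i = d' i"
  shows "sesq_form S K c d = sesq_form S L c' d'"
  unfolding sesq_form_def by (intro sum.cong refl) (use assms in auto)

lemma psd_onD: "psd_on I K \<Longrightarrow> finite S \<Longrightarrow> S \<subseteq> I \<Longrightarrow> 0 \<le> sesq_form S K c c"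
  by (simp add: psd_on_def)

lemma psd_on_subset: "psd_on I K \<Longrightarrow> J \<subseteq> I \<Longrightarrow> psd_on J K"
  by (auto simp: psd_on_def)

lemma psd_on_cong:
  assumes "psd_on I K" "\<And>i j. i \<in> I \<Longrightarrow> j \<in> I \<Longrightarrow> K i j = L i j"
  shows "psd_on I L"
  unfolding psd_on_def
proof (intro allI impI, elim conjE)
  fix S c assume S: "finite S" "S \<subseteq> I"
  have "sesq_form S L c c = sesq_form S K c c"
    by (rule sesq_form_cong) (use assms(2) S in \<open>auto simp: subset_iff\<close>)
  with psd_onD[OF assms(1) S] show "0 \<le> sesq_form S L c c" by simp
qed

lemma psd_on_superset:
  assumes "finite F" "F \<subseteq> I"
    and "\<And>S c. finite S \<Longrightarrow> F \<subseteq> S \<Longrightarrow> S \<subseteq> I \<Longrightarrow> 0 \<le> sesq_form S K c c"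
  shows "psd_on I K"
  unfolding psd_on_def
proof (intro allI impI, elim conjE)
  fix S c assume S: "finite S" "S \<subseteq> I"
  let ?c = "\<lambda>i. if i \<in> S then c i else (0::complex)"
  have "0 \<le> sesq_form (S \<union> F) K ?c ?c"
    by (rule assms(3)) (use assms(1,2) S in auto)
  also have "sesq_form (S \<union> F) K ?c ?c = sesq_form S K ?c ?c"
    by (rule sesq_form_zero_extend) (use assms(1) S in auto)
  also have "\<dots> = sesq_form S K c c" by (rule sesq_form_cong) auto
  finally show "0 \<le> sesq_form S K c c" .
qed

lemma psd_on_finite: "finite S \<Longrightarrow> psd_on S K \<longleftrightarrow> (\<forall>c. 0 \<le> sesq_form S K c c)"
  by (metis order_refl psd_onD psd_on_superset subset_antisym)

lemma psd_on_finitary: "psd_on I K \<longleftrightarrow> (\<forall>S. finite S \<and> S \<subseteq> I \<longrightarrow> psd_on S K)"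
  by (meson psd_onD psd_on_finite psd_on_def)

lemma psd_on_add: "psd_on I K \<Longrightarrow> psd_on I L \<Longrightarrow> psd_on I (\<lambda>i j. K i j + L i j)"
  unfolding psd_on_def sesq_form_kernel_add by (simp add: add_nonneg_nonneg)

lemma psd_on_scale: "psd_on I K \<Longrightarrow> 0 \<le> t \<Longrightarrow> psd_on I (\<lambda>i j. t * K i j)"
  unfolding psd_on_def sesq_form_kernel_scale by simp

lemma psd_on_sum:
  "(\<And>m. m \<in> M \<Longrightarrow> psd_on I (K m)) \<Longrightarrow> psd_on I (\<lambda>i j. \<Sum>m\<in>M. K m i j)"
  unfolding psd_on_def sesq_form_kernel_sum by (simp add: sum_nonneg)

lemma psd_on_rank_one: "psd_on I (\<lambda>i j. cnj (v i) * v j)"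
  unfolding psd_on_def sesq_form_rank_one
proof (intro allI impI)
  fix S c
  have "(\<Sum>i\<in>S. cnj (c i) * cnj (v i)) = cnj (\<Sum>j\<in>S. v j * c j)"
    by (simp add: mult.commute)
  then show "0 \<le> (\<Sum>i\<in>S. cnj (c i) * cnj (v i)) * (\<Sum>j\<in>S. v j * c j)"
    by (simp add: cnj_mult_nonneg del: cnj_sum)
qed

lemma psd_on_diag: 
  assumes "psd_on I K" "i \<in> I" shows "0 \<le> K i i"
  using psd_onD[OF assms(1), of "{i}" "\<lambda>_. 1"] assms(2) by (simp add: sesq_form_def)

lemma psd_on_hermitian:
  assumes "psd_on I K" "i \<in> I" "j \<in> I"
  shows "K j i = cnj (K i j)"
proof (cases "i = j")
  case True
  then show ?thesis using psd_on_diag[OF assms(1,2)] by (simp add: less_eq_complex_def complex_eq_iff)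
next
  case False
  have d: "Im (K i i) = 0" "Im (K j j) = 0"
    using psd_on_diag[OF assms(1,2)] psd_on_diag[OF assms(1,3)] by (simp_all add: less_eq_complex_def)
  have "0 \<le> sesq_form {i,j} K (\<lambda>_. 1) (\<lambda>_. 1)"
    "0 \<le> sesq_form {i,j} K (\<lambda>x. if x = i then 1 else \<i>) (\<lambda>x. if x = i then 1 else \<i>)"
    by (rule psd_onD[OF assms(1)]; use assms in simp)+
  then show ?thesis using False d
    by (auto simp: sesq_form_def less_eq_complex_def complex_eq_iff)
qed

lemma sesq_form_commute:
  assumes "psd_on I K" "finite S" "S \<subseteq> I"
  shows "sesq_form S K c d = cnj (sesq_form S K d c)"
  unfolding sesq_form_def cnj_sum
proof (subst sum.swap, intro sum.cong refl)
  fix i j assume "i \<in> S" "j \<in> S"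
  then have "K j i = cnj (K i j)" using psd_on_hermitian[OF assms(1)] assms(3) by blast
  then show "cnj (c j) * K j i * d i = cnj (cnj (d i) * K i j * c j)" by simp
qed

text \<open>
  A vector of norm zero is orthogonal to all others; otherwise a large multiple of it would make
  the form negative.
\<close>

lemma psd_on_zero_diag:
  assumes "psd_on I K" "i \<in> I" "b \<in> I" "K b b = 0"
  shows "K i b = 0"
proof (rule ccontr)
  assume nz: "K i b \<noteq> 0"
  then have ib: "i \<noteq> b" using assms(4) by auto
  define r where "r = (Re (K i i) + 1) / (2 * (cmod (K i b))\<^sup>2)"
  let ?c = "\<lambda>x. if x = i then 1 else - of_real r * cnj (K i b)"
  have "0 \<le> sesq_form {i,b} K ?c ?c"
    by (rule psd_onD[OF assms(1)]) (use assms in auto)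
  moreover have "sesq_form {i,b} K ?c ?c = K i i - 2 * of_real (r * (cmod (K i b))\<^sup>2)"
    using ib assms(4) psd_on_hermitian[OF assms(1,2,3)]
    by (simp add: sesq_form_def complex_norm_square[symmetric] algebra_simps)
  ultimately have "0 \<le> Re (K i i) - 2 * (r * (cmod (K i b))\<^sup>2)"
    by (simp add: less_eq_complex_def)
  moreover have "2 * (r * (cmod (K i b))\<^sup>2) = Re (K i i) + 1"
    using nz by (simp add: r_def field_simps)
  ultimately show False by simp
qed

lemma psd_on_zero_side:
  assumes "psd_on I K" "i \<in> I" "b \<in> I" "K b b = 0"
  shows "K b i = 0"
  using psd_on_hermitian[OF assms(1-3)] psd_on_zero_diag[OF assms] by simp

text \<open>
  Completing the square in the coefficient at \<open>b\<close>: the minimum of the form over this coefficient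
  is the form of the Schur complement.
\<close>

lemma sesq_form_schur_complement:
  assumes K: "psd_on I K" and S: "finite S" "b \<in> S" "S \<subseteq> I" and nz: "K b b \<noteq> 0"
  shows "\<exists>t. sesq_form S (\<lambda>i j. K i j - K i b * K b j / K b b) c c
    = sesq_form S K (\<lambda>i. c i + (if i = b then t else 0)) (\<lambda>i. c i + (if i = b then t else 0))"
proof -
  have b: "b \<in> I" using S by auto
  define u where "u = (\<Sum>j\<in>S. K b j * c j)"
  have u': "(\<Sum>i\<in>S. cnj (c i) * K i b) = cnj u"
    unfolding u_def cnj_sum
  proof (rule sum.cong[OF refl])
    fix i assume "i \<in> S"
    then have "K i b = cnj (K b i)" using psd_on_hermitian[OF K b] S by blast
    then show "cnj (c i) * K i b = cnj (K b i * c i)" by simp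
  qed
  have re: "cnj (K b b) = K b b"
    using psd_on_hermitian[OF K b b] by simp
  define t where "t = - (u / K b b)"
  have ct: "cnj t = - (cnj u / K b b)" by (simp add: t_def re)
  let ?d = "\<lambda>i. if i = b then t else 0"
  have "sesq_form S K (\<lambda>i. c i + ?d i) (\<lambda>i. c i + ?d i)
    = sesq_form S K c c + sesq_form S K c ?d + (sesq_form S K ?d c + sesq_form S K ?d ?d)"
    by (simp only: sesq_form_add_left sesq_form_add_right)
  also have "sesq_form S K c ?d = t * cnj u"
    by (simp only: sesq_form_delta_right[OF S(1,2)] u')
  also have "sesq_form S K ?d c = cnj t * u"
    by (simp only: sesq_form_delta_left[OF S(1,2)] u_def)
  also have "sesq_form S K ?d ?d = cnj t * (K b b * t)"
    unfolding sesq_form_delta_left[OF S(1,2)] using S(1,2) by (simp add: if_distrib cong: if_cong)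
  also have "sesq_form S K c c + t * cnj u + (cnj t * u + cnj t * (K b b * t))
      = sesq_form S K c c - cnj u * u / K b b"
    using nz by (simp add: ct t_def)
  also have "\<dots> = sesq_form S (\<lambda>i j. K i j - K i b * (K b j / K b b)) c c"
  proof -
    have "(\<Sum>j\<in>S. K b j / K b b * c j) = u / K b b"
      by (simp add: u_def sum_divide_distrib)
    then show ?thesis unfolding sesq_form_kernel_diff sesq_form_rank_one u' by simp
  qed
  finally show ?thesis by (intro exI[of _ t]) simp
qed

text \<open>
  This is the Gram kernel of the projections onto the orthogonal complement of \<open>v\<^sub>b\<close>. If \<open>v\<^sub>b = 0\<close> the
  quotient is \<open>0\<close> by the convention for division by zero, which is the correct correction term.
\<close>

lemma psd_on_schur_complement:
  assumes K: "psd_on I K" and b: "b \<in> I"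
  shows "psd_on I (\<lambda>i j. K i j - K i b * K b j / K b b)"
proof (cases "K b b = 0")
  case True
  with K show ?thesis by simp
next
  case False
  show ?thesis
  proof (rule psd_on_superset[of "{b}"])
    fix S c assume S: "finite S" "{b} \<subseteq> S" "S \<subseteq> I"
    then show "0 \<le> sesq_form S (\<lambda>i j. K i j - K i b * K b j / K b b) c c"
      using sesq_form_schur_complement[of I K S b c] K False psd_onD[OF K S(1,3)] by auto
  qed (use b in auto)
qed

text \<open>
  The Schur complement of the two-by-two Gram kernel of \<open>a\<close> and \<open>c\<close>.
\<close>

lemma sesq_form_Cauchy_Schwarz:
  assumes K: "psd_on I K" and S: "finite S" "S \<subseteq> I"
  shows "0 \<le> sesq_form S K a a * sesq_form S K c c - sesq_form S K c a * sesq_form S K a c"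
proof -
  define A where "A x = (if x then c else a)" for x
  define L where "L x y = sesq_form S K (A x) (A y)" for x y
  have L: "psd_on UNIV L"
  proof (rule psd_on_superset[of UNIV])
    fix T :: "bool set" and b :: "bool \<Rightarrow> complex" assume "UNIV \<subseteq> T"
    then have T: "T = {False, True}" by auto
    have "sesq_form T L b b
        = sesq_form S K (\<lambda>i. b False * A False i + b True * A True i) (\<lambda>i. b False * A False i + b True * A True i)"
      unfolding sesq_form_add_left sesq_form_add_right sesq_form_scale_left sesq_form_scale_right
      by (simp add: T sesq_form_def[of "{False, True}"] L_def algebra_simps)
    then show "0 \<le> sesq_form T L b b" using psd_onD[OF K S] by simp
  qed auto
  have "0 \<le> L False False * (L True True - L True False * L False True / L False False)"
    by (intro mult_nonneg_nonneg psd_on_diag[OF L UNIV_I]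
        psd_on_diag[OF psd_on_schur_complement[OF L UNIV_I, of False] UNIV_I, of True])
  moreover have "L True False = 0" if "L False False = 0"
    using psd_on_zero_diag[OF L _ _ that] by simp
  ultimately have "0 \<le> L False False * L True True - L True False * L False True"
    by (cases "L False False = 0") (simp_all add: right_diff_distrib)
  then show ?thesis by (simp add: L_def A_def)
qed

text \<open>
  The Cholesky factorization: passing to the Schur complement at one index splits off a kernel of
  rank one and leaves a kernel on the remaining indices.
\<close>

lemma psd_on_gram_factor:
  assumes "finite S" "psd_on S K"
  shows "\<exists>w :: 'i \<Rightarrow> nat \<Rightarrow> complex. \<forall>i\<in>S. \<forall>j\<in>S. K i j = (\<Sum>m<card S. cnj (w i m) * w j m)"
  using assms
proof (induction S arbitrary: K rule: finite_induct)
  case empty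
  then show ?case by simp
next
  case (insert b S)
  let ?K = "\<lambda>i j. K i j - K i b * K b j / K b b"
  have "psd_on S ?K"
    using psd_on_schur_complement[OF insert.prems, of b] by (auto elim: psd_on_subset)
  then obtain w :: "'i \<Rightarrow> nat \<Rightarrow> complex"
    where w: "\<And>i j. i \<in> S \<Longrightarrow> j \<in> S \<Longrightarrow> ?K i j = (\<Sum>m<card S. cnj (w i m) * w j m)"
    using insert.IH by blast
  define r where "r = sqrt (Re (K b b))"
  have r: "K b b = of_real r * of_real r"
    using psd_on_diag[OF insert.prems, of b]
    by (simp add: r_def less_eq_complex_def complex_eq_iff)
  have z: "K i b = 0" "K b i = 0" if "K b b = 0" "i \<in> insert b S" for i
    using psd_on_zero_side[OF insert.prems, of i b] psd_on_zero_diag[OF insert.prems, of i b] that by simp_all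
  define w' where "w' i m = (if m = card S then K b i / of_real r else if i = b then 0 else w i m)" for i m
  have "K i j = (\<Sum>m<Suc (card S). cnj (w' i m) * w' j m)" if "i \<in> insert b S" "j \<in> insert b S" for i j
  proof -
    have 1: "cnj (K b i / of_real r) * (K b j / of_real r) = K i b * K b j / K b b"
      using psd_on_hermitian[OF insert.prems, of b i] that(1) by (simp add: r)
    have "?K i j = (\<Sum>m<card S. cnj (if i = b then 0 else w i m) * (if j = b then 0 else w j m))"
    proof (cases "i = b \<or> j = b")
      case True
      then show ?thesis using z[OF _ that(1)] z[OF _ that(2)] by (cases "K b b = 0") auto
    next
      case False
      then show ?thesis using w that by auto
    qed
    also have "\<dots> = (\<Sum>m<card S. cnj (w' i m) * w' j m)"
      by (rule sum.cong) (auto simp: w'_def)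
    finally have "K i j = (\<Sum>m<card S. cnj (w' i m) * w' j m) + K i b * K b j / K b b"
      by (simp add: algebra_simps)
    then show ?thesis using 1 by (simp add: w'_def)
  qed
  then show ?case using insert.hyps by auto
qed

text \<open>
  Multiplication by a kernel of rank one only rescales the coefficients of the form, and a positive
  semidefinite kernel is on finite sets a sum of kernels of rank one.
\<close>

theorem psd_on_schur_product:
  assumes "psd_on I K" "psd_on I L"
  shows "psd_on I (\<lambda>i j. K i j * L i j)"
  unfolding psd_on_def
proof (intro allI impI, elim conjE)
  fix S c assume S: "finite S" "S \<subseteq> I"
  obtain w :: "'a \<Rightarrow> nat \<Rightarrow> complex"
    where w: "\<And>i j. i \<in> S \<Longrightarrow> j \<in> S \<Longrightarrow> K i j = (\<Sum>m<card S. cnj (w i m) * w j m)"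
    using psd_on_gram_factor[OF S(1) psd_on_subset[OF assms(1) S(2)]] by blast
  have "sesq_form S (\<lambda>i j. K i j * L i j) c c
      = sesq_form S (\<lambda>i j. \<Sum>m<card S. cnj (w i m) * w j m * L i j) c c"
    by (rule sesq_form_cong) (auto simp: w sum_distrib_right)
  also have "\<dots> = (\<Sum>m<card S. sesq_form S L (\<lambda>i. w i m * c i) (\<lambda>i. w i m * c i))"
    unfolding sesq_form_kernel_sum by (simp add: sesq_form_def algebra_simps)
  also have "0 \<le> \<dots>"
    by (intro sum_nonneg psd_onD[OF assms(2)] S)
  finally show "0 \<le> sesq_form S (\<lambda>i j. K i j * L i j) c c" .
qed

text \<open>
  The map \<open>p\<close> may repeat indices; a Gram factorization is insensitive to that.
\<close>

lemma psd_on_pullback: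
  assumes "psd_on I K" "\<And>j. j \<in> J \<Longrightarrow> p j \<in> I"
  shows "psd_on J (\<lambda>i j. K (p i) (p j))"
  unfolding psd_on_finitary[of J]
proof (intro allI impI, elim conjE)
  fix S assume S: "finite S" "S \<subseteq> J"
  have "psd_on (p ` S) K" by (rule psd_on_subset[OF assms(1)]) (use S assms(2) in auto)
  then obtain w :: "_ \<Rightarrow> nat \<Rightarrow> complex"
    where w: "\<And>x y. x \<in> p ` S \<Longrightarrow> y \<in> p ` S \<Longrightarrow> K x y = (\<Sum>m<card (p ` S). cnj (w x m) * w y m)"
    using psd_on_gram_factor[of "p ` S" K] S(1) by blast
  have "psd_on S (\<lambda>i j. \<Sum>m<card (p ` S). cnj (w (p i) m) * w (p j) m)"
    by (intro psd_on_sum psd_on_rank_one)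
  then show "psd_on S (\<lambda>i j. K (p i) (p j))"
    by (rule psd_on_cong) (simp add: w)
qed

text \<open>
  The coefficients of the orthogonal projection of \<open>v\<^sub>a\<close> onto the span of the \<open>v\<^sub>j\<close>. They are found by
  eliminating the indices of \<open>S\<close> one at a time, so that linear dependence does no harm.
\<close>

lemma psd_on_column_in_range:
  assumes "finite S" "psd_on (insert a S) K"
  shows "\<exists>\<alpha>. \<forall>i\<in>S. K i a = (\<Sum>j\<in>S. K i j * \<alpha> j)"
  using assms
proof (induction S arbitrary: K rule: finite_induct)
  case empty
  then show ?case by simp
next
  case (insert b S)
  let ?K = "\<lambda>i j. K i j - K i b * K b j / K b b"
  have z: "K i b = 0" "K b i = 0" if "K b b = 0" "i \<in> insert a (insert b S)" for i
    using psd_on_zero_side[OF insert.prems, of i b] psd_on_zero_diag[OF insert.prems, of i b] that by simp_all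
  have "psd_on (insert a S) ?K"
    using psd_on_schur_complement[OF insert.prems, of b] by (auto elim!: psd_on_subset)
  then obtain \<alpha> where \<alpha>: "\<And>i. i \<in> S \<Longrightarrow> ?K i a = (\<Sum>j\<in>S. ?K i j * \<alpha> j)"
    using insert.IH by blast
  define \<beta> where "\<beta> = \<alpha>(b := (K b a - (\<Sum>j\<in>S. K b j * \<alpha> j)) / K b b)"
  have "K i a = (\<Sum>j\<in>insert b S. K i j * \<beta> j)" if i: "i \<in> insert b S" for i
  proof -
    have eq: "?K i a = (\<Sum>j\<in>S. ?K i j * \<alpha> j)"
    proof (cases "i = b")
      case True
      then show ?thesis using z insert.prems by (cases "K b b = 0") auto
    qed (use i \<alpha> in auto)
    have "(\<Sum>j\<in>insert b S. K i j * \<beta> j) = K i b * \<beta> b + (\<Sum>j\<in>S. K i j * \<beta> j)"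
      using insert.hyps by simp
    also have "(\<Sum>j\<in>S. K i j * \<beta> j) = (\<Sum>j\<in>S. K i j * \<alpha> j)"
      by (rule sum.cong) (use insert.hyps in \<open>auto simp: \<beta>_def\<close>)
    also have "K i b * \<beta> b = K i b * K b a / K b b - (\<Sum>j\<in>S. K i b * K b j / K b b * \<alpha> j)"
      by (simp add: \<beta>_def diff_divide_distrib algebra_simps sum_distrib_left sum_divide_distrib)
    finally have "(\<Sum>j\<in>insert b S. K i j * \<beta> j)
        = K i b * K b a / K b b + (\<Sum>j\<in>S. ?K i j * \<alpha> j)"
      by (simp add: left_diff_distrib sum_subtractf)
    then show ?thesis using eq by (metis add.commute diff_eq_eq)
  qed
  then show ?case by blast
qed

lemma psd_on_zero_row:
  assumes K: "psd_on S K" and z: "\<And>i. i \<in> insert a S \<Longrightarrow> K i a = 0" "\<And>i. i \<in> insert a S \<Longrightarrow> K a i = 0"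
  shows "psd_on (insert a S) K"
  unfolding psd_on_def
proof (intro allI impI, elim conjE)
  fix T c assume T: "finite T" "T \<subseteq> insert a S"
  let ?c = "\<lambda>i. if i = a then 0 else c i :: complex"
  have eq: "cnj (?c i) * K i j * ?c j = cnj (c i) * K i j * c j" if "i \<in> T" "j \<in> T" for i j
  proof -
    have "K i j = 0" if "i = a \<or> j = a"
      using that z[of i] z[of j] \<open>i \<in> T\<close> \<open>j \<in> T\<close> T(2) by blast
    then show ?thesis by auto
  qed
  have "sesq_form T K c c = sesq_form T K ?c ?c"
    unfolding sesq_form_def by (intro sum.cong refl) (rule eq[symmetric])
  also have "\<dots> = sesq_form (T - {a}) K ?c ?c"
    by (rule sesq_form_zero_extend) (use T in auto)
  also have "0 \<le> \<dots>"
    by (rule psd_onD[OF K]) (use T in auto)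
  finally show "0 \<le> sesq_form T K c c" .
qed

text \<open>
  The hypothesis says \<open>|\<langle>c, F\<rangle>|\<^sup>2 \<le> t \<parallel>\<Sum>\<^sub>j c\<^sub>j v\<^sub>j\<parallel>\<^sup>2\<close>, so \<open>F\<close> respects the linear relations between the
  \<open>v\<^sub>j\<close>. The proof adjoins \<open>F\<close> to \<open>t K\<close> as an additional column, indexed by \<open>None\<close>.
\<close>

lemma psd_on_bounded_in_range:
  assumes S: "finite S" and psd: "psd_on S (\<lambda>i j. t * K i j - F i * cnj (F j))"
  shows "\<exists>c. \<forall>i\<in>S. F i = (\<Sum>j\<in>S. K i j * c j)"
proof -
  define L where "L a b = (case a of
      None \<Rightarrow> (case b of None \<Rightarrow> 1 | Some j \<Rightarrow> cnj (F j))
    | Some i \<Rightarrow> (case b of None \<Rightarrow> F i | Some j \<Rightarrow> t * K i j))" for a b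
  define P where "P a b = (case a of None \<Rightarrow> 0 | Some i \<Rightarrow> (case b of None \<Rightarrow> 0
    | Some j \<Rightarrow> t * K i j - F i * cnj (F j)))" for a b
  define w where "w a = (case a of None \<Rightarrow> 1 | Some i \<Rightarrow> cnj (F i))" for a
  have "psd_on (Some ` S) (\<lambda>a b. t * K (the a) (the b) - F (the a) * cnj (F (the b)))"
    by (rule psd_on_pullback[OF psd]) auto
  then have "psd_on (Some ` S) P"
    by (rule psd_on_cong) (auto simp: P_def)
  then have "psd_on (insert None (Some ` S)) P"
    by (rule psd_on_zero_row) (auto simp: P_def split: option.splits)
  then have "psd_on (insert None (Some ` S)) (\<lambda>a b. P a b + cnj (w a) * w b)"
    by (intro psd_on_add psd_on_rank_one)
  then have "psd_on (insert None (Some ` S)) L"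
    by (rule psd_on_cong) (auto simp: P_def L_def w_def)
  then obtain \<alpha> where \<alpha>: "\<forall>a\<in>Some ` S. L a None = (\<Sum>b\<in>Some ` S. L a b * \<alpha> b)"
    using psd_on_column_in_range[of "Some ` S" None L] S by auto
  have "F i = (\<Sum>j\<in>S. K i j * (t * \<alpha> (Some j)))" if "i \<in> S" for i
    using \<alpha> that by (simp add: sum.reindex L_def mult_ac)
  then show ?thesis by (intro exI[of _ "\<lambda>j. t * \<alpha> (Some j)"]) simp
qed

text \<open>
  The vectors \<open>m\<^sub>j\<close> are the images of the Gram vectors \<open>v\<^sub>j\<close> of \<open>Q\<close> under a contraction on their span.
  Composing it with the orthogonal projection onto this span extends it to \<open>v\<^sub>a\<close>.
\<close>

lemma psd_on_contractive_extension:
  fixes m :: "'i \<Rightarrow> nat \<Rightarrow> complex"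
  assumes S: "finite S" "a \<notin> S" and Q: "psd_on (insert a S) Q"
    and le: "psd_on S (\<lambda>i j. Q i j - (\<Sum>n<N. cnj (m i n) * m j n))"
  shows "\<exists>m'. (\<forall>i\<in>S. m' i = m i) \<and>
    psd_on (insert a S) (\<lambda>i j. Q i j - (\<Sum>n<N. cnj (m' i n) * m' j n))"
proof -
  obtain \<alpha> where \<alpha>: "\<And>i. i \<in> S \<Longrightarrow> Q i a = (\<Sum>j\<in>S. Q i j * \<alpha> j)"
    using psd_on_column_in_range[OF S(1) Q] by blast
  define m' where "m' = m(a := (\<lambda>n. \<Sum>j\<in>S. \<alpha> j * m j n))"
  have "0 \<le> sesq_form (insert a S) (\<lambda>i j. Q i j - (\<Sum>n<N. cnj (m' i n) * m' j n)) c c" for c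
  proof -
    \<comment> \<open>Splits the combination into a vector \<open>c'\<close> of the span and a multiple of the component \<open>d\<close> of
        the new vector orthogonal to the span.\<close>
    define c' where "c' i = (if i = a then 0 else c i + c a * \<alpha> i)" for i
    define d where "d i = (if i = a then 1 else - \<alpha> i)" for i
    have c: "c = (\<lambda>i. c' i + c a * d i)"
      by (auto simp: c'_def d_def)
    have res: "(\<Sum>j\<in>insert a S. Q i j * d j) = 0" if "i \<in> S" for i
    proof -
      have "(\<Sum>j\<in>S. Q i j * d j) = (\<Sum>j\<in>S. - (Q i j * \<alpha> j))"
        by (rule sum.cong) (use S in \<open>auto simp: d_def\<close>)
      then show ?thesis using S \<alpha>[OF that] by (simp add: d_def sum_negf)
    qed
    have 1: "sesq_form (insert a S) Q c' d = 0"
    proof -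
      have "sesq_form (insert a S) Q c' d = (\<Sum>i\<in>insert a S. cnj (c' i) * (\<Sum>j\<in>insert a S. Q i j * d j))"
        by (simp add: sesq_form_def sum_distrib_left algebra_simps)
      also have "\<dots> = 0"
        by (rule sum.neutral) (use res in \<open>auto simp: c'_def\<close>)
      finally show ?thesis .
    qed
    have 2: "sesq_form (insert a S) Q d c' = 0"
      using sesq_form_commute[OF Q, of "insert a S" d c'] S(1) 1 by simp
    have Qc: "sesq_form (insert a S) Q c c = sesq_form S Q c' c' + cnj (c a) * c a * sesq_form (insert a S) Q d d"
    proof -
      have "sesq_form (insert a S) Q c' c' = sesq_form S Q c' c'"
        by (rule sesq_form_zero_extend) (use S in \<open>auto simp: c'_def\<close>)
      then show ?thesis
        by (subst (1 2) c) (simp only: sesq_form_add_left sesq_form_add_right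
            sesq_form_scale_left sesq_form_scale_right 1 2, simp)
    qed
    have L: "(\<Sum>j\<in>insert a S. m' j n * c j) = (\<Sum>j\<in>S. m j n * c' j)" for n
    proof -
      have "(\<Sum>j\<in>S. m' j n * c j) = (\<Sum>j\<in>S. m j n * c j)"
        by (rule sum.cong) (use S in \<open>auto simp: m'_def\<close>)
      moreover have "(\<Sum>j\<in>S. m j n * c' j) = (\<Sum>j\<in>S. m j n * c j) + (\<Sum>j\<in>S. \<alpha> j * m j n) * c a"
        unfolding sum_distrib_right sum.distrib[symmetric]
        by (rule sum.cong) (use S in \<open>auto simp: c'_def algebra_simps\<close>)
      ultimately show ?thesis using S by (simp add: m'_def)
    qed
    have L': "(\<Sum>j\<in>insert a S. cnj (c j) * cnj (m' j n)) = cnj (\<Sum>j\<in>S. m j n * c' j)" for n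
      unfolding L[symmetric] by (simp add: mult.commute)
    have L'': "(\<Sum>j\<in>S. cnj (c' j) * cnj (m j n)) = cnj (\<Sum>j\<in>S. m j n * c' j)" for n
      by (simp add: mult.commute)
    have "sesq_form (insert a S) (\<lambda>i j. Q i j - (\<Sum>n<N. cnj (m' i n) * m' j n)) c c
      = sesq_form S (\<lambda>i j. Q i j - (\<Sum>n<N. cnj (m i n) * m j n)) c' c'
        + cnj (c a) * c a * sesq_form (insert a S) Q d d"
      unfolding sesq_form_kernel_diff sesq_form_kernel_sum sesq_form_rank_one Qc L L' L'' by simp
    also have "0 \<le> \<dots>"
      by (intro add_nonneg_nonneg mult_nonneg_nonneg cnj_mult_nonneg psd_onD[OF le] psd_onD[OF Q])
        (use S in auto)
    finally show ?thesis .
  qed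
  then have "psd_on (insert a S) (\<lambda>i j. Q i j - (\<Sum>n<N. cnj (m' i n) * m' j n))"
    using S by (simp add: psd_on_finite)
  then show ?thesis using S by (intro exI[of _ m']) (auto simp: m'_def)
qed

lemma psd_mat_iff_psd_on: "psd_mat (mat n n (\<lambda>(i, j). K i j)) \<longleftrightarrow> psd_on {..<n} K"
proof -
  have eq: "(mat n n (\<lambda>(i, j). K i j) *\<^sub>v v) \<bullet>c v = sesq_form {..<n} K (vec_index v) (vec_index v)"
    if "v \<in> carrier_vec n" for v
    using that unfolding sesq_form_def
    by (auto simp: scalar_prod_def sum_distrib_right sum_distrib_left atLeast0LessThan algebra_simps
        intro!: sum.cong)
  show ?thesis
  proof
    assume psd: "psd_mat (mat n n (\<lambda>(i, j). K i j))"
    have "0 \<le> sesq_form {..<n} K c c" for c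
    proof -
      have "sesq_form {..<n} K c c = (mat n n (\<lambda>(i, j). K i j) *\<^sub>v vec n c) \<bullet>c vec n c"
        by (subst eq) (auto intro!: sesq_form_cong)
      then show ?thesis using psd by (simp add: psd_mat_def)
    qed
    then show "psd_on {..<n} K" by (simp add: psd_on_finite)
  next
    assume "psd_on {..<n} K"
    then show "psd_mat (mat n n (\<lambda>(i, j). K i j))"
      by (auto simp: psd_mat_def eq psd_on_finite)
  qed
qed

lemma pd_kernel_iff_psd_on: "pd_kernel k \<longleftrightarrow> psd_on UNIV k"
  unfolding pd_kernel_def psd_mat_iff_psd_on
proof
  assume k: "\<forall>n (z :: nat \<Rightarrow> 'a). psd_on {..<n} (\<lambda>i j. k (z i) (z j))"
  show "psd_on UNIV k"
    unfolding psd_on_finitary[of UNIV]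
  proof (intro allI impI, elim conjE)
    fix S :: "'a set" assume "finite S"
    then obtain z where z: "bij_betw z {..<card S} S"
      using ex_bij_betw_nat_finite[of S] by (auto simp: atLeast0LessThan)
    have "psd_on S (\<lambda>x y. k (z (inv_into {..<card S} z x)) (z (inv_into {..<card S} z y)))"
      by (rule psd_on_pullback[OF k[rule_format, of "card S" z]])
        (use bij_betw_apply[OF bij_betw_inv_into[OF z]] in auto)
    then show "psd_on S k"
      by (rule psd_on_cong) (use z in \<open>simp add: bij_betw_inv_into_right\<close>)
  qed
next
  assume "psd_on UNIV k"
  then have "psd_on {..<n} (\<lambda>i j. k (z i) (z j))" for n and z :: "nat \<Rightarrow> 'a"
    by (rule psd_on_pullback) simp
  then show "\<forall>n (z :: nat \<Rightarrow> 'a). psd_on {..<n} (\<lambda>i j. k (z i) (z j))" by blast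
qed

section \<open>Pick defects and tangential interpolation\<close>

definition gram :: "nat \<Rightarrow> ('i \<Rightarrow> nat \<Rightarrow> complex) \<Rightarrow> 'i \<Rightarrow> 'i \<Rightarrow> complex" where
  "gram N w i j = (\<Sum>m<N. cnj (w i m) * w j m)"

text \<open>
  With \<open>a\<close> fixed, \<open>s (1 - pick_defect s a)\<close> is the rank one kernel \<open>s(z,a) s(a,w) / s(a,a)\<close>, and
  \<open>s \<cdot> pick_defect s a\<close> is the Schur complement of \<open>s\<close> at \<open>a\<close>, the kernel of the functions in \<open>H\<^sub>s\<close>
  that vanish at \<open>a\<close>. Positivity of the defect is the McCullough--Quiggin condition.
\<close>

definition pick_defect :: "('x \<Rightarrow> 'x \<Rightarrow> complex) \<Rightarrow> 'x \<Rightarrow> 'x \<Rightarrow> 'x \<Rightarrow> complex" where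
  "pick_defect s a i j = 1 - s i a * s a j / (s a a * s i j)"

lemma schur_complement_eq_pick_defect:
  assumes "\<And>i j. s i j \<noteq> 0"
  shows "s i j - s i a * s a j / s a a = s i j * pick_defect s a i j"
  using assms by (simp add: pick_defect_def field_simps)

text \<open>
  The hypothesis says that \<open>s(\<cdot>,z) \<mapsto> s(\<cdot>,z) \<otimes> w(z)\<close> is a contraction on the span of the kernel
  functions. It maps \<open>s(\<cdot>,a)\<close> to \<open>s(\<cdot>,a) \<otimes> w(a)\<close>, so it induces a contraction between the orthogonal
  complements of \<open>s(\<cdot>,a)\<close>, in which \<open>w(a)\<close> is no longer visible.
\<close>

lemma psd_on_compress_tangential:
  assumes s: "psd_on UNIV s" and nz: "s a a \<noteq> 0" and S: "finite S"
    and le: "psd_on (insert a S) (\<lambda>i j. s i j * (1 - gram N w i j))"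
  shows "psd_on S (\<lambda>i j. (s i j - s i a * s a j / s a a) * (1 - gram N w i j))"
proof -
  let ?T = "insert a S" and ?s = "\<lambda>i j. s i j - s i a * s a j / s a a"
  have split: "sesq_form ?T (\<lambda>i j. K i j * (1 - gram N w i j)) c c
      = sesq_form ?T K c c - (\<Sum>m<N. sesq_form ?T K (\<lambda>i. w i m * c i) (\<lambda>i. w i m * c i))" for K c
  proof -
    have "sesq_form ?T (\<lambda>i j. K i j * (1 - gram N w i j)) c c
      = sesq_form ?T K c c - sesq_form ?T (\<lambda>i j. \<Sum>m<N. K i j * (cnj (w i m) * w j m)) c c"
      unfolding sesq_form_kernel_diff[symmetric]
      by (rule sesq_form_cong) (simp_all add: gram_def algebra_simps sum_distrib_left)
    also have "sesq_form ?T (\<lambda>i j. \<Sum>m<N. K i j * (cnj (w i m) * w j m)) c c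
      = (\<Sum>m<N. sesq_form ?T K (\<lambda>i. w i m * c i) (\<lambda>i. w i m * c i))"
      unfolding sesq_form_kernel_sum by (simp add: sesq_form_def algebra_simps)
    finally show ?thesis .
  qed
  have mono: "sesq_form ?T ?s d d \<le> sesq_form ?T s d d" for d
  proof -
    have "psd_on ?T (\<lambda>i j. (1 / s a a) * (cnj (s a i) * s a j))"
    proof (rule psd_on_scale[OF psd_on_rank_one])
      show "0 \<le> 1 / s a a"
        using psd_on_diag[OF s, of a] by (auto simp: less_eq_complex_def Re_divide Im_divide)
    qed
    then have "psd_on ?T (\<lambda>i j. s i a * s a j / s a a)"
      by (rule psd_on_cong) (use psd_on_hermitian[OF s UNIV_I UNIV_I, symmetric] in simp)
    then have "0 \<le> sesq_form ?T (\<lambda>i j. s i a * s a j / s a a) d d"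
      by (rule psd_onD) (use S in auto)
    moreover have "sesq_form ?T ?s d d = sesq_form ?T s d d - sesq_form ?T (\<lambda>i j. s i a * s a j / s a a) d d"
      by (rule sesq_form_kernel_diff)
    ultimately show ?thesis by simp
  qed
  have "psd_on ?T (\<lambda>i j. ?s i j * (1 - gram N w i j))"
    unfolding psd_on_finite[OF finite.insertI[OF S]]
  proof
    fix c
    obtain t where t: "sesq_form ?T ?s c c
        = sesq_form ?T s (\<lambda>i. c i + (if i = a then t else 0)) (\<lambda>i. c i + (if i = a then t else 0))"
      using sesq_form_schur_complement[OF s, of ?T a c] S nz by auto
    let ?c = "\<lambda>i. c i + (if i = a then t else 0)"
    have a0: "?s i a = 0" "?s a i = 0" for i using nz by simp_all
    \<comment> \<open>The Schur complement does not see the corrected coefficient at \<open>a\<close>.\<close>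
    have *: "sesq_form ?T ?s (\<lambda>i. w i m * c i) (\<lambda>i. w i m * c i)
        = sesq_form ?T ?s (\<lambda>i. w i m * ?c i) (\<lambda>i. w i m * ?c i)" for m
      unfolding sesq_form_def
    proof (intro sum.cong refl)
      fix i j
      show "cnj (w i m * c i) * ?s i j * (w j m * c j) = cnj (w i m * ?c i) * ?s i j * (w j m * ?c j)"
        using a0 by (cases "i = a"; cases "j = a") auto
    qed
    have "0 \<le> sesq_form ?T (\<lambda>i j. s i j * (1 - gram N w i j)) ?c ?c"
      by (rule psd_onD[OF le]) (use S in auto)
    also have "\<dots> = sesq_form ?T s ?c ?c - (\<Sum>m<N. sesq_form ?T s (\<lambda>i. w i m * ?c i) (\<lambda>i. w i m * ?c i))"
      by (rule split)
    also have "\<dots> \<le> sesq_form ?T ?s c c - (\<Sum>m<N. sesq_form ?T ?s (\<lambda>i. w i m * c i) (\<lambda>i. w i m * c i))"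
      unfolding t * by (intro diff_mono order_refl sum_mono mono)
    also have "\<dots> = sesq_form ?T (\<lambda>i j. ?s i j * (1 - gram N w i j)) c c"
      by (rule split[symmetric])
    finally show "0 \<le> sesq_form ?T (\<lambda>i j. ?s i j * (1 - gram N w i j)) c c" .
  qed
  then show ?thesis by (rule psd_on_subset) auto
qed

text \<open>
  The hypothesis \<open>ext\<close> is the Pick property for rows: data of finitely many points extend to one
  more point. The idea is to apply it to extremal data. In the induction step the defect based at a
  point \<open>c\<close> of the set is positive semidefinite by the induction hypothesis, as its row at \<open>c\<close> is zero,
  so it is the Gram kernel of some rows \<open>w\<close>. For these \<open>s (1 - gram w)\<close> has rank one; extending to \<open>a\<close>
  and compressing multiplies it by the defect based at \<open>a\<close>, and the rank one factor can be divided out.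
\<close>

theorem psd_on_pick_defect:
  fixes s :: "'x \<Rightarrow> 'x \<Rightarrow> complex"
  assumes s: "psd_on UNIV s" and nz: "\<And>i j. s i j \<noteq> 0"
    and ext: "\<And>S a N (w :: 'x \<Rightarrow> nat \<Rightarrow> complex). finite S \<Longrightarrow>
      psd_on S (\<lambda>i j. s i j * (1 - gram N w i j)) \<Longrightarrow>
      \<exists>M w'. (\<forall>i\<in>S. \<forall>j\<in>S. gram M w' i j = gram N w i j) \<and>
        psd_on (insert a S) (\<lambda>i j. s i j * (1 - gram M w' i j))"
  shows "psd_on UNIV (pick_defect s a)"
proof -
  have "psd_on S (pick_defect s a)" if "finite S" for S a
    using that
  proof (induction S arbitrary: a rule: finite_induct)
    case empty
    show ?case by (simp add: psd_on_def sesq_form_def)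
  next
    case (insert c S)
    let ?T = "insert c S"
    have T: "finite ?T" using insert.hyps by simp
    have h: "cnj (s c i) = s i c" for i c using psd_on_hermitian[OF s, of c i] by simp
    have pc: "psd_on ?T (pick_defect s c)"
      by (rule psd_on_zero_row[OF insert.IH]) (simp_all add: pick_defect_def nz)
    obtain w :: "'x \<Rightarrow> nat \<Rightarrow> complex"
      where w: "\<And>i j. i \<in> ?T \<Longrightarrow> j \<in> ?T \<Longrightarrow> pick_defect s c i j = gram (card ?T) w i j"
      using psd_on_gram_factor[OF T pc] unfolding gram_def by auto
    have cc: "0 \<le> 1 / s c c"
      using psd_on_diag[OF s, of c] by (auto simp: less_eq_complex_def Re_divide Im_divide)
    have rank: "s i j * (1 - pick_defect s c i j) = 1 / s c c * (cnj (s c i) * s c j)" for i j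
      using nz by (simp add: pick_defect_def h)
    have "psd_on ?T (\<lambda>i j. 1 / s c c * (cnj (s c i) * s c j))"
      by (rule psd_on_scale[OF psd_on_rank_one cc])
    then have pw: "psd_on ?T (\<lambda>i j. s i j * (1 - gram (card ?T) w i j))"
      by (rule psd_on_cong) (simp add: w[symmetric] rank)
    obtain M w' where w'': "\<forall>i\<in>?T. \<forall>j\<in>?T. gram M w' i j = gram (card ?T) w i j"
      and pw': "psd_on (insert a ?T) (\<lambda>i j. s i j * (1 - gram M w' i j))"
      using ext[OF T pw, of a] by blast
    from w'' have w': "\<And>i j. i \<in> ?T \<Longrightarrow> j \<in> ?T \<Longrightarrow> gram M w' i j = gram (card ?T) w i j"
      by blast
    from pw' have "psd_on ?T (\<lambda>i j. (s i j - s i a * s a j / s a a) * (1 - gram M w' i j))"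
      using psd_on_compress_tangential[OF s nz T] by blast
    then have "psd_on ?T (\<lambda>i j. pick_defect s a i j * (1 / s c c * (cnj (s c i) * s c j)))"
    proof (rule psd_on_cong)
      fix i j assume ij: "i \<in> ?T" "j \<in> ?T"
      have "(s i j - s i a * s a j / s a a) * (1 - gram M w' i j)
          = (s i j * pick_defect s a i j) * (1 - pick_defect s c i j)"
        using w[OF ij] w'[OF ij] schur_complement_eq_pick_defect[of s i j a] nz by metis
      then show "(s i j - s i a * s a j / s a a) * (1 - gram M w' i j)
          = pick_defect s a i j * (1 / s c c * (cnj (s c i) * s c j))"
        by (simp only: rank[symmetric]) (simp add: mult_ac)
    qed
    then have "psd_on ?T (\<lambda>i j. pick_defect s a i j * (1 / s c c * (cnj (s c i) * s c j))
        * (s c c * (cnj (1 / s c i) * (1 / s c j))))"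
      by (rule psd_on_schur_product[OF _ psd_on_scale[OF psd_on_rank_one psd_on_diag[OF s UNIV_I]]])
    then show ?case
      by (rule psd_on_cong) (simp add: nz h)
  qed
  then show ?thesis by (auto simp: psd_on_finitary[of UNIV])
qed

text \<open>
  The problem is to extend the operator \<open>s(\<cdot>,p i) \<otimes> \<kappa>\<^sub>i \<mapsto> s(\<cdot>,p i) \<otimes> f\<^sub>i\<close> contractively, where
  \<open>g i j = \<langle>\<kappa>\<^sub>j, \<kappa>\<^sub>i\<rangle>\<close>. Its range is split along \<open>s(\<cdot>,a)\<close> with \<open>a = p y\<close>. The component orthogonal to
  \<open>s(\<cdot>,a)\<close> does not depend on the unknown value \<open>f\<^sub>y\<close>; \<open>Q\<close> is the Gram kernel of the domain minus the one
  of this component, and it is positive semidefinite by positivity of the Pick defect. The component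
  along \<open>s(\<cdot>,a)\<close> is a contraction with respect to \<open>Q\<close> with values in a space of \<open>N\<close>-tuples, and these
  always extend (as in Parrott's theorem).
\<close>

lemma tangential_pick_one_point:
  fixes s :: "'x \<Rightarrow> 'x \<Rightarrow> complex" and f :: "'y \<Rightarrow> nat \<Rightarrow> complex"
  assumes s: "psd_on UNIV s" and nz: "\<And>i j. s i j \<noteq> 0"
    and pick: "\<And>a. psd_on UNIV (pick_defect s a)"
    and S: "finite S" "y \<notin> S" and g: "psd_on (insert y S) g"
    and f: "psd_on S (\<lambda>i j. s (p i) (p j) * (g i j - gram N f i j))"
  shows "\<exists>f'. (\<forall>i\<in>S. f' i = f i) \<and>
    psd_on (insert y S) (\<lambda>i j. s (p i) (p j) * (g i j - gram N f' i j))"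
proof -
  define a where "a = p y"
  let ?b = "\<lambda>i j. pick_defect s a (p i) (p j)"
  have h: "cnj (s c i) = s i c" for i c using psd_on_hermitian[OF s, of c i] by simp
  have b0: "?b y i = 0" "?b i y = 0" for i using nz by (simp_all add: pick_defect_def a_def)
  define r where "r = sqrt (Re (s a a))"
  have saa: "s a a = of_real r * of_real r"
    using psd_on_diag[OF s, of a] by (simp add: r_def less_eq_complex_def complex_eq_iff)
  have r0: "r \<noteq> 0" using saa nz[of a a] by auto
  define \<rho> where "\<rho> i = s a (p i) / of_real r" for i
  have \<rho>: "s (p i) (p j) * (1 - ?b i j) = cnj (\<rho> i) * \<rho> j" for i j
    using nz by (simp add: pick_defect_def \<rho>_def h saa)
  have \<rho>0: "\<rho> i \<noteq> 0" for i using r0 nz by (simp add: \<rho>_def)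
  define Q where "Q i j = cnj (\<rho> i) * \<rho> j * g i j + ?b i j * (s (p i) (p j) * (g i j - gram N f i j))" for i j
  have Q: "psd_on (insert y S) Q"
    unfolding Q_def
  proof (intro psd_on_add)
    show "psd_on (insert y S) (\<lambda>i j. cnj (\<rho> i) * \<rho> j * g i j)"
      by (intro psd_on_schur_product psd_on_rank_one g)
    show "psd_on (insert y S) (\<lambda>i j. ?b i j * (s (p i) (p j) * (g i j - gram N f i j)))"
    proof (rule psd_on_zero_row)
      have "psd_on S ?b" by (rule psd_on_pullback[OF pick]) simp
      then show "psd_on S (\<lambda>i j. ?b i j * (s (p i) (p j) * (g i j - gram N f i j)))"
        by (rule psd_on_schur_product) (rule f)
    qed (simp_all add: b0)
  qed
  define m where "m i n = \<rho> i * f i n" for i n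
  have gm: "(\<Sum>n<N. cnj (\<rho> i * v i n) * (\<rho> j * v j n)) = cnj (\<rho> i) * \<rho> j * gram N v i j" for i j v
    by (simp add: gram_def sum_distrib_left algebra_simps)
  have Qm: "Q i j - cnj (\<rho> i) * \<rho> j * gram N f i j = s (p i) (p j) * (g i j - gram N f i j)" for i j
  proof -
    have "Q i j - cnj (\<rho> i) * \<rho> j * gram N f i j
        = (cnj (\<rho> i) * \<rho> j + s (p i) (p j) * ?b i j) * (g i j - gram N f i j)"
      by (simp add: Q_def algebra_simps)
    also have "cnj (\<rho> i) * \<rho> j + s (p i) (p j) * ?b i j = s (p i) (p j)"
      unfolding \<rho>[symmetric] by (simp add: algebra_simps)
    finally show ?thesis .
  qed
  have "psd_on S (\<lambda>i j. Q i j - (\<Sum>n<N. cnj (m i n) * m j n))"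
    unfolding m_def gm Qm by (rule f)
  from psd_on_contractive_extension[OF S Q this] obtain m' where m': "\<And>i. i \<in> S \<Longrightarrow> m' i = m i"
    and ps: "psd_on (insert y S) (\<lambda>i j. Q i j - (\<Sum>n<N. cnj (m' i n) * m' j n))" by blast
  \<comment> \<open>Since \<open>\<rho> y = r \<noteq> 0\<close>, the extended vector determines the new value.\<close>
  define f' where "f' i n = m' i n / \<rho> i" for i n
  have ff: "f' i = f i" if "i \<in> S" for i
    using m'[OF that] \<rho>0 by (auto simp: f'_def m_def)
  have m'f: "m' = (\<lambda>i n. \<rho> i * f' i n)" using \<rho>0 by (auto simp: f'_def)
  have "psd_on (insert y S) (\<lambda>i j. s (p i) (p j) * (g i j - gram N f' i j))"
  proof (rule psd_on_cong[OF ps])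
    fix i j assume ij: "i \<in> insert y S" "j \<in> insert y S"
    show "Q i j - (\<Sum>n<N. cnj (m' i n) * m' j n) = s (p i) (p j) * (g i j - gram N f' i j)"
    proof (cases "i = y \<or> j = y")
      case True
      then have "?b i j = 0" using b0 by auto
      then have "Q i j = cnj (\<rho> i) * \<rho> j * g i j" "s (p i) (p j) = cnj (\<rho> i) * \<rho> j"
        using \<rho>[of i j] by (simp_all add: Q_def)
      then show ?thesis unfolding m'f gm by (simp add: algebra_simps)
    next
      case False
      then have "gram N f' i j = gram N f i j" using ij ff by (auto simp: gram_def)
      then show ?thesis unfolding m'f gm by (simp add: Qm)
    qed
  qed
  then show ?thesis using ff by blast
qed

lemma tangential_pick_finite:
  fixes s :: "'x \<Rightarrow> 'x \<Rightarrow> complex" and f :: "'y \<Rightarrow> nat \<Rightarrow> complex"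
  assumes s: "psd_on UNIV s" and nz: "\<And>i j. s i j \<noteq> 0"
    and pick: "\<And>a. psd_on UNIV (pick_defect s a)"
    and "finite T" "finite S" "psd_on (S \<union> T) g"
    and "psd_on S (\<lambda>i j. s (p i) (p j) * (g i j - gram N f i j))"
  shows "\<exists>f'. (\<forall>i\<in>S. f' i = f i) \<and>
    psd_on (S \<union> T) (\<lambda>i j. s (p i) (p j) * (g i j - gram N f' i j))"
  using assms(4-)
proof (induction T rule: finite_induct)
  case empty
  then show ?case by auto
next
  case (insert y T)
  have "psd_on (S \<union> T) g" using insert.prems(2) by (rule psd_on_subset) auto
  then obtain f' where f': "\<forall>i\<in>S. f' i = f i"
    and ps: "psd_on (S \<union> T) (\<lambda>i j. s (p i) (p j) * (g i j - gram N f' i j))"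
    using insert by blast
  show ?case
  proof (cases "y \<in> S \<union> T")
    case True
    then have "S \<union> insert y T = S \<union> T" by auto
    then show ?thesis using f' ps by auto
  next
    case False
    have "psd_on (insert y (S \<union> T)) g" using insert.prems(2) by simp
    then obtain f'' where "\<forall>i\<in>S \<union> T. f'' i = f' i"
      "psd_on (insert y (S \<union> T)) (\<lambda>i j. s (p i) (p j) * (g i j - gram N f'' i j))"
      using tangential_pick_one_point[OF s nz pick _ False _ ps] insert.prems insert.hyps by auto
    then show ?thesis using f' by (intro exI[of _ f'']) auto
  qed
qed

lemma closed_psd_on:
  assumes "finite S" "\<And>i j. i \<in> S \<Longrightarrow> j \<in> S \<Longrightarrow> continuous_on UNIV (\<lambda>x. K x i j)"
  shows "closed {x. psd_on S (K x)}"
proof -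
  have "continuous_on UNIV (\<lambda>x. sesq_form S (K x) c c)" for c
    unfolding sesq_form_def by (intro continuous_intros assms)
  then have "closed {x. 0 \<le> Re (sesq_form S (K x) c c) \<and> Im (sesq_form S (K x) c c) = 0}" for c
    by (intro closed_Collect_conj closed_Collect_le closed_Collect_eq continuous_intros)
  then have "closed (\<Inter>c. {x. 0 \<le> Re (sesq_form S (K x) c c) \<and> Im (sesq_form S (K x) c c) = 0})"
    by (intro closed_INT) auto
  moreover have "{x. psd_on S (K x)}
      = (\<Inter>c. {x. 0 \<le> Re (sesq_form S (K x) c c) \<and> Im (sesq_form S (K x) c c) = 0})"
    using assms(1) by (auto simp: psd_on_finite less_eq_complex_def)
  ultimately show ?thesis by simp
qed

lemma compact_complex_square: "compact {z::complex. \<bar>Re z\<bar> \<le> r \<and> \<bar>Im z\<bar> \<le> r}"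
proof -
  have "compact ((\<lambda>p. Complex (fst p) (snd p)) ` ({-r..r} \<times> {-r..r}))"
    by (intro compact_continuous_image compact_Times compact_Icc)
      (auto intro!: continuous_intros simp: Complex_eq)
  moreover have "(\<lambda>p. Complex (fst p) (snd p)) ` ({-r..r} \<times> {-r..r}) = {z. \<bar>Re z\<bar> \<le> r \<and> \<bar>Im z\<bar> \<le> r}"
  proof (intro Set.set_eqI iffI)
    fix z :: complex assume "z \<in> {z. \<bar>Re z\<bar> \<le> r \<and> \<bar>Im z\<bar> \<le> r}"
    then show "z \<in> (\<lambda>p. Complex (fst p) (snd p)) ` ({-r..r} \<times> {-r..r})"
      by (intro image_eqI[of _ _ "(Re z, Im z)"]) auto
  qed auto
  ultimately show ?thesis by simp
qed

text \<open>
  Any solution on a finite set is bounded by the diagonal of \<open>g\<close>, so all solutions lie in one product of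
  compact squares. Being a solution is a closed condition on finitely many coordinates,
  and finitely many such conditions are compatible by the finite case.
\<close>

theorem tangential_pick_interpolation:
  fixes s :: "'x \<Rightarrow> 'x \<Rightarrow> complex" and f :: "'y \<Rightarrow> nat \<Rightarrow> complex"
  assumes s: "psd_on UNIV s" and nz: "\<And>i j. s i j \<noteq> 0"
    and pick: "\<And>a. psd_on UNIV (pick_defect s a)"
    and g: "psd_on Y g" and Y0: "Y0 \<subseteq> Y"
    and f: "psd_on Y0 (\<lambda>i j. s (p i) (p j) * (g i j - gram N f i j))"
  shows "\<exists>f'. (\<forall>i\<in>Y0. \<forall>n<N. f' i n = f i n) \<and>
    psd_on Y (\<lambda>i j. s (p i) (p j) * (g i j - gram N f' i j))"
proof -
  define K where "K x i j = s (p i) (p j) * (g i j - gram N (curry x) i j)" for x :: "'y \<times> nat \<Rightarrow> complex" and i j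
  define C where "C S = {x. psd_on S (K x)} \<inter> {x. \<forall>i\<in>S \<inter> Y0. \<forall>n<N. x (i, n) = f i n}" for S
  \<comment> \<open>Coordinates outside the problem are confined to \<open>0\<close> to keep the product compact.\<close>
  define r where "r q = (if fst q \<in> Y \<and> snd q < N then sqrt (Re (g (fst q) (fst q))) else 0)" for q :: "'y \<times> nat"
  define B where "B = (\<Pi>\<^sub>E q\<in>UNIV. {z. \<bar>Re z\<bar> \<le> r q \<and> \<bar>Im z\<bar> \<le> r q})"
  have "compactin (product_topology (\<lambda>_. euclidean) UNIV) B"
    unfolding B_def compactin_PiE by (auto simp: compact_complex_square)
  then have compB: "compact B" by (simp add: euclidean_product_topology)
  have closC: "closed (C S)" if "finite S" for S
    unfolding C_def
  proof (intro closed_Int closed_psd_on that)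
    show "continuous_on UNIV (\<lambda>x. K x i j)" for i j
      unfolding K_def gram_def curry_def by (intro continuous_intros continuous_on_product_coordinates)
    have eq: "{x. \<forall>i\<in>S \<inter> Y0. \<forall>n<N. x (i, n) = f i n} = (\<Inter>i\<in>S \<inter> Y0. \<Inter>n\<in>{..<N}. {x. x (i, n) = f i n})"
      by auto
    show "closed {x. \<forall>i\<in>S \<inter> Y0. \<forall>n<N. x (i, n) = f i n}"
      unfolding eq by (intro closed_INT ballI closed_Collect_eq continuous_on_product_coordinates continuous_intros)
  qed
  have fip: "B \<inter> (\<Inter>S\<in>\<S>. C S) \<noteq> {}" if \<S>: "finite \<S>" "\<S> \<subseteq> {S. finite S \<and> S \<subseteq> Y}" for \<S>
  proof -
    let ?T = "\<Union>\<S>"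
    have T: "finite ?T" "?T \<subseteq> Y" using \<S> by auto
    have "\<exists>f'. (\<forall>i\<in>?T \<inter> Y0. f' i = f i) \<and>
        psd_on (?T \<inter> Y0 \<union> ?T) (\<lambda>i j. s (p i) (p j) * (g i j - gram N f' i j))"
      by (rule tangential_pick_finite[OF s nz pick])
        (use T g f in \<open>auto intro: psd_on_subset\<close>)
    then obtain f' where f': "\<And>i. i \<in> ?T \<Longrightarrow> i \<in> Y0 \<Longrightarrow> f' i = f i"
      and "psd_on (?T \<inter> Y0 \<union> ?T) (\<lambda>i j. s (p i) (p j) * (g i j - gram N f' i j))" by auto
    then have ps: "psd_on ?T (\<lambda>i j. s (p i) (p j) * (g i j - gram N f' i j))"
      by (auto elim: psd_on_subset)
    define x where "x = (\<lambda>(i, n). if i \<in> ?T \<and> n < N then f' i n else 0)"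
    have "psd_on ?T (K x)"
      by (rule psd_on_cong[OF ps]) (auto simp: K_def x_def gram_def curry_def intro!: sum.cong)
    then have "x \<in> C S" if "S \<in> \<S>" for S
      using that T f' unfolding C_def by (auto elim!: psd_on_subset simp: x_def)
    moreover have "x \<in> B"
    proof -
      have "\<bar>Re (x q)\<bar> \<le> r q \<and> \<bar>Im (x q)\<bar> \<le> r q" for q
      proof (cases "fst q \<in> ?T \<and> snd q < N")
        case True
        define i n where "i = fst q" and "n = snd q"
        have i: "i \<in> ?T" "n < N" "i \<in> Y" using True T by (auto simp: i_def n_def)
        have sp: "0 \<le> s (p i) (p i)" by (rule psd_on_diag[OF s]) simp
        then have sp: "0 < Re (s (p i) (p i))" "Im (s (p i) (p i)) = 0"
          using nz[of "p i" "p i"] by (auto simp: less_eq_complex_def complex_eq_iff)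
        have "0 \<le> s (p i) (p i) * (g i i - gram N f' i i)"
          using psd_on_diag[OF ps i(1)] .
        then have "0 \<le> Re (g i i - gram N f' i i)"
          using sp by (auto simp: less_eq_complex_def zero_le_mult_iff)
        moreover have "Re (gram N f' i i) = (\<Sum>n<N. (cmod (f' i n))\<^sup>2)"
          by (simp add: gram_def cmod_power2 power2_eq_square[of "Re _"] power2_eq_square[of "Im _"] sum.distrib)
        ultimately have "(\<Sum>n<N. (cmod (f' i n))\<^sup>2) \<le> Re (g i i)" by simp
        moreover have "(cmod (f' i n))\<^sup>2 \<le> (\<Sum>n<N. (cmod (f' i n))\<^sup>2)"
          by (rule member_le_sum) (use i in auto)
        ultimately have "cmod (f' i n) \<le> sqrt (Re (g i i))"
          by (intro real_le_rsqrt) simp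
        moreover have "x q = f' i n" "r q = sqrt (Re (g i i))"
          using i by (auto simp: x_def r_def i_def n_def split_beta)
        ultimately show ?thesis
          using abs_Re_le_cmod[of "x q"] abs_Im_le_cmod[of "x q"] by auto
      next
        case False
        have "0 \<le> r q" using psd_on_diag[OF g] by (auto simp: r_def less_eq_complex_def)
        then show ?thesis using False by (auto simp: x_def split_beta)
      qed
      then show ?thesis by (auto simp: B_def)
    qed
    ultimately show ?thesis by blast
  qed
  have "B \<inter> (\<Inter>S\<in>{S. finite S \<and> S \<subseteq> Y}. C S) \<noteq> {}"
    by (rule compact_imp_fip_image[OF compB _ fip]) (auto intro: closC)
  then obtain x where x: "\<And>S. finite S \<Longrightarrow> S \<subseteq> Y \<Longrightarrow> x \<in> C S" by blast
  then have "psd_on Y (K x)"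
    by (subst psd_on_finitary) (auto simp: C_def)
  moreover have "curry x i n = f i n" if "i \<in> Y0" "n < N" for i n
    using x[of "{i}"] that Y0 by (auto simp: C_def)
  ultimately show ?thesis
    unfolding K_def by (intro exI[of _ "curry x"]) auto
qed

section \<open>Hilbert spaces and the moment problem\<close>

context hilbert_space
begin

lemma zero_closed [simp]: "0 \<in> carrier H"
  and add_closed [simp]: "x \<in> carrier H \<Longrightarrow> y \<in> carrier H \<Longrightarrow> x + y \<in> carrier H"
  and scaleC_closed [simp]: "x \<in> carrier H \<Longrightarrow> c *\<^sub>C x \<in> carrier H"
  and diff_closed [simp]: "x \<in> carrier H \<Longrightarrow> y \<in> carrier H \<Longrightarrow> x - y \<in> carrier H"
  using subspace by (auto intro: complex_vector.subspace_0 complex_vector.subspace_add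
      complex_vector.subspace_scale complex_vector.subspace_diff)

lemma sum_closed [simp]: "(\<And>i. i \<in> S \<Longrightarrow> v i \<in> carrier H) \<Longrightarrow> (\<Sum>i\<in>S. v i) \<in> carrier H"
  using subspace by (auto intro: complex_vector.subspace_sum)

lemma cinner_add_right:
  assumes "x \<in> carrier H" "y \<in> carrier H" "z \<in> carrier H"
  shows "cinner H z (x + y) = cinner H z x + cinner H z y"
proof -
  have "cinner H z (x + y) = cnj (cinner H (x + y) z)"
    by (rule cinner_commute) (use assms in auto)
  also have "\<dots> = cnj (cinner H x z) + cnj (cinner H y z)"
    using assms by (simp add: cinner_add_left)
  also have "\<dots> = cinner H z x + cinner H z y"
    using assms cinner_commute[of z x] cinner_commute[of z y] by simp
  finally show ?thesis .
qed

lemma cinner_scaleC_right: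
  assumes "x \<in> carrier H" "y \<in> carrier H"
  shows "cinner H x (c *\<^sub>C y) = cnj c * cinner H x y"
proof -
  have "cinner H x (c *\<^sub>C y) = cnj (cinner H (c *\<^sub>C y) x)"
    by (rule cinner_commute) (use assms in auto)
  also have "\<dots> = cnj c * cnj (cinner H y x)"
    using assms by (simp add: cinner_scaleC_left)
  also have "cnj (cinner H y x) = cinner H x y"
    using assms cinner_commute[of x y] by simp
  finally show ?thesis .
qed

lemma cinner_zero_left [simp]: "x \<in> carrier H \<Longrightarrow> cinner H 0 x = 0"
  using cinner_scaleC_left[of 0 x 0] by simp

lemma cinner_zero_right [simp]: "x \<in> carrier H \<Longrightarrow> cinner H x 0 = 0"
  using cinner_scaleC_right[of x 0 0] by simp

lemma cinner_diff_left:
  assumes "x \<in> carrier H" "y \<in> carrier H" "z \<in> carrier H"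
  shows "cinner H (x - y) z = cinner H x z - cinner H y z"
  using cinner_add_left[of "x - y" y z] assms by simp

lemma cinner_diff_right:
  assumes "x \<in> carrier H" "y \<in> carrier H" "z \<in> carrier H"
  shows "cinner H z (x - y) = cinner H z x - cinner H z y"
  using cinner_add_right[of "x - y" y z] assms by simp

lemma cinner_sum_left:
  assumes "finite S" "\<And>i. i \<in> S \<Longrightarrow> v i \<in> carrier H" "z \<in> carrier H"
  shows "cinner H (\<Sum>i\<in>S. c i *\<^sub>C v i) z = (\<Sum>i\<in>S. c i * cinner H (v i) z)"
  using assms
  by (induction S rule: finite_induct) (auto simp: cinner_add_left cinner_scaleC_left)

lemma cinner_sum_right:
  assumes "finite S" "\<And>i. i \<in> S \<Longrightarrow> v i \<in> carrier H" "z \<in> carrier H"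
  shows "cinner H z (\<Sum>i\<in>S. c i *\<^sub>C v i) = (\<Sum>i\<in>S. cnj (c i) * cinner H z (v i))"
  using assms
  by (induction S rule: finite_induct) (auto simp: cinner_add_right cinner_scaleC_right)

lemma cinner_self_nonneg: "x \<in> carrier H \<Longrightarrow> 0 \<le> cinner H x x"
  using cinner_pos[of x] cinner_commute[of x x]
  by (cases "x = 0") (auto simp: less_eq_complex_def complex_eq_iff)

lemma hnorm_nonneg [simp]: "x \<in> carrier H \<Longrightarrow> 0 \<le> hnorm H x"
  using cinner_self_nonneg[of x] by (simp add: hnorm_def less_eq_complex_def)

lemma hnorm_zero [simp]: "hnorm H 0 = 0"
  by (simp add: hnorm_def)

lemma hnorm_eq_zero_iff: "x \<in> carrier H \<Longrightarrow> hnorm H x = 0 \<longleftrightarrow> x = 0"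
  using cinner_pos[of x] by (cases "x = 0") (auto simp: hnorm_def)

lemma cinner_self: "x \<in> carrier H \<Longrightarrow> cinner H x x = of_real ((hnorm H x)\<^sup>2)"
  using cinner_self_nonneg[of x] by (simp add: hnorm_def less_eq_complex_def complex_eq_iff)

lemma sesq_form_cinner:
  assumes "finite S" "\<And>i. i \<in> S \<Longrightarrow> v i \<in> carrier H"
  shows "sesq_form S (\<lambda>i j. cinner H (v j) (v i)) c d
    = cinner H (\<Sum>i\<in>S. d i *\<^sub>C v i) (\<Sum>i\<in>S. c i *\<^sub>C v i)"
proof -
  have "cinner H (\<Sum>i\<in>S. d i *\<^sub>C v i) (\<Sum>i\<in>S. c i *\<^sub>C v i)
      = (\<Sum>i\<in>S. cnj (c i) * (\<Sum>j\<in>S. d j * cinner H (v j) (v i)))"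
    using assms by (subst cinner_sum_right) (auto simp: cinner_sum_left)
  then show ?thesis
    by (simp add: sesq_form_def sum_distrib_left mult_ac)
qed

lemma psd_on_cinner:
  assumes "\<And>i. i \<in> I \<Longrightarrow> v i \<in> carrier H"
  shows "psd_on I (\<lambda>i j. cinner H (v j) (v i))"
  unfolding psd_on_def
proof (intro allI impI, elim conjE)
  fix S and c :: "_ \<Rightarrow> complex" assume S: "finite S" "S \<subseteq> I"
  have v: "v i \<in> carrier H" if "i \<in> S" for i using assms S that by auto
  have "sesq_form S (\<lambda>i j. cinner H (v j) (v i)) c c
      = cinner H (\<Sum>i\<in>S. c i *\<^sub>C v i) (\<Sum>i\<in>S. c i *\<^sub>C v i)"
    by (rule sesq_form_cinner) (use S v in auto)
  also have "0 \<le> \<dots>" by (rule cinner_self_nonneg) (use v in auto)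
  finally show "0 \<le> sesq_form S (\<lambda>i j. cinner H (v j) (v i)) c c" .
qed

lemma Cauchy_Schwarz:
  assumes "x \<in> carrier H" "y \<in> carrier H"
  shows "cmod (cinner H x y) \<le> hnorm H x * hnorm H y"
proof (cases "y = 0")
  case False
  define a where "a = hnorm H y"
  have a: "a > 0" using False assms hnorm_eq_zero_iff[of y] hnorm_nonneg[of y] by (auto simp: a_def less_le)
  have c: "cinner H y x = cnj (cinner H x y)" by (rule cinner_commute[OF assms(2,1)])
  define t where "t = cinner H x y / of_real (a\<^sup>2)"
  have "cinner H (x - t *\<^sub>C y) (x - t *\<^sub>C y)
      = cinner H x x - cnj t * cinner H x y - t * (cnj (cinner H x y) - cnj t * cinner H y y)"
    using assms
    by (simp add: cinner_diff_left cinner_diff_right cinner_scaleC_left cinner_scaleC_right c algebra_simps)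
  also have "\<dots> = of_real ((hnorm H x)\<^sup>2) - cinner H x y * cnj (cinner H x y) / of_real (a\<^sup>2)"
    unfolding cinner_self[OF assms(1)] cinner_self[OF assms(2)] a_def[symmetric]
    using a by (simp add: t_def field_simps)
  also have "cinner H x y * cnj (cinner H x y) = of_real ((cmod (cinner H x y))\<^sup>2)"
    by (simp only: complex_norm_square)
  finally have "0 \<le> (hnorm H x)\<^sup>2 - (cmod (cinner H x y))\<^sup>2 / a\<^sup>2"
    using cinner_self_nonneg[of "x - t *\<^sub>C y"] assms by (simp add: less_eq_complex_def flip: of_real_divide)
  then have "(cmod (cinner H x y))\<^sup>2 \<le> (hnorm H x * a)\<^sup>2"
    using a by (simp add: field_simps power_mult_distrib)
  then show ?thesis
    using a assms by (auto simp: a_def intro: power2_le_imp_le)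
qed (use assms in auto)

lemma hnorm_scaleC: "x \<in> carrier H \<Longrightarrow> hnorm H (c *\<^sub>C x) = cmod c * hnorm H x"
proof -
  assume x: "x \<in> carrier H"
  have "cinner H (c *\<^sub>C x) (c *\<^sub>C x) = of_real ((cmod c * hnorm H x)\<^sup>2)"
  proof -
    have "cinner H (c *\<^sub>C x) (c *\<^sub>C x) = c * cnj c * of_real ((hnorm H x)\<^sup>2)"
      using x cinner_self[OF x] by (simp add: cinner_scaleC_left cinner_scaleC_right mult.assoc del: of_real_power)
    then show ?thesis by (simp only: complex_norm_square[symmetric] power_mult_distrib of_real_mult)
  qed
  then show ?thesis using x by (simp only: hnorm_def[of H "c *\<^sub>C x"] Re_complex_of_real) (simp add: real_sqrt_unique)
qed

lemma hnorm_triangle: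
  assumes "x \<in> carrier H" "y \<in> carrier H"
  shows "hnorm H (x + y) \<le> hnorm H x + hnorm H y"
proof (rule power2_le_imp_le)
  have "cinner H (x + y) (x + y) = cinner H x x + cinner H x y + (cnj (cinner H x y) + cinner H y y)"
    using assms cinner_commute[of y x] by (simp add: cinner_add_left cinner_add_right)
  then have "(hnorm H (x + y))\<^sup>2 = (hnorm H x)\<^sup>2 + 2 * Re (cinner H x y) + (hnorm H y)\<^sup>2"
    using assms by (simp add: cinner_self complex_eq_iff)
  also have "Re (cinner H x y) \<le> hnorm H x * hnorm H y"
    using complex_Re_le_cmod Cauchy_Schwarz[OF assms] by (rule order_trans)
  finally show "(hnorm H (x + y))\<^sup>2 \<le> (hnorm H x + hnorm H y)\<^sup>2"
    by (simp add: power2_sum)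
qed (use assms in auto)

lemma hnorm_minus_commute:
  assumes "x \<in> carrier H" "y \<in> carrier H"
  shows "hnorm H (x - y) = hnorm H (y - x)"
  using hnorm_scaleC[of "y - x" "-1"] assms by simp

lemma tendsto_cinner_left:
  assumes "\<And>n. u n \<in> carrier H" "x \<in> carrier H" "y \<in> carrier H"
    and "(\<lambda>n. hnorm H (u n - x)) \<longlonglongrightarrow> 0"
  shows "(\<lambda>n. cinner H (u n) y) \<longlonglongrightarrow> cinner H x y"
proof -
  have "(\<lambda>n. hnorm H (u n - x) * hnorm H y) \<longlonglongrightarrow> 0"
    using tendsto_mult_right[OF assms(4), of "hnorm H y"] by simp
  moreover have "norm (cinner H (u n) y - cinner H x y) \<le> norm (hnorm H (u n - x) * hnorm H y) * 1" for n
    using Cauchy_Schwarz[of "u n - x" y] assms(1)[of n] assms(2,3) by (simp add: cinner_diff_left)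
  ultimately have "(\<lambda>n. cinner H (u n) y - cinner H x y) \<longlonglongrightarrow> 0"
    by (rule tendsto_0_le[OF _ always_eventually[OF allI]])
  then show ?thesis by (rule LIM_zero_cancel)
qed

text \<open>
  The hypothesis makes the system for the coefficients of a solution in the span solvable. The
  norm \<open>n\<close> of this solution satisfies \<open>n\<^sup>4 \<le> C\<^sup>2 n\<^sup>2\<close>, because its pairing with \<open>F\<close> is \<open>n\<^sup>2\<close>.
\<close>

lemma moment_finite:
  assumes S: "finite S" "\<And>i. i \<in> S \<Longrightarrow> v i \<in> carrier H" and C: "0 \<le> C"
    and psd: "psd_on S (\<lambda>i j. of_real (C\<^sup>2) * cinner H (v j) (v i) - F i * cnj (F j))"
  shows "\<exists>c. (\<forall>i\<in>S. cinner H (\<Sum>j\<in>S. c j *\<^sub>C v j) (v i) = F i) \<and> hnorm H (\<Sum>j\<in>S. c j *\<^sub>C v j) \<le> C"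
proof -
  obtain c where c: "\<And>i. i \<in> S \<Longrightarrow> F i = (\<Sum>j\<in>S. cinner H (v j) (v i) * c j)"
    using psd_on_bounded_in_range[OF S(1) psd] by blast
  let ?p = "\<Sum>j\<in>S. c j *\<^sub>C v j"
  have p: "?p \<in> carrier H" using S by auto
  have F: "cinner H ?p (v i) = F i" if "i \<in> S" for i
    using c[OF that] that S by (simp add: cinner_sum_left mult.commute)
  define L where "L = (\<Sum>i\<in>S. cnj (c i) * F i)"
  have L: "L = of_real ((hnorm H ?p)\<^sup>2)"
  proof -
    have "cinner H ?p ?p = (\<Sum>i\<in>S. cnj (c i) * cinner H ?p (v i))"
      by (rule cinner_sum_right) (use S p in auto)
    then show ?thesis unfolding cinner_self[OF p] L_def by (simp add: F)
  qed
  have "0 \<le> sesq_form S (\<lambda>i j. of_real (C\<^sup>2) * cinner H (v j) (v i) - F i * cnj (F j)) c c"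
    by (rule psd_onD[OF psd]) (use S in auto)
  also have "\<dots> = of_real (C\<^sup>2) * cinner H ?p ?p - L * cnj L"
  proof -
    have 1: "sesq_form S (\<lambda>i j. cinner H (v j) (v i)) c c = cinner H ?p ?p"
      by (rule sesq_form_cinner) (use S in auto)
    have 2: "(\<Sum>j\<in>S. cnj (F j) * c j) = cnj L" by (simp add: L_def mult.commute)
    show ?thesis
      unfolding sesq_form_kernel_diff sesq_form_kernel_scale sesq_form_rank_one 1 2 L_def[symmetric] ..
  qed
  also have "\<dots> = of_real (C\<^sup>2 * (hnorm H ?p)\<^sup>2 - (hnorm H ?p)\<^sup>2 * (hnorm H ?p)\<^sup>2)"
    using p by (simp add: L cinner_self)
  finally have "(hnorm H ?p)\<^sup>2 * (hnorm H ?p)\<^sup>2 \<le> C\<^sup>2 * (hnorm H ?p)\<^sup>2"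
    by (simp only: less_eq_complex_def) simp
  then have "hnorm H ?p \<le> C"
  proof (cases "hnorm H ?p = 0")
    case False
    have "(hnorm H ?p)\<^sup>2 \<le> C\<^sup>2"
      by (rule mult_right_le_imp_le[OF \<open>(hnorm H ?p)\<^sup>2 * (hnorm H ?p)\<^sup>2 \<le> C\<^sup>2 * (hnorm H ?p)\<^sup>2\<close>])
        (use False in simp)
    then show ?thesis using C by (rule power2_le_imp_le)
  qed (use C in simp)
  then show ?thesis using F by blast
qed

text \<open>
  For a finite set \<open>S\<close> of indices let \<open>p S\<close> be the solution in the span of the \<open>v i\<close>. For \<open>S \<subseteq> T\<close> it is the
  projection of \<open>p T\<close>, so the norms increase with \<open>S\<close> and, by Pythagoras, an increasing sequence
  of sets that exhausts the supremum \<open>d\<close> of the squared norms yields a Cauchy sequence. Its limit solves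
  the equations for all indices, since adding one more index to \<open>B n\<close> moves \<open>p\<close> by little.
  Taking \<open>v\<close> to be the identity gives Riesz representation; the approximation clause gives density of
  the span whenever the \<open>v i\<close> separate points.
\<close>

theorem moment_problem:
  assumes v: "\<And>i. i \<in> I \<Longrightarrow> v i \<in> carrier H" and C: "0 \<le> C"
    and psd: "psd_on I (\<lambda>i j. of_real (C\<^sup>2) * cinner H (v j) (v i) - F i * cnj (F j))"
  shows "\<exists>u\<in>carrier H. (\<forall>i\<in>I. cinner H u (v i) = F i) \<and> hnorm H u \<le> C \<and>
    (\<forall>\<epsilon>>0. \<exists>S c. finite S \<and> S \<subseteq> I \<and> hnorm H (u - (\<Sum>i\<in>S. c i *\<^sub>C v i)) < \<epsilon>)"
proof -
  let ?fin = "\<lambda>S. finite S \<and> S \<subseteq> I"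
  have "\<exists>c. ?fin S \<longrightarrow> (\<forall>i\<in>S. cinner H (\<Sum>j\<in>S. c j *\<^sub>C v j) (v i) = F i) \<and> hnorm H (\<Sum>j\<in>S. c j *\<^sub>C v j) \<le> C" for S
    using moment_finite[of S v C F] v C psd_on_subset[OF psd] by blast
  then obtain c where c: "\<And>S i. ?fin S \<Longrightarrow> i \<in> S \<Longrightarrow> cinner H (\<Sum>j\<in>S. c S j *\<^sub>C v j) (v i) = F i"
    "\<And>S. ?fin S \<Longrightarrow> hnorm H (\<Sum>j\<in>S. c S j *\<^sub>C v j) \<le> C" by metis
  define p where "p S = (\<Sum>j\<in>S. c S j *\<^sub>C v j)" for S
  have pc: "p S \<in> carrier H" if "?fin S" for S using that v by (auto simp: p_def subset_iff)
  have pF: "cinner H (p S) (v i) = F i" if "?fin S" "i \<in> S" for S i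
    using c(1)[OF that] by (simp add: p_def)
  have pC: "hnorm H (p S) \<le> C" if "?fin S" for S using c(2)[OF that] by (simp add: p_def)
  have pyth: "(hnorm H (p T - p S))\<^sup>2 = (hnorm H (p T))\<^sup>2 - (hnorm H (p S))\<^sup>2" if "?fin T" "S \<subseteq> T" for S T
  proof -
    have S: "?fin S" using that finite_subset by auto
    have pS: "cinner H y (p S) = (\<Sum>i\<in>S. cnj (c S i) * cinner H y (v i))" if "y \<in> carrier H" for y
      unfolding p_def[of S] by (rule cinner_sum_right) (use S v that in auto)
    have "cinner H (p T - p S) (p S) = (\<Sum>i\<in>S. cnj (c S i) * cinner H (p T - p S) (v i))"
      by (rule pS[OF diff_closed[OF pc[OF that(1)] pc[OF S]]])
    also have "\<dots> = 0"
    proof (rule sum.neutral, rule ballI)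
      fix i assume i: "i \<in> S"
      have "cinner H (p T - p S) (v i) = cinner H (p T) (v i) - cinner H (p S) (v i)"
        by (rule cinner_diff_left) (use S i that pc v in auto)
      also have "\<dots> = 0" using pF[OF S i] pF[OF that(1), of i] that(2) i by auto
      finally show "cnj (c S i) * cinner H (p T - p S) (v i) = 0" by simp
    qed
    finally have 0: "cinner H (p T) (p S) = cinner H (p S) (p S)"
      using pc S that by (simp add: cinner_diff_left)
    have "cinner H (p S) (p T) = cnj (cinner H (p T) (p S))"
      by (rule cinner_commute[OF pc[OF S] pc[OF that(1)]])
    also have "\<dots> = cinner H (p S) (p S)"
      unfolding 0 by (rule cinner_commute[OF pc[OF S] pc[OF S], symmetric])
    finally have 1: "cinner H (p S) (p T) = cinner H (p S) (p S)" .
    have "cinner H (p T - p S) (p T - p S) = cinner H (p T) (p T) - cinner H (p S) (p S)"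
      using pc[OF S] pc[OF that(1)] by (simp add: cinner_diff_left cinner_diff_right 0 1)
    then have "complex_of_real ((hnorm H (p T - p S))\<^sup>2) = of_real ((hnorm H (p T))\<^sup>2 - (hnorm H (p S))\<^sup>2)"
      unfolding of_real_diff cinner_self[OF pc[OF S]] cinner_self[OF pc[OF that(1)]]
        cinner_self[OF diff_closed[OF pc[OF that(1)] pc[OF S]]] .
    then show ?thesis by (simp only: of_real_eq_iff)
  qed
  define d where "d = (SUP S\<in>{S. ?fin S}. (hnorm H (p S))\<^sup>2)"
  have bdd: "bdd_above ((\<lambda>S. (hnorm H (p S))\<^sup>2) ` {S. ?fin S})"
    by (rule bdd_aboveI2[of _ _ "C\<^sup>2"]) (auto intro!: power_mono pC hnorm_nonneg pc)
  have ne: "{S. ?fin S} \<noteq> {}" by auto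
  have le_d: "(hnorm H (p S))\<^sup>2 \<le> d" if "?fin S" for S
    unfolding d_def by (rule cSUP_upper[OF _ bdd]) (use that in auto)
  have "\<exists>S. ?fin S \<and> d - inverse (real (Suc n)) < (hnorm H (p S))\<^sup>2" for n
  proof -
    have "d - inverse (real (Suc n)) < d" by simp
    then have "\<exists>S\<in>{S. ?fin S}. d - inverse (real (Suc n)) < (hnorm H (p S))\<^sup>2"
      unfolding less_cSUP_iff[OF ne bdd, folded d_def] .
    then show ?thesis by auto
  qed
  then obtain A where A: "\<And>n. ?fin (A n)" "\<And>n. d - inverse (real (Suc n)) < (hnorm H (p (A n)))\<^sup>2" by metis
  define B where "B n = (\<Union>k\<le>n. A k)" for n
  have B: "?fin (B n)" for n using A by (auto simp: B_def)
  have AB: "A n \<subseteq> B n" for n by (auto simp: B_def)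
  have Bmono: "B m \<subseteq> B n" if "m \<le> n" for m n using that by (force simp: B_def)
  have near: "(hnorm H (p T - p (B n)))\<^sup>2 < inverse (real (Suc n))" if "?fin T" "B n \<subseteq> T" for T n
  proof -
    have "(hnorm H (p (B n)))\<^sup>2 - (hnorm H (p (A n)))\<^sup>2 \<ge> 0"
      unfolding pyth[OF B AB, symmetric] by simp
    then show ?thesis unfolding pyth[OF that] using le_d[OF that(1)] A(2)[of n] by linarith
  qed
  define u where "u n = p (B n)" for n
  have uc: "u n \<in> carrier H" for n using pc B by (simp add: u_def)
  have small: "\<exists>M. \<forall>n\<ge>M. inverse (real (Suc n)) < \<epsilon>\<^sup>2" if "\<epsilon> > 0" for \<epsilon> :: real
  proof -
    have "0 < \<epsilon>\<^sup>2" using that by simp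
    then obtain M where M: "inverse (real (Suc M)) < \<epsilon>\<^sup>2" using reals_Archimedean by blast
    have "inverse (real (Suc n)) \<le> inverse (real (Suc M))" if "n \<ge> M" for n
      using that by (simp add: le_imp_inverse_le)
    then show ?thesis using M by (meson le_less_trans)
  qed
  have "\<exists>x\<in>carrier H. (\<lambda>n. hnorm H (u n - x)) \<longlonglongrightarrow> 0"
  proof (rule complete[OF uc], intro allI impI)
    fix \<epsilon> :: real assume \<epsilon>: "0 < \<epsilon>"
    obtain M where M: "\<forall>n\<ge>M. inverse (real (Suc n)) < \<epsilon>\<^sup>2" using small[OF \<epsilon>] by blast
    have half: "hnorm H (u m - u n) < \<epsilon>" if "n \<ge> M" "m \<ge> n" for m n
    proof (rule power2_less_imp_less)
      show "(hnorm H (u m - u n))\<^sup>2 < \<epsilon>\<^sup>2"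
        using near[OF B Bmono[OF that(2)]] M that(1) unfolding u_def by (meson less_trans)
    qed (use \<epsilon> in auto)
    show "\<exists>M. \<forall>m\<ge>M. \<forall>n\<ge>M. hnorm H (u m - u n) < \<epsilon>"
    proof (intro exI[of _ M] allI impI)
      fix m n assume "M \<le> m" "M \<le> n"
      then show "hnorm H (u m - u n) < \<epsilon>"
        using half[of n m] half[of m n] hnorm_minus_commute[OF uc uc, of m n] by (cases "n \<le> m") auto
    qed
  qed
  then obtain x where x: "x \<in> carrier H" "(\<lambda>n. hnorm H (u n - x)) \<longlonglongrightarrow> 0" by blast
  have xF: "cinner H x (v i) = F i" if i: "i \<in> I" for i
  proof (rule LIMSEQ_unique[OF tendsto_cinner_left[OF uc x(1) v[OF i] x(2)]])
    have "(\<lambda>n. sqrt (inverse (real (Suc n))) * hnorm H (v i)) \<longlonglongrightarrow> sqrt 0 * hnorm H (v i)"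
      by (intro tendsto_intros LIMSEQ_inverse_real_of_nat)
    then have lim: "(\<lambda>n. sqrt (inverse (real (Suc n))) * hnorm H (v i)) \<longlonglongrightarrow> 0" by simp
    have "norm (cinner H (u n) (v i) - F i) \<le> sqrt (inverse (real (Suc n))) * hnorm H (v i)" for n
    proof -
      let ?T = "insert i (B n)"
      have T: "?fin ?T" using B i by auto
      have "cinner H (p ?T - u n) (v i) = F i - cinner H (u n) (v i)"
        using pc[OF T] uc v[OF i] pF[OF T, of i] by (simp add: cinner_diff_left)
      then have "norm (cinner H (u n) (v i) - F i) \<le> hnorm H (p ?T - u n) * hnorm H (v i)"
        using Cauchy_Schwarz[of "p ?T - u n" "v i"] pc[OF T] uc v[OF i] by (simp add: norm_minus_commute)
      also have "hnorm H (p ?T - u n) \<le> sqrt (inverse (real (Suc n)))"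
        unfolding u_def by (rule real_le_rsqrt[OF less_imp_le[OF near[OF T subset_insertI]]])
      finally show ?thesis using v[OF i] by (simp add: mult_right_mono)
    qed
    then have "(\<lambda>n. cinner H (u n) (v i) - F i) \<longlonglongrightarrow> 0"
      using v[OF i] by (intro tendsto_0_le[OF lim, where K = 1] always_eventually) (auto simp: abs_mult)
    then show "(\<lambda>n. cinner H (u n) (v i)) \<longlonglongrightarrow> F i" by (rule LIM_zero_cancel)
  qed
  have approx: "\<exists>n. hnorm H (x - u n) < \<epsilon>" if "\<epsilon> > 0" for \<epsilon>
  proof -
    have "\<forall>\<^sub>F n in sequentially. hnorm H (u n - x) < \<epsilon>"
      using order_tendstoD(2)[OF x(2)] that by simp
    then show ?thesis using hnorm_minus_commute[OF uc x(1)] by (auto simp: eventually_sequentially)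
  qed
  have "hnorm H x \<le> C"
  proof (rule field_le_epsilon)
    fix \<epsilon> :: real assume "0 < \<epsilon>"
    then obtain n where n: "hnorm H (x - u n) < \<epsilon>" using approx by blast
    have "hnorm H x \<le> hnorm H (x - u n) + hnorm H (u n)"
      using hnorm_triangle[of "x - u n" "u n"] uc x by simp
    also have "hnorm H (u n) \<le> C" using pC B by (simp add: u_def)
    finally show "hnorm H x \<le> C + \<epsilon>" using n by simp
  qed
  moreover have "\<exists>S c. finite S \<and> S \<subseteq> I \<and> hnorm H (x - (\<Sum>i\<in>S. c i *\<^sub>C v i)) < \<epsilon>" if "\<epsilon> > 0" for \<epsilon>
  proof -
    obtain n where "hnorm H (x - u n) < \<epsilon>" using approx \<open>\<epsilon> > 0\<close> by blast
    then show ?thesis using B[of n] by (intro exI[of _ "B n"] exI[of _ "c (B n)"]) (simp add: u_def p_def)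
  qed
  ultimately show ?thesis using x(1) xF by blast
qed

lemma moment_solution:
  assumes "\<And>i. i \<in> I \<Longrightarrow> v i \<in> carrier H" and "0 \<le> C"
    and "psd_on I (\<lambda>i j. of_real (C\<^sup>2) * cinner H (v j) (v i) - F i * cnj (F j))"
  shows "\<exists>u\<in>carrier H. (\<forall>i\<in>I. cinner H u (v i) = F i) \<and> hnorm H u \<le> C"
proof -
  from moment_problem[OF assms] obtain u where uH: "u \<in> carrier H"
    and u: "(\<forall>i\<in>I. cinner H u (v i) = F i) \<and> hnorm H u \<le> C \<and>
      (\<forall>\<epsilon>>0. \<exists>S c. finite S \<and> S \<subseteq> I \<and> hnorm H (u - (\<Sum>i\<in>S. c i *\<^sub>C v i)) < \<epsilon>)" ..
  from u have "(\<forall>i\<in>I. cinner H u (v i) = F i) \<and> hnorm H u \<le> C" by simp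
  then show ?thesis using uH by (rule bexI)
qed

text \<open>
  The converse of \<open>moment_problem\<close>: a reformulation of the Cauchy--Schwarz inequality for \<open>u\<close> and all
  combinations of the \<open>v i\<close>.
\<close>

lemma psd_on_moments:
  assumes v: "\<And>i. i \<in> I \<Longrightarrow> v i \<in> carrier H" and u: "u \<in> carrier H" "hnorm H u \<le> C"
  shows "psd_on I (\<lambda>i j. of_real (C\<^sup>2) * cinner H (v j) (v i) - cinner H u (v i) * cnj (cinner H u (v j)))"
  unfolding psd_on_def
proof (intro allI impI, elim conjE)
  fix S and c :: "_ \<Rightarrow> complex" assume S: "finite S" "S \<subseteq> I"
  have v: "v i \<in> carrier H" if "i \<in> S" for i using v S that by auto
  let ?w = "\<Sum>i\<in>S. c i *\<^sub>C v i"
  have w: "?w \<in> carrier H" using v by auto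
  have "(cmod (cinner H u ?w))\<^sup>2 \<le> (C * hnorm H ?w)\<^sup>2"
  proof (rule power_mono)
    have "cmod (cinner H u ?w) \<le> hnorm H u * hnorm H ?w" by (rule Cauchy_Schwarz[OF u(1) w])
    also have "\<dots> \<le> C * hnorm H ?w" using u w by (intro mult_right_mono) auto
    finally show "cmod (cinner H u ?w) \<le> C * hnorm H ?w" .
  qed simp
  then have "(0::complex) \<le> of_real (C\<^sup>2 * (hnorm H ?w)\<^sup>2 - (cmod (cinner H u ?w))\<^sup>2)"
    by (simp add: less_eq_complex_def power_mult_distrib del: of_real_diff of_real_mult of_real_power)
  also have "\<dots> = of_real (C\<^sup>2) * cinner H ?w ?w - cinner H u ?w * cnj (cinner H u ?w)"
    unfolding cinner_self[OF w] complex_norm_square[symmetric] by simp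
  also have "\<dots> = sesq_form S (\<lambda>i j. of_real (C\<^sup>2) * cinner H (v j) (v i) - cinner H u (v i) * cnj (cinner H u (v j))) c c"
  proof -
    have 1: "(\<Sum>i\<in>S. cnj (c i) * cinner H u (v i)) = cinner H u ?w"
      using S v u by (simp add: cinner_sum_right)
    have 2: "(\<Sum>i\<in>S. cnj (cinner H u (v i)) * c i) = cnj (cinner H u ?w)"
      unfolding 1[symmetric] by (simp add: mult.commute)
    have 3: "sesq_form S (\<lambda>i j. cinner H (v j) (v i)) c c = cinner H ?w ?w"
      by (rule sesq_form_cinner) (use S v in auto)
    show ?thesis
      unfolding sesq_form_kernel_diff sesq_form_kernel_scale sesq_form_rank_one 1 2 3 ..
  qed
  finally show "0 \<le> sesq_form S (\<lambda>i j. of_real (C\<^sup>2) * cinner H (v j) (v i) - cinner H u (v i) * cnj (cinner H u (v j))) c c" .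
qed

end

section \<open>Existence of reproducing kernel Hilbert spaces\<close>

lemma incseq_finite_subsets_tendsto:
  fixes f :: "'a set \<Rightarrow> real"
  assumes mono: "\<And>S T. finite T \<Longrightarrow> S \<subseteq> T \<Longrightarrow> T \<subseteq> I \<Longrightarrow> f S \<le> f T"
    and bound: "\<And>S. finite S \<Longrightarrow> S \<subseteq> I \<Longrightarrow> f S \<le> B"
  shows "\<exists>l. (f \<longlongrightarrow> l) (finite_subsets_at_top I) \<and> (\<forall>S. finite S \<and> S \<subseteq> I \<longrightarrow> f S \<le> l)"
proof -
  let ?fin = "{S. finite S \<and> S \<subseteq> I}"
  have bdd: "bdd_above (f ` ?fin)" by (rule bdd_aboveI2[of _ _ B]) (use bound in auto)
  have ne: "?fin \<noteq> {}" by auto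
  define l where "l = (SUP S\<in>?fin. f S)"
  have le: "f S \<le> l" if "S \<in> ?fin" for S
    unfolding l_def by (rule cSUP_upper[OF that bdd])
  have "(f \<longlongrightarrow> l) (finite_subsets_at_top I)"
  proof (rule order_tendstoI)
    fix a assume "a < l"
    then obtain S where S: "S \<in> ?fin" "a < f S"
      unfolding l_def less_cSUP_iff[OF ne bdd] by blast
    show "\<forall>\<^sub>F T in finite_subsets_at_top I. a < f T"
      unfolding eventually_finite_subsets_at_top
    proof (intro exI[of _ S] conjI allI impI)
      fix T assume T: "finite T \<and> S \<subseteq> T \<and> T \<subseteq> I"
      then have "f S \<le> f T" by (intro mono) auto
      with S(2) show "a < f T" by simp
    qed (use S in auto)
  next
    fix a assume a: "l < a"
    show "\<forall>\<^sub>F T in finite_subsets_at_top I. f T < a"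
      unfolding eventually_finite_subsets_at_top
    proof (intro exI[of _ "{}"] conjI allI impI)
      fix T assume T: "finite T \<and> {} \<subseteq> T \<and> T \<subseteq> I"
      then have "f T \<le> l" by (intro le) auto
      with a show "f T < a" by simp
    qed auto
  qed
  then show ?thesis using le by auto
qed

text \<open>
  The inner product of functions \<open>F\<close> and \<open>G\<close> with finite norm is obtained from finite sets of points:
  on a finite \<open>S\<close> they agree with unique elements of the span of the kernel functions of \<open>S\<close>, whose inner
  products (\<open>fin_ip\<close>) converge along the net of finite sets.
\<close>

locale psd_kernel =
  fixes I :: "'i set" and K :: "'i \<Rightarrow> 'i \<Rightarrow> complex"
  assumes psd: "psd_on I K"
begin

definition has_coeffs :: "'i set \<Rightarrow> ('i \<Rightarrow> complex) \<Rightarrow> ('i \<Rightarrow> complex) \<Rightarrow> bool" where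
  "has_coeffs S F a \<longleftrightarrow> (\<forall>i\<in>S. F i = (\<Sum>j\<in>S. K i j * a j))"

definition fin_ip :: "'i set \<Rightarrow> ('i \<Rightarrow> complex) \<Rightarrow> ('i \<Rightarrow> complex) \<Rightarrow> complex" where
  "fin_ip S F G = (\<Sum>i\<in>S. (SOME a. has_coeffs S F a) i * cnj (G i))"

text \<open>
  This expresses \<open>\<parallel>F\<parallel>\<^sup>2 \<le> t\<close> without a norm (\<open>ip_self\<close>). As a condition on finitely many values at a time
  it passes to pointwise limits, which is what makes the space complete.
\<close>

definition dominated :: "('i \<Rightarrow> complex) \<Rightarrow> real \<Rightarrow> bool" where
  "dominated F t \<longleftrightarrow> 0 \<le> t \<and> psd_on I (\<lambda>i j. of_real t * K i j - F i * cnj (F j))"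

lemma coeffs_form:
  assumes S: "finite S" "S \<subseteq> I" and a: "has_coeffs S F a" and b: "has_coeffs S G b"
  shows "sesq_form S K b a = (\<Sum>i\<in>S. cnj (b i) * F i)"
    and "sesq_form S K b a = (\<Sum>i\<in>S. a i * cnj (G i))"
proof -
  show "sesq_form S K b a = (\<Sum>i\<in>S. cnj (b i) * F i)"
    using a by (simp add: sesq_form_def has_coeffs_def sum_distrib_left mult.assoc)
  have "sesq_form S K b a = (\<Sum>j\<in>S. \<Sum>i\<in>S. cnj (b i) * K i j * a j)"
    unfolding sesq_form_def by (rule sum.swap)
  also have "\<dots> = (\<Sum>j\<in>S. a j * (\<Sum>i\<in>S. cnj (K j i * b i)))"
    unfolding sum_distrib_left
  proof (intro sum.cong refl)
    fix j i assume "j \<in> S" "i \<in> S"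
    then have "K i j = cnj (K j i)" using psd_on_hermitian[OF psd] S by blast
    then show "cnj (b i) * K i j * a j = a j * cnj (K j i * b i)" by simp
  qed
  also have "\<dots> = (\<Sum>i\<in>S. a i * cnj (G i))"
    using b by (simp add: has_coeffs_def)
  finally show "sesq_form S K b a = (\<Sum>i\<in>S. a i * cnj (G i))" .
qed

lemma fin_ip_eq:
  assumes S: "finite S" "S \<subseteq> I" and a: "has_coeffs S F a" and b: "has_coeffs S G b"
  shows "fin_ip S F G = sesq_form S K b a"
proof -
  have "has_coeffs S F (SOME a. has_coeffs S F a)" by (rule someI[of "has_coeffs S F", OF a])
  then have "fin_ip S F G = sesq_form S K b (SOME a. has_coeffs S F a)"
    unfolding fin_ip_def by (rule coeffs_form(2)[OF S _ b, symmetric])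
  also have "\<dots> = (\<Sum>i\<in>S. cnj (b i) * F i)"
    by (rule coeffs_form(1)[OF S someI[of "has_coeffs S F", OF a] b])
  also have "\<dots> = sesq_form S K b a"
    by (rule coeffs_form(1)[OF S a b, symmetric])
  finally show ?thesis .
qed

lemma coeffs_add: "has_coeffs S F a \<Longrightarrow> has_coeffs S G b \<Longrightarrow> has_coeffs S (F + G) (\<lambda>i. a i + b i)"
  by (simp add: has_coeffs_def distrib_left sum.distrib)

lemma coeffs_scaleC: "has_coeffs S F a \<Longrightarrow> has_coeffs S (c *\<^sub>C F) (\<lambda>i. c * a i)"
  by (simp add: has_coeffs_def scaleC_fun_def scaleC_complex_def sum_distrib_left mult_ac)

lemma dominated_coeffs: "dominated F t \<Longrightarrow> finite S \<Longrightarrow> S \<subseteq> I \<Longrightarrow> \<exists>a. has_coeffs S F a"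
  unfolding dominated_def has_coeffs_def
  by (rule psd_on_bounded_in_range[where t = "of_real t"]) (auto elim: psd_on_subset)

lemma dominated_add:
  assumes "dominated F t" "dominated G u"
  shows "dominated (F + G) (2 * (t + u))"
proof -
  have "psd_on I (\<lambda>i j. (2 * (of_real t * K i j - F i * cnj (F j)) + 2 * (of_real u * K i j - G i * cnj (G j)))
      + cnj (cnj (F i - G i)) * cnj (F j - G j))"
    using assms unfolding dominated_def
    by (intro psd_on_add psd_on_scale psd_on_rank_one) (auto simp: less_eq_complex_def)
  then have "psd_on I (\<lambda>i j. of_real (2 * (t + u)) * K i j - (F + G) i * cnj ((F + G) j))"
    by (rule psd_on_cong) (simp add: algebra_simps)
  then show ?thesis using assms by (simp add: dominated_def)
qed

lemma dominated_scaleC: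
  assumes "dominated F t"
  shows "dominated (c *\<^sub>C F) ((cmod c)\<^sup>2 * t)"
proof -
  have "psd_on I (\<lambda>i j. of_real ((cmod c)\<^sup>2) * (of_real t * K i j - F i * cnj (F j)))"
    using assms unfolding dominated_def by (intro psd_on_scale) (auto simp: less_eq_complex_def)
  then have "psd_on I (\<lambda>i j. of_real ((cmod c)\<^sup>2 * t) * K i j - (c *\<^sub>C F) i * cnj ((c *\<^sub>C F) j))"
    by (rule psd_on_cong)
      (simp add: scaleC_fun_def scaleC_complex_def complex_norm_square right_diff_distrib mult_ac del: of_real_power)
  then show ?thesis using assms by (simp add: dominated_def)
qed

lemma fin_ip_add:
  assumes "finite S" "S \<subseteq> I" "dominated F t" "dominated F' t'" "dominated G u"
  shows "fin_ip S (F + F') G = fin_ip S F G + fin_ip S F' G"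
proof -
  obtain a a' b where "has_coeffs S F a" "has_coeffs S F' a'" "has_coeffs S G b"
    using assms dominated_coeffs by metis
  then show ?thesis
    using assms by (simp add: fin_ip_eq[OF assms(1,2)] fin_ip_eq[OF assms(1,2) coeffs_add] sesq_form_add_right)
qed

lemma fin_ip_scaleC:
  assumes "finite S" "S \<subseteq> I" "dominated F t" "dominated G u"
  shows "fin_ip S (c *\<^sub>C F) G = c * fin_ip S F G"
proof -
  obtain a b where "has_coeffs S F a" "has_coeffs S G b"
    using assms dominated_coeffs by metis
  then show ?thesis
    using assms by (simp add: fin_ip_eq[OF assms(1,2)] fin_ip_eq[OF assms(1,2) coeffs_scaleC] sesq_form_scale_right)
qed

lemma fin_ip_commute:
  assumes "finite S" "S \<subseteq> I" "dominated F t" "dominated G u"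
  shows "fin_ip S F G = cnj (fin_ip S G F)"
proof -
  obtain a b where ab: "has_coeffs S F a" "has_coeffs S G b"
    using assms dominated_coeffs by metis
  have "fin_ip S F G = (\<Sum>i\<in>S. a i * cnj (G i))"
    using fin_ip_eq[OF assms(1,2) ab] coeffs_form(2)[OF assms(1,2) ab] by simp
  also have "\<dots> = cnj (\<Sum>i\<in>S. cnj (a i) * G i)" by simp
  also have "(\<Sum>i\<in>S. cnj (a i) * G i) = fin_ip S G F"
    using fin_ip_eq[OF assms(1,2) ab(2,1)] coeffs_form(1)[OF assms(1,2) ab(2,1)] by simp
  finally show ?thesis .
qed

lemma fin_ip_self:
  assumes "finite S" "S \<subseteq> I" "dominated F t"
  shows "0 \<le> fin_ip S F F" and "Re (fin_ip S F F) \<le> t"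
    and "psd_on S (\<lambda>i j. fin_ip S F F * K i j - F i * cnj (F j))"
proof -
  obtain a where a: "has_coeffs S F a"
    using assms dominated_coeffs by metis
  have q: "fin_ip S F F = sesq_form S K a a" by (rule fin_ip_eq[OF assms(1,2) a a])
  then show q0: "0 \<le> fin_ip S F F" using psd_onD[OF psd assms(1,2)] by simp
  have L: "(\<Sum>i\<in>S. cnj (a i) * F i) = fin_ip S F F"
    using coeffs_form(1)[OF assms(1,2) a a] q by simp
  have L': "(\<Sum>i\<in>S. cnj (F i) * a i) = fin_ip S F F"
    using coeffs_form(2)[OF assms(1,2) a a] q by (simp add: mult.commute)
  have "0 \<le> sesq_form S (\<lambda>i j. of_real t * K i j - F i * cnj (F j)) a a"
    using assms by (intro psd_onD) (auto simp: dominated_def)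
  also have "\<dots> = of_real t * fin_ip S F F - fin_ip S F F * fin_ip S F F"
    unfolding sesq_form_kernel_diff sesq_form_kernel_scale sesq_form_rank_one L L' q ..
  finally have "0 \<le> Re (fin_ip S F F) * (t - Re (fin_ip S F F))"
    using q0 by (simp add: less_eq_complex_def algebra_simps)
  then show "Re (fin_ip S F F) \<le> t"
    using q0 assms(3) by (auto simp: less_eq_complex_def zero_le_mult_iff dominated_def)
  show "psd_on S (\<lambda>i j. fin_ip S F F * K i j - F i * cnj (F j))"
  proof -
    have "0 \<le> sesq_form S (\<lambda>i j. fin_ip S F F * K i j - F i * cnj (F j)) c c" for c
    proof -
      have 1: "(\<Sum>i\<in>S. cnj (c i) * F i) = sesq_form S K c a"
        using a by (simp add: sesq_form_def has_coeffs_def sum_distrib_left mult.assoc)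
      have "(\<Sum>i\<in>S. cnj (F i) * c i) = cnj (\<Sum>i\<in>S. cnj (c i) * F i)"
        by (simp add: mult.commute)
      also have "\<dots> = sesq_form S K a c"
        unfolding 1 by (rule sesq_form_commute[OF psd assms(1,2), symmetric])
      finally have 2: "(\<Sum>i\<in>S. cnj (F i) * c i) = sesq_form S K a c" .
      show ?thesis
        unfolding sesq_form_kernel_diff sesq_form_kernel_scale sesq_form_rank_one 1 2 q
        by (rule sesq_form_Cauchy_Schwarz[OF psd assms(1,2)])
    qed
    then show ?thesis by (simp add: psd_on_finite[OF assms(1)])
  qed
qed

text \<open>
  The interpolant of \<open>F\<close> on the smaller set is the orthogonal projection of the one on the larger set.
\<close>

lemma fin_ip_mono:
  assumes "finite T" "S \<subseteq> T" "T \<subseteq> I" "dominated F t"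
  shows "Re (fin_ip S F F) \<le> Re (fin_ip T F F)"
proof -
  have S: "finite S" "S \<subseteq> I" using assms finite_subset by auto
  obtain a b where a: "has_coeffs S F a" and b: "has_coeffs T F b"
    using assms S dominated_coeffs by metis
  define a0 where "a0 i = (if i \<in> S then a i else 0)" for i
  have aa: "sesq_form T K a0 a0 = fin_ip S F F"
  proof -
    have "sesq_form T K a0 a0 = sesq_form S K a0 a0"
      by (rule sesq_form_zero_extend) (use assms in \<open>auto simp: a0_def\<close>)
    also have "\<dots> = sesq_form S K a a" by (rule sesq_form_cong) (auto simp: a0_def)
    finally show ?thesis by (simp add: fin_ip_eq[OF S a a])
  qed
  have "sesq_form T K a0 b = (\<Sum>i\<in>T. cnj (a0 i) * F i)"
    using b by (simp add: sesq_form_def has_coeffs_def sum_distrib_left mult.assoc)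
  also have "\<dots> = (\<Sum>i\<in>S. cnj (a0 i) * F i)"
    by (rule sum.mono_neutral_right) (use assms in \<open>auto simp: a0_def\<close>)
  also have "\<dots> = (\<Sum>i\<in>S. cnj (a i) * F i)" by (rule sum.cong) (auto simp: a0_def)
  also have "\<dots> = fin_ip S F F" by (simp add: coeffs_form(1)[OF S a a, symmetric] fin_ip_eq[OF S a a])
  finally have ab: "sesq_form T K a0 b = fin_ip S F F" .
  have ba: "sesq_form T K b a0 = cnj (sesq_form T K a0 b)"
    by (rule sesq_form_commute[OF psd assms(1,3)])
  have "0 \<le> sesq_form T K (\<lambda>i. b i + (-1) * a0 i) (\<lambda>i. b i + (-1) * a0 i)"
    using assms by (intro psd_onD[OF psd]) auto
  also have "\<dots> = sesq_form T K b b - sesq_form T K b a0 - sesq_form T K a0 b + sesq_form T K a0 a0"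
    by (simp only: sesq_form_add_left sesq_form_add_right sesq_form_scale_left sesq_form_scale_right) simp
  finally have "0 \<le> Re (fin_ip T F F) - Re (fin_ip S F F)"
    by (simp add: fin_ip_eq[OF assms(1,3) b b] ba ab aa less_eq_complex_def)
  then show ?thesis by simp
qed

lemma fin_ip_polarization:
  assumes "finite S" "S \<subseteq> I" "dominated F t" "dominated G u"
  defines "Q X \<equiv> of_real (Re (fin_ip S X X))"
  shows "4 * fin_ip S F G = Q (F + 1 *\<^sub>C G) - Q (F + (-1) *\<^sub>C G) + \<i> * Q (F + \<i> *\<^sub>C G) - \<i> * Q (F + (-\<i>) *\<^sub>C G)"
proof -
  have Q: "Q X = fin_ip S X X" if "dominated X v" for X v
    using fin_ip_self(1)[OF assms(1,2) that] by (simp add: Q_def less_eq_complex_def complex_eq_iff)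
  note dG = dominated_scaleC[OF assms(4)]
  have e: "Q (F + c *\<^sub>C G) = fin_ip S F F + cnj c * fin_ip S F G + c * fin_ip S G F + c * cnj c * fin_ip S G G" for c
  proof -
    have dc: "dominated (F + c *\<^sub>C G) (2 * (t + (cmod c)\<^sup>2 * u))" by (rule dominated_add[OF assms(3) dG])
    have r: "fin_ip S X (F + c *\<^sub>C G) = fin_ip S X F + cnj c * fin_ip S X G" if "dominated X v" for X v
      using fin_ip_commute[OF assms(1,2) that dc] fin_ip_commute[OF assms(1,2) that assms(3)]
        fin_ip_commute[OF assms(1,2) that assms(4)]
      by (simp add: fin_ip_add[OF assms(1,2,3) dG that] fin_ip_scaleC[OF assms(1,2,4) that])
    have "Q (F + c *\<^sub>C G) = fin_ip S (F + c *\<^sub>C G) (F + c *\<^sub>C G)" by (rule Q[OF dc])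
    also have "\<dots> = fin_ip S F (F + c *\<^sub>C G) + c * fin_ip S G (F + c *\<^sub>C G)"
      by (simp add: fin_ip_add[OF assms(1,2,3) dG dc] fin_ip_scaleC[OF assms(1,2,4) dc])
    also have "\<dots> = fin_ip S F F + cnj c * fin_ip S F G + c * fin_ip S G F + c * cnj c * fin_ip S G G"
      by (simp add: r[OF assms(3)] r[OF assms(4)] algebra_simps)
    finally show ?thesis .
  qed
  show ?thesis unfolding e by (simp add: algebra_simps)
qed

text \<open>
  For \<open>F = G\<close> the limit exists by monotonicity; polarization reduces the general case to this one.
\<close>

definition ip :: "('i \<Rightarrow> complex) \<Rightarrow> ('i \<Rightarrow> complex) \<Rightarrow> complex" where
  "ip F G = Lim (finite_subsets_at_top I) (\<lambda>S. fin_ip S F G)"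

lemma fin_ip_self_tendsto:
  assumes "dominated F t"
  shows "\<exists>l. ((\<lambda>S. Re (fin_ip S F F)) \<longlongrightarrow> l) (finite_subsets_at_top I)
    \<and> (\<forall>S. finite S \<and> S \<subseteq> I \<longrightarrow> Re (fin_ip S F F) \<le> l)"
  by (rule incseq_finite_subsets_tendsto) (use fin_ip_mono fin_ip_self(2) assms in blast)+

lemma eventually_finite_subset: "\<forall>\<^sub>F S in finite_subsets_at_top I. finite S \<and> S \<subseteq> I"
  by (auto simp: eventually_finite_subsets_at_top)

lemma tendsto_ip:
  assumes F: "dominated F t" and G: "dominated G u"
  shows "((\<lambda>S. fin_ip S F G) \<longlongrightarrow> ip F G) (finite_subsets_at_top I)"
proof -
  have "\<exists>l. ((\<lambda>S. of_real (Re (fin_ip S (F + c *\<^sub>C G) (F + c *\<^sub>C G))) :: complex) \<longlongrightarrow> l) (finite_subsets_at_top I)" for c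
    using fin_ip_self_tendsto[OF dominated_add[OF F dominated_scaleC[OF G, of c]]] tendsto_of_real by blast
  then obtain l where l: "\<And>c. ((\<lambda>S. of_real (Re (fin_ip S (F + c *\<^sub>C G) (F + c *\<^sub>C G))) :: complex) \<longlongrightarrow> l c) (finite_subsets_at_top I)"
    by metis
  let ?Q = "\<lambda>S X. of_real (Re (fin_ip S X X)) :: complex"
  have "((\<lambda>S. (?Q S (F + 1 *\<^sub>C G) - ?Q S (F + (-1) *\<^sub>C G) + \<i> * ?Q S (F + \<i> *\<^sub>C G) - \<i> * ?Q S (F + (-\<i>) *\<^sub>C G)) / 4)
      \<longlongrightarrow> (l 1 - l (-1) + \<i> * l \<i> - \<i> * l (-\<i>)) / 4) (finite_subsets_at_top I)"
    by (intro tendsto_intros l) simp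
  moreover have "\<forall>\<^sub>F S in finite_subsets_at_top I.
      (?Q S (F + 1 *\<^sub>C G) - ?Q S (F + (-1) *\<^sub>C G) + \<i> * ?Q S (F + \<i> *\<^sub>C G) - \<i> * ?Q S (F + (-\<i>) *\<^sub>C G)) / 4 = fin_ip S F G"
    using eventually_finite_subset
  proof eventually_elim
    case (elim S)
    then have "finite S" "S \<subseteq> I" by auto
    show ?case by (subst fin_ip_polarization[OF \<open>finite S\<close> \<open>S \<subseteq> I\<close> F G, symmetric]) simp
  qed
  ultimately have "((\<lambda>S. fin_ip S F G) \<longlongrightarrow> (l 1 - l (-1) + \<i> * l \<i> - \<i> * l (-\<i>)) / 4) (finite_subsets_at_top I)"
    by (rule Lim_transform_eventually)
  then show ?thesis unfolding ip_def by (simp add: tendsto_Lim)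
qed

lemma ip_unique:
  assumes "dominated F t" "dominated G u"
    and "\<And>S. finite S \<Longrightarrow> S \<subseteq> I \<Longrightarrow> fin_ip S F G = f S" and "(f \<longlongrightarrow> l) (finite_subsets_at_top I)"
  shows "ip F G = l"
proof (rule tendsto_unique)
  show "((\<lambda>S. fin_ip S F G) \<longlongrightarrow> ip F G) (finite_subsets_at_top I)" by (rule tendsto_ip[OF assms(1,2)])
  show "((\<lambda>S. fin_ip S F G) \<longlongrightarrow> l) (finite_subsets_at_top I)"
    by (rule Lim_transform_eventually[OF assms(4)])
      (use eventually_finite_subset in \<open>auto elim!: eventually_mono simp: assms(3)\<close>)
qed simp

lemma ip_self:
  assumes "dominated F t"
  shows "0 \<le> Re (ip F F)" "Re (ip F F) \<le> t" "dominated F (Re (ip F F))"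
proof -
  obtain l where l: "((\<lambda>S. Re (fin_ip S F F)) \<longlongrightarrow> l) (finite_subsets_at_top I)"
    "\<And>S. finite S \<Longrightarrow> S \<subseteq> I \<Longrightarrow> Re (fin_ip S F F) \<le> l"
    using fin_ip_self_tendsto[OF assms] by blast
  have "((\<lambda>S. Re (fin_ip S F F)) \<longlongrightarrow> Re (ip F F)) (finite_subsets_at_top I)"
    by (intro tendsto_Re tendsto_ip[OF assms assms])
  then have ll: "Re (ip F F) = l" using l(1) by (intro tendsto_unique) auto
  have le: "Re (fin_ip S F F) \<le> Re (ip F F)" if "finite S" "S \<subseteq> I" for S using l(2) that ll by simp
  have "0 \<le> Re (fin_ip {} F F)" by (simp add: fin_ip_def)
  then show pos: "0 \<le> Re (ip F F)" using le[of "{}"] by simp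
  show "Re (ip F F) \<le> t"
    unfolding ll by (rule tendsto_upperbound[OF l(1)])
      (use eventually_finite_subset fin_ip_self(2) assms in \<open>auto elim!: eventually_mono\<close>)
  have "psd_on S (\<lambda>i j. of_real (Re (ip F F)) * K i j - F i * cnj (F j))" if S: "finite S" "S \<subseteq> I" for S
  proof -
    have r: "fin_ip S F F = of_real (Re (fin_ip S F F))"
      using fin_ip_self(1)[OF S assms] by (simp add: less_eq_complex_def complex_eq_iff)
    have "psd_on S (\<lambda>i j. (fin_ip S F F * K i j - F i * cnj (F j)) + of_real (Re (ip F F) - Re (fin_ip S F F)) * K i j)"
      using le[OF S] by (intro psd_on_add psd_on_scale fin_ip_self(3)[OF S assms] psd_on_subset[OF psd S(2)])
        (simp add: less_eq_complex_def)
    then show ?thesis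
      by (rule psd_on_cong) (subst r, simp add: algebra_simps)
  qed
  then show "dominated F (Re (ip F F))"
    using pos by (auto simp: dominated_def psd_on_finitary[of I])
qed

lemma dominated_pointwise:
  assumes "dominated F t" "i \<in> I"
  shows "(cmod (F i))\<^sup>2 \<le> t * Re (K i i)"
proof -
  have "0 \<le> of_real t * K i i - F i * cnj (F i)"
    using assms psd_on_diag[of I "\<lambda>i j. of_real t * K i j - F i * cnj (F j)" i] by (auto simp: dominated_def)
  then show ?thesis by (simp add: less_eq_complex_def complex_norm_square[symmetric] flip: of_real_power)
qed

definition rkhs_on :: "('i \<Rightarrow> complex) hspace" where
  "rkhs_on = \<lparr>carrier = {F. (\<exists>t. dominated F t) \<and> (\<forall>i. i \<notin> I \<longrightarrow> F i = 0)}, cinner = ip\<rparr>"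

lemma dominated_diff:
  assumes "dominated F t" "dominated G u"
  shows "dominated (F - G) (2 * (t + u))"
proof -
  have "F - G = F + (-1) *\<^sub>C G" by (auto simp: scaleC_fun_def scaleC_complex_def)
  then show ?thesis using dominated_add[OF assms(1) dominated_scaleC[OF assms(2), of "-1"]] by simp
qed

lemma dominated_limit:
  assumes "\<And>n::nat. dominated (F n) t" and "\<And>i. i \<in> I \<Longrightarrow> (\<lambda>n. F n i) \<longlonglongrightarrow> G i"
  shows "dominated G t"
proof -
  have "psd_on I (\<lambda>i j. of_real t * K i j - G i * cnj (G j))"
    unfolding psd_on_def
  proof (intro allI impI, elim conjE)
    fix S and c :: "'i \<Rightarrow> complex" assume S: "finite S" "S \<subseteq> I"
    have lim: "(\<lambda>n. sesq_form S (\<lambda>i j. of_real t * K i j - F n i * cnj (F n j)) c c)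
        \<longlonglongrightarrow> sesq_form S (\<lambda>i j. of_real t * K i j - G i * cnj (G j)) c c"
      unfolding sesq_form_def by (intro tendsto_intros assms(2)) (use S in auto)
    have nn: "0 \<le> sesq_form S (\<lambda>i j. of_real t * K i j - F n i * cnj (F n j)) c c" for n
      using assms(1)[of n] S by (auto simp: dominated_def intro: psd_onD)
    have "0 \<le> Re (sesq_form S (\<lambda>i j. of_real t * K i j - G i * cnj (G j)) c c)"
      by (rule LIMSEQ_le_const[OF tendsto_Re[OF lim]]) (use nn in \<open>auto simp: less_eq_complex_def\<close>)
    moreover have "(\<lambda>n. 0) \<longlonglongrightarrow> Im (sesq_form S (\<lambda>i j. of_real t * K i j - G i * cnj (G j)) c c)"
      using tendsto_Im[OF lim] nn by (simp add: less_eq_complex_def)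
    ultimately show "0 \<le> sesq_form S (\<lambda>i j. of_real t * K i j - G i * cnj (G j)) c c"
      by (simp add: less_eq_complex_def LIMSEQ_const_iff)
  qed
  then show ?thesis using assms(1) by (simp add: dominated_def)
qed

lemma dominated_mono: "dominated F t \<Longrightarrow> t \<le> u \<Longrightarrow> dominated F u"
proof -
  assume F: "dominated F t" and tu: "t \<le> u"
  have "psd_on I (\<lambda>i j. (of_real t * K i j - F i * cnj (F j)) + of_real (u - t) * K i j)"
    using F tu unfolding dominated_def by (intro psd_on_add psd_on_scale psd) (auto simp: less_eq_complex_def)
  then have "psd_on I (\<lambda>i j. of_real u * K i j - F i * cnj (F j))"
    by (rule psd_on_cong) (simp add: algebra_simps)
  then show "dominated F u" using F tu by (simp add: dominated_def)
qed

lemma ip_add: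
  "dominated F t \<Longrightarrow> dominated F' t' \<Longrightarrow> dominated G u \<Longrightarrow> ip (F + F') G = ip F G + ip F' G"
  by (rule ip_unique[OF dominated_add _ fin_ip_add]) (auto intro: tendsto_add tendsto_ip)

lemma ip_scaleC: "dominated F t \<Longrightarrow> dominated G u \<Longrightarrow> ip (c *\<^sub>C F) G = c * ip F G"
  by (rule ip_unique[OF dominated_scaleC _ fin_ip_scaleC]) (auto intro: tendsto_mult tendsto_ip)

lemma ip_commute: "dominated F t \<Longrightarrow> dominated G u \<Longrightarrow> ip F G = cnj (ip G F)"
  by (rule ip_unique[OF _ _ fin_ip_commute]) (auto intro: tendsto_cnj tendsto_ip)

lemma carrier_rkhs_on: "F \<in> carrier rkhs_on \<longleftrightarrow> (\<exists>t. dominated F t) \<and> (\<forall>i. i \<notin> I \<longrightarrow> F i = 0)"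
  by (simp add: rkhs_on_def)

lemma hnorm_rkhs_on: "hnorm rkhs_on F = sqrt (Re (ip F F))"
  by (simp add: rkhs_on_def hnorm_def)

lemma dominated_hnorm:
  assumes "dominated F t" shows "dominated F ((hnorm rkhs_on F)\<^sup>2)"
  using ip_self[OF assms] by (simp add: hnorm_rkhs_on)

lemma cmod_le_hnorm_rkhs_on:
  assumes "dominated F t" "i \<in> I"
  shows "cmod (F i) \<le> hnorm rkhs_on F * sqrt (Re (K i i))"
proof -
  have "cmod (F i) \<le> sqrt ((hnorm rkhs_on F)\<^sup>2 * Re (K i i))"
    by (rule real_le_rsqrt) (rule dominated_pointwise[OF dominated_hnorm[OF assms(1)] assms(2)])
  also have "\<dots> = hnorm rkhs_on F * sqrt (Re (K i i))"
    using ip_self(1)[OF assms(1)] by (simp add: real_sqrt_mult hnorm_rkhs_on)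
  finally show ?thesis .
qed

lemma hnorm_rkhs_on_le:
  assumes "dominated F (\<epsilon>\<^sup>2)" "0 \<le> \<epsilon>" shows "hnorm rkhs_on F \<le> \<epsilon>"
  unfolding hnorm_rkhs_on using ip_self(2)[OF assms(1)] assms(2) by (intro real_le_lsqrt) auto

text \<open>
  A Cauchy sequence converges pointwise, and \<open>dominated_limit\<close> carries the estimates of its
  differences over to the pointwise limit.
\<close>

lemma complete_rkhs_on:
  fixes u :: "nat \<Rightarrow> 'i \<Rightarrow> complex"
  assumes u: "\<And>n. u n \<in> carrier rkhs_on"
    and Cauchy: "\<And>\<epsilon>. \<epsilon> > 0 \<Longrightarrow> \<exists>M. \<forall>m\<ge>M. \<forall>n\<ge>M. hnorm rkhs_on (u m - u n) < \<epsilon>"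
  shows "\<exists>x\<in>carrier rkhs_on. (\<lambda>n. hnorm rkhs_on (u n - x)) \<longlonglongrightarrow> 0"
proof -
  have "\<exists>t. dominated (u n) t" for n using u by (simp add: carrier_rkhs_on)
  then obtain t where t: "\<And>n. dominated (u n) (t n)" by metis
  have "\<exists>l. (\<lambda>n. u n i) \<longlonglongrightarrow> l" if i: "i \<in> I" for i
  proof -
    have "Cauchy (\<lambda>n. u n i)"
    proof (rule CauchyI)
      fix e :: real assume e: "0 < e"
      define k where "k = sqrt (Re (K i i))"
      have k: "0 \<le> k" using psd_on_diag[OF psd i] by (simp add: less_eq_complex_def k_def)
      obtain M where M: "\<forall>m\<ge>M. \<forall>n\<ge>M. hnorm rkhs_on (u m - u n) < e / (k + 1)"
        using Cauchy[of "e / (k + 1)"] e k by (auto simp: add_nonneg_pos)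
      show "\<exists>M. \<forall>m\<ge>M. \<forall>n\<ge>M. norm (u m i - u n i) < e"
      proof (intro exI[of _ M] allI impI)
        fix m n assume mn: "M \<le> m" "M \<le> n"
        have "norm ((u m - u n) i) \<le> hnorm rkhs_on (u m - u n) * k"
          unfolding k_def by (rule cmod_le_hnorm_rkhs_on[OF dominated_diff[OF t t] i])
        also have "\<dots> \<le> e / (k + 1) * k"
          using M mn k by (intro mult_right_mono) (auto intro: less_imp_le)
        also have "\<dots> < e" using e k by (simp add: pos_divide_less_eq algebra_simps)
        finally show "norm (u m i - u n i) < e" by simp
      qed
    qed
    then show ?thesis using Cauchy_convergent convergent_def by blast
  qed
  then obtain l where l: "\<And>i. i \<in> I \<Longrightarrow> (\<lambda>n. u n i) \<longlonglongrightarrow> l i" by metis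
  define L where "L i = (if i \<in> I then l i else 0)" for i
  have close: "\<exists>M. \<forall>n\<ge>M. dominated (u n - L) (\<epsilon>\<^sup>2)" if \<epsilon>: "\<epsilon> > 0" for \<epsilon>
  proof -
    obtain M where M: "\<forall>m\<ge>M. \<forall>n\<ge>M. hnorm rkhs_on (u m - u n) < \<epsilon>" using Cauchy[OF \<epsilon>] by blast
    have "dominated (u n - L) (\<epsilon>\<^sup>2)" if n: "n \<ge> M" for n
    proof (rule dominated_limit[where F = "\<lambda>m. u n - u (m + M)"])
      fix m
      have "(hnorm rkhs_on (u n - u (m + M)))\<^sup>2 \<le> \<epsilon>\<^sup>2"
        using M n ip_self(1)[OF dominated_diff[OF t[of n] t[of "m + M"]]]
        by (intro power_mono) (auto simp: hnorm_rkhs_on intro: less_imp_le)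
      then show "dominated (u n - u (m + M)) (\<epsilon>\<^sup>2)"
        using dominated_mono[OF dominated_hnorm[OF dominated_diff[OF t t]]] by blast
    next
      fix i assume i: "i \<in> I"
      show "(\<lambda>m. (u n - u (m + M)) i) \<longlonglongrightarrow> (u n - L) i"
        using LIMSEQ_ignore_initial_segment[OF l[OF i], of M] i by (auto simp: L_def intro!: tendsto_intros)
    qed
    then show ?thesis by blast
  qed
  obtain M where "dominated (u M - L) (1\<^sup>2)" using close[of 1] by auto
  from dominated_diff[OF t[of M] this] have "\<exists>t. dominated L t" by auto
  then have "L \<in> carrier rkhs_on" by (simp add: carrier_rkhs_on L_def)
  moreover have "(\<lambda>n. hnorm rkhs_on (u n - L)) \<longlonglongrightarrow> 0"
  proof (rule LIMSEQ_I)
    fix r :: real assume r: "0 < r"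
    then obtain M where M: "\<forall>n\<ge>M. dominated (u n - L) ((r / 2)\<^sup>2)" using close[of "r / 2"] by auto
    have "norm (hnorm rkhs_on (u n - L) - 0) < r" if "n \<ge> M" for n
    proof -
      have d: "dominated (u n - L) ((r / 2)\<^sup>2)" using M that by blast
      then have "0 \<le> hnorm rkhs_on (u n - L)" using ip_self(1) by (auto simp: hnorm_rkhs_on)
      moreover have "hnorm rkhs_on (u n - L) \<le> r / 2"
        by (rule hnorm_rkhs_on_le[OF d]) (use r in simp)
      ultimately show ?thesis using r by simp
    qed
    then show "\<exists>M. \<forall>n\<ge>M. norm (hnorm rkhs_on (u n - L) - 0) < r" by blast
  qed
  ultimately show ?thesis by blast
qed

lemma hilbert_space_rkhs_on: "hilbert_space rkhs_on"
proof
  have "dominated 0 0"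
    by (simp add: dominated_def psd_on_def sesq_form_def)
  then have "0 \<in> carrier rkhs_on" by (auto simp: carrier_rkhs_on)
  moreover have "F + G \<in> carrier rkhs_on" if "F \<in> carrier rkhs_on" "G \<in> carrier rkhs_on" for F G
    using that dominated_add unfolding carrier_rkhs_on by (metis add.right_neutral plus_fun_apply)
  moreover have "c *\<^sub>C F \<in> carrier rkhs_on" if "F \<in> carrier rkhs_on" for c F
  proof -
    have "(c *\<^sub>C F) i = 0" if "F i = 0" for i using that by (simp add: scaleC_fun_def scaleC_complex_def)
    then show ?thesis using that dominated_scaleC unfolding carrier_rkhs_on by blast
  qed
  ultimately show "complex_vector.subspace (carrier rkhs_on)"
    unfolding complex_vector.subspace_def by blast
next
  fix x y z assume "x \<in> carrier rkhs_on" "y \<in> carrier rkhs_on" "z \<in> carrier rkhs_on"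
  then show "cinner rkhs_on (x + y) z = cinner rkhs_on x z + cinner rkhs_on y z"
    by (auto simp: rkhs_on_def intro: ip_add)
next
  fix x y c assume "x \<in> carrier rkhs_on" "y \<in> carrier rkhs_on"
  then show "cinner rkhs_on (c *\<^sub>C x) y = c * cinner rkhs_on x y"
    by (auto simp: rkhs_on_def intro: ip_scaleC)
next
  fix x y assume "x \<in> carrier rkhs_on" "y \<in> carrier rkhs_on"
  then show "cinner rkhs_on x y = cnj (cinner rkhs_on y x)"
    by (auto simp: rkhs_on_def intro: ip_commute)
next
  fix x assume x: "x \<in> carrier rkhs_on" "x \<noteq> 0"
  obtain t where t: "dominated x t" using x(1) by (auto simp: carrier_rkhs_on)
  obtain i where i: "i \<in> I" "x i \<noteq> 0" using x by (auto simp: carrier_rkhs_on fun_eq_iff)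
  have "hnorm rkhs_on x \<noteq> 0" using cmod_le_hnorm_rkhs_on[OF t i(1)] i(2) by auto
  then have "0 < Re (ip x x)"
    using ip_self(1)[OF t] by (auto simp: hnorm_rkhs_on less_le)
  then show "0 < Re (cinner rkhs_on x x)" by (simp add: rkhs_on_def)
next
  fix u :: "nat \<Rightarrow> 'i \<Rightarrow> complex"
  assume "\<And>n. u n \<in> carrier rkhs_on"
    and "\<forall>\<epsilon>>0. \<exists>M. \<forall>m\<ge>M. \<forall>n\<ge>M. hnorm rkhs_on (u m - u n) < \<epsilon>"
  then show "\<exists>x\<in>carrier rkhs_on. (\<lambda>n. hnorm rkhs_on (u n - x)) \<longlonglongrightarrow> 0"
    by (intro complete_rkhs_on) auto
qed

lemma kernel_function:
  assumes j: "j \<in> I"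
  defines "k \<equiv> \<lambda>i. if i \<in> I then K i j else 0"
  shows "k \<in> carrier rkhs_on" and "F \<in> carrier rkhs_on \<Longrightarrow> cinner rkhs_on F k = F j"
proof -
  have d: "dominated k (Re (K j j))"
  proof -
    have r: "of_real (Re (K j j)) = K j j" "0 \<le> Re (K j j)" "0 \<le> K j j"
      using psd_on_diag[OF psd j] by (auto simp: less_eq_complex_def complex_eq_iff)
    have "psd_on I (\<lambda>i i'. K j j * (K i i' - K i j * K j i' / K j j))"
      by (intro psd_on_scale psd_on_schur_complement psd j r)
    then have "psd_on I (\<lambda>i i'. of_real (Re (K j j)) * K i i' - k i * cnj (k i'))"
    proof (rule psd_on_cong)
      fix i i' assume i: "i \<in> I" "i' \<in> I"
      have "cnj (K i' j) = K j i'" using psd_on_hermitian[OF psd i(2) j] by simp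
      moreover have "K i j = 0" if "K j j = 0" using psd_on_zero_diag[OF psd i(1) j that] .
      ultimately show "K j j * (K i i' - K i j * K j i' / K j j) = of_real (Re (K j j)) * K i i' - k i * cnj (k i')"
        using i by (cases "K j j = 0") (simp_all add: r k_def right_diff_distrib)
    qed
    then show ?thesis using r by (simp add: dominated_def)
  qed
  then show "k \<in> carrier rkhs_on" by (auto simp: carrier_rkhs_on k_def)
  assume "F \<in> carrier rkhs_on"
  then obtain t where t: "dominated F t" by (auto simp: carrier_rkhs_on)
  have "\<forall>\<^sub>F S in finite_subsets_at_top I. F j = fin_ip S F k"
    unfolding eventually_finite_subsets_at_top
  proof (intro exI[of _ "{j}"] conjI allI impI)
    fix S assume S: "finite S \<and> {j} \<subseteq> S \<and> S \<subseteq> I"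
    then have S': "finite S" "S \<subseteq> I" "j \<in> S" by auto
    obtain a where a: "has_coeffs S F a" using dominated_coeffs[OF t S'(1,2)] by blast
    have b: "has_coeffs S k (\<lambda>i. if i = j then 1 else 0)"
      using S' by (auto simp: has_coeffs_def k_def if_distrib cong: if_cong)
    have "fin_ip S F k = (\<Sum>i\<in>S. cnj (if i = j then 1 else 0) * F i)"
      using fin_ip_eq[OF S'(1,2) a b] coeffs_form(1)[OF S'(1,2) a b] by simp
    also have "\<dots> = (\<Sum>i\<in>S. if i = j then F i else 0)" by (rule sum.cong) auto
    finally show "F j = fin_ip S F k" using S' by simp
  qed (use j in auto)
  then have "((\<lambda>S. fin_ip S F k) \<longlongrightarrow> F j) (finite_subsets_at_top I)"
    by (rule Lim_transform_eventually[OF tendsto_const])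
  then have "ip F k = F j"
    by (rule ip_unique[OF t d refl])
  then show "cinner rkhs_on F k = F j" by (simp add: rkhs_on_def)
qed

end

text \<open>
  Functions are extended by \<open>0\<close> outside \<open>I\<close>, so that distinct functions differ at a point of \<open>I\<close>.
\<close>

definition is_rkhs_on :: "'i set \<Rightarrow> ('i \<Rightarrow> 'i \<Rightarrow> complex) \<Rightarrow> ('i \<Rightarrow> complex) hspace \<Rightarrow> bool" where
  "is_rkhs_on I K H \<longleftrightarrow> hilbert_space H \<and> (\<forall>F\<in>carrier H. \<forall>i. i \<notin> I \<longrightarrow> F i = 0) \<and>
    (\<forall>j\<in>I. (\<lambda>i. if i \<in> I then K i j else 0) \<in> carrier H) \<and>
    (\<forall>F\<in>carrier H. \<forall>j\<in>I. cinner H F (\<lambda>i. if i \<in> I then K i j else 0) = F j)"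

lemma is_rkhs_onD:
  assumes "is_rkhs_on I K H"
  shows "hilbert_space H"
    and "F \<in> carrier H \<Longrightarrow> i \<notin> I \<Longrightarrow> F i = 0"
    and "j \<in> I \<Longrightarrow> (\<lambda>i. if i \<in> I then K i j else 0) \<in> carrier H"
    and "F \<in> carrier H \<Longrightarrow> j \<in> I \<Longrightarrow> cinner H F (\<lambda>i. if i \<in> I then K i j else 0) = F j"
  using assms unfolding is_rkhs_on_def by blast+

theorem Moore_Aronszajn:
  assumes "psd_on I K"
  shows "\<exists>H. is_rkhs_on I K H"
proof -
  interpret psd_kernel I K by unfold_locales (rule assms)
  have "is_rkhs_on I K rkhs_on"
    unfolding is_rkhs_on_def
    using hilbert_space_rkhs_on kernel_function carrier_rkhs_on by auto
  then show ?thesis ..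
qed

section \<open>Vector-valued reproducing kernel Hilbert spaces and their multipliers\<close>

lemma sum_scaleC_apply:
  "(\<Sum>i\<in>S. c i *\<^sub>C f i) z = (\<Sum>i\<in>S. c i *\<^sub>C f i z)" for f :: "'i \<Rightarrow> 'x \<Rightarrow> 'e::complex_vector"
  by (induction S rule: infinite_finite_induct) (auto simp: scaleC_fun_def)

lemma is_rkhs_rkhs:
  assumes "pd_kernel k"
  shows "is_rkhs k (rkhs k)"
proof -
  have "psd_on UNIV k" using assms by (simp add: pd_kernel_iff_psd_on)
  from Moore_Aronszajn[OF this] have "\<exists>H. is_rkhs k H" by (auto simp: is_rkhs_def is_rkhs_on_def)
  then show ?thesis unfolding rkhs_def by (rule someI_ex)
qed

text \<open>
  A function \<open>u\<close> with values in \<open>E\<close> is identified with the scalar function \<open>(z, e) \<mapsto> \<langle>u(z), e\<rangle>\<close>. This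
  carries \<open>H\<^sub>k \<otimes> E\<close> onto the scalar reproducing kernel Hilbert space of \<open>tensor_kernel k E\<close>.
\<close>

definition scalarize :: "'e::complex_vector hspace \<Rightarrow> ('x \<Rightarrow> 'e) \<Rightarrow> 'x \<times> 'e \<Rightarrow> complex" where
  "scalarize E u = (\<lambda>(z, e). if e \<in> carrier E then cinner E (u z) e else 0)"

definition tensor_kernel :: "('x \<Rightarrow> 'x \<Rightarrow> complex) \<Rightarrow> 'e::complex_vector hspace \<Rightarrow> 'x \<times> 'e \<Rightarrow> 'x \<times> 'e \<Rightarrow> complex" where
  "tensor_kernel k E i j = k (fst i) (fst j) * cinner E (snd j) (snd i)"

lemma psd_on_tensor_kernel:
  assumes "psd_on UNIV k" "hilbert_space E"
  shows "psd_on (UNIV \<times> carrier E) (tensor_kernel k E)"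
proof -
  interpret hilbert_space E by fact
  show ?thesis
    unfolding tensor_kernel_def
    by (intro psd_on_schur_product psd_on_pullback[OF assms(1)] psd_on_cinner) auto
qed

lemma scalarize_add: "hilbert_space E \<Longrightarrow> (\<And>z. u z \<in> carrier E) \<Longrightarrow> (\<And>z. v z \<in> carrier E) \<Longrightarrow>
    scalarize E (u + v) = scalarize E u + scalarize E v"
  by (auto simp: scalarize_def fun_eq_iff hilbert_space.cinner_add_left)

lemma scalarize_scaleC: "hilbert_space E \<Longrightarrow> (\<And>z. u z \<in> carrier E) \<Longrightarrow> scalarize E (c *\<^sub>C u) = c *\<^sub>C scalarize E u"
  by (auto simp: scalarize_def fun_eq_iff scaleC_fun_def scaleC_complex_def hilbert_space.cinner_scaleC_left)

lemma scalarize_diff: "hilbert_space E \<Longrightarrow> (\<And>z. u z \<in> carrier E) \<Longrightarrow> (\<And>z. v z \<in> carrier E) \<Longrightarrow>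
    scalarize E (u - v) = scalarize E u - scalarize E v"
  by (auto simp: scalarize_def fun_eq_iff hilbert_space.cinner_diff_left)

lemma scalarize_sum:
  fixes u :: "'i \<Rightarrow> 'x \<Rightarrow> 'e::complex_vector"
  assumes "hilbert_space E" "finite S" "\<And>i z. i \<in> S \<Longrightarrow> u i z \<in> carrier E"
  shows "scalarize E (\<Sum>i\<in>S. c i *\<^sub>C u i) = (\<Sum>i\<in>S. c i *\<^sub>C scalarize E (u i))"
proof
  fix p :: "'x \<times> 'e"
  interpret hilbert_space E by fact
  show "scalarize E (\<Sum>i\<in>S. c i *\<^sub>C u i) p = (\<Sum>i\<in>S. c i *\<^sub>C scalarize E (u i)) p"
    using assms(2,3)
    by (auto simp: scalarize_def sum_scaleC_apply scaleC_complex_def split_beta intro!: cinner_sum_left)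
qed

text \<open>
  The space is transported from the reproducing kernel Hilbert space \<open>H\<close> of \<open>tensor_kernel k E\<close>. Each
  \<open>F\<close> in \<open>H\<close> comes from an \<open>E\<close>-valued function by Riesz representation in \<open>E\<close>, applied at every point.
  Membership and the norm bound of an elementary tensor \<open>f \<otimes> e\<close> follow from a Schur product of the
  Cauchy--Schwarz inequalities for \<open>f\<close> and for \<open>e\<close>. Multiplicativity of the inner product is the
  reproducing property when the second factor is a kernel function, and extends by density.
\<close>

theorem is_rkhs_tensor_rkhs_tensor:
  fixes k :: "'x \<Rightarrow> 'x \<Rightarrow> complex" and E :: "'e::complex_vector hspace"
  assumes k: "pd_kernel k" and E: "hilbert_space E"
  shows "is_rkhs_tensor k E (rkhs_tensor k E)"
proof -
  let ?R = "rkhs k"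
  have psk: "psd_on UNIV k" using k by (simp add: pd_kernel_iff_psd_on)
  have R: "hilbert_space ?R" "\<And>w. (\<lambda>z. k z w) \<in> carrier ?R"
    "\<And>f w. f \<in> carrier ?R \<Longrightarrow> cinner ?R f (\<lambda>z. k z w) = f w"
    using is_rkhs_rkhs[OF k] by (auto simp: is_rkhs_def)
  interpret E: hilbert_space E by fact
  interpret R: hilbert_space ?R by fact
  let ?I = "UNIV \<times> carrier E :: ('x \<times> 'e) set"
  let ?K = "tensor_kernel k E"
  obtain H where H0: "is_rkhs_on ?I ?K H"
    using Moore_Aronszajn[OF psd_on_tensor_kernel[OF psk E]] by blast
  note H = is_rkhs_onD[OF H0]
  interpret H: hilbert_space H by (rule H(1))
  define v where "v j = (\<lambda>i. if i \<in> ?I then ?K i j else 0)" for j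
  have v: "v j \<in> carrier H" "F \<in> carrier H \<Longrightarrow> cinner H F (v j) = F j" if "j \<in> ?I" for F j
    unfolding v_def using H(3,4) that by blast+
  have vv: "cinner H (v j) (v i) = ?K i j" if "i \<in> ?I" "j \<in> ?I" for i j
  proof -
    have "cinner H (v j) (v i) = v j i" by (rule v(2)[OF that(1) v(1)[OF that(2)]])
    then show ?thesis using that by (simp add: v_def)
  qed
  have v_sect: "v (z, e) = scalarize E (elem_tensor (\<lambda>w. k w z) e)" if "e \<in> carrier E" for z e
    using that by (auto simp: v_def scalarize_def elem_tensor_def tensor_kernel_def fun_eq_iff E.cinner_scaleC_left)
  have moments: "psd_on ?I (\<lambda>i j. of_real ((hnorm H F)\<^sup>2) * ?K i j - F i * cnj (F j))"
    if F: "F \<in> carrier H" for F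
    by (rule psd_on_cong[OF H.psd_on_moments[of ?I v F "hnorm H F"]]) (use F v vv in auto)
  \<comment> \<open>Membership in \<open>H\<close>, the norm bound and approximation by kernel functions are all instances of
      the moment problem, since a function is determined by its values.\<close>
  have solve: "F \<in> carrier H \<and> hnorm H F \<le> C \<and>
      (\<forall>\<epsilon>>0. \<exists>S c. finite S \<and> S \<subseteq> ?I \<and> hnorm H (F - (\<Sum>i\<in>S. c i *\<^sub>C v i)) < \<epsilon>)"
    if C: "0 \<le> C" and F: "\<And>i. i \<notin> ?I \<Longrightarrow> F i = 0"
      and psd: "psd_on ?I (\<lambda>i j. of_real (C\<^sup>2) * ?K i j - F i * cnj (F j))" for F C
  proof -
    have ps: "psd_on ?I (\<lambda>i j. of_real (C\<^sup>2) * cinner H (v j) (v i) - F i * cnj (F j))"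
      by (rule psd_on_cong[OF psd]) (use vv in auto)
    have "\<exists>u\<in>carrier H. (\<forall>i\<in>?I. cinner H u (v i) = F i) \<and> hnorm H u \<le> C \<and>
        (\<forall>\<epsilon>>0. \<exists>S c. finite S \<and> S \<subseteq> ?I \<and> hnorm H (u - (\<Sum>i\<in>S. c i *\<^sub>C v i)) < \<epsilon>)"
    proof (rule H.moment_problem)
      show "v i \<in> carrier H" if "i \<in> ?I" for i by (rule v(1)[OF that])
    qed (rule C, rule ps)
    then obtain u where u1: "u \<in> carrier H" and u2: "(\<forall>i\<in>?I. cinner H u (v i) = F i) \<and> hnorm H u \<le> C \<and>
        (\<forall>\<epsilon>>0. \<exists>S c. finite S \<and> S \<subseteq> ?I \<and> hnorm H (u - (\<Sum>i\<in>S. c i *\<^sub>C v i)) < \<epsilon>)" ..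
    have "u = F"
    proof
      fix i show "u i = F i"
      proof (cases "i \<in> ?I")
        case True
        then have "cinner H u (v i) = F i" using u2 by blast
        then show ?thesis using v(2)[OF True u1] by simp
      next
        case False
        then show ?thesis using H(2)[OF u1 False] F[OF False] by simp
      qed
    qed
    then show ?thesis using u1 u2 by simp
  qed
  have riesz: "\<exists>u. (\<forall>z. u z \<in> carrier E) \<and> scalarize E u = F" if F: "F \<in> carrier H" for F
  proof -
    have "\<exists>x\<in>carrier E. \<forall>e\<in>carrier E. cinner E x e = F (z, e)" for z
    proof -
      let ?C = "hnorm H F * sqrt (Re (k z z))"
      have kz: "0 \<le> Re (k z z)" "of_real (Re (k z z)) = k z z"
        using psd_on_diag[OF psk, of z] by (auto simp: less_eq_complex_def complex_eq_iff)
      have C2: "of_real (?C\<^sup>2) = of_real ((hnorm H F)\<^sup>2) * k z z"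
        using kz by (simp add: power_mult_distrib)
      have "psd_on (carrier E) (\<lambda>e e'. of_real ((hnorm H F)\<^sup>2) * ?K (z, e) (z, e') - F (z, e) * cnj (F (z, e')))"
        by (rule psd_on_pullback[OF moments[OF F]]) auto
      then have "psd_on (carrier E) (\<lambda>e e'. of_real (?C\<^sup>2) * cinner E e' e - F (z, e) * cnj (F (z, e')))"
        by (rule psd_on_cong) (simp only: C2 tensor_kernel_def fst_conv snd_conv mult.assoc)
      then show ?thesis
        using E.moment_problem[of "carrier E" "\<lambda>e. e" ?C "\<lambda>e. F (z, e)"] kz F by auto
    qed
    then obtain u where u: "\<And>z. u z \<in> carrier E" "\<And>z e. e \<in> carrier E \<Longrightarrow> cinner E (u z) e = F (z, e)"
      by metis
    then have "scalarize E u = F" using H(2)[OF F] by (auto simp: scalarize_def fun_eq_iff)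
    then show ?thesis using u by blast
  qed
  define T :: "('x \<Rightarrow> 'e) hspace" where
    "T = \<lparr>carrier = {u. (\<forall>z. u z \<in> carrier E) \<and> scalarize E u \<in> carrier H},
      cinner = (\<lambda>u v. cinner H (scalarize E u) (scalarize E v))\<rparr>"
  have carrT: "u \<in> carrier T \<longleftrightarrow> (\<forall>z. u z \<in> carrier E) \<and> scalarize E u \<in> carrier H" for u
    by (simp add: T_def)
  have ipT: "cinner T u w = cinner H (scalarize E u) (scalarize E w)" for u w by (simp add: T_def)
  have normT: "hnorm T u = hnorm H (scalarize E u)" for u by (simp add: hnorm_def ipT)
  have hT: "hilbert_space T"
  proof
    have "scalarize E (0 :: 'x \<Rightarrow> 'e) = 0" by (auto simp: scalarize_def fun_eq_iff)
    then have "0 \<in> carrier T" by (simp add: carrT)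
    moreover have "x \<in> carrier T \<Longrightarrow> y \<in> carrier T \<Longrightarrow> x + y \<in> carrier T" for x y
      by (simp add: carrT scalarize_add[OF E])
    moreover have "x \<in> carrier T \<Longrightarrow> c *\<^sub>C x \<in> carrier T" for x c
      by (simp add: carrT scalarize_scaleC[OF E]) (simp add: scaleC_fun_def)
    ultimately show "complex_vector.subspace (carrier T)"
      unfolding complex_vector.subspace_def by blast
  next
    fix x y z assume "x \<in> carrier T" "y \<in> carrier T" "z \<in> carrier T"
    then show "cinner T (x + y) z = cinner T x z + cinner T y z"
      by (simp add: carrT ipT scalarize_add[OF E] H.cinner_add_left)
  next
    fix x y c assume "x \<in> carrier T" "y \<in> carrier T"
    then show "cinner T (c *\<^sub>C x) y = c * cinner T x y"
      by (simp add: carrT ipT scalarize_scaleC[OF E] H.cinner_scaleC_left)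
  next
    fix x y assume "x \<in> carrier T" "y \<in> carrier T"
    then show "cinner T x y = cnj (cinner T y x)"
      unfolding carrT ipT by (intro H.cinner_commute) auto
  next
    fix x assume x: "x \<in> carrier T" "x \<noteq> 0"
    then obtain z where z: "x z \<noteq> 0" by (auto simp: fun_eq_iff)
    have "scalarize E x (z, x z) \<noteq> 0"
      using E.cinner_pos[of "x z"] z x by (auto simp: scalarize_def carrT)
    then have "scalarize E x \<noteq> 0" by auto
    then show "0 < Re (cinner T x x)"
      using x by (simp add: carrT ipT H.cinner_pos)
  next
    fix u :: "nat \<Rightarrow> 'x \<Rightarrow> 'e"
    assume u: "\<And>n. u n \<in> carrier T"
      and Cauchy: "\<forall>\<epsilon>>0. \<exists>M. \<forall>m\<ge>M. \<forall>n\<ge>M. hnorm T (u m - u n) < \<epsilon>"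
    have uE: "u n z \<in> carrier E" for n z using u by (simp add: carrT)
    have "\<exists>F\<in>carrier H. (\<lambda>n. hnorm H (scalarize E (u n) - F)) \<longlonglongrightarrow> 0"
      by (rule H.complete) (use u Cauchy in \<open>simp_all add: carrT normT scalarize_diff[OF E uE uE]\<close>)
    then obtain F where F: "F \<in> carrier H" "(\<lambda>n. hnorm H (scalarize E (u n) - F)) \<longlonglongrightarrow> 0" by blast
    obtain x where x: "\<And>z. x z \<in> carrier E" "scalarize E x = F" using riesz[OF F(1)] by blast
    have "(\<lambda>n. hnorm T (u n - x)) \<longlonglongrightarrow> 0"
      using F(2) by (simp add: normT scalarize_diff[OF E uE x(1)] x(2))
    then show "\<exists>x\<in>carrier T. (\<lambda>n. hnorm T (u n - x)) \<longlonglongrightarrow> 0"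
      using x F(1) by (intro bexI[of _ x]) (simp_all add: carrT)
  qed
  have psR: "psd_on UNIV (\<lambda>z w. of_real ((hnorm ?R f)\<^sup>2) * k z w - f z * cnj (f w))" if f: "f \<in> carrier ?R" for f
    by (rule psd_on_cong[OF R.psd_on_moments[of UNIV "\<lambda>w z. k z w" f "hnorm ?R f"]]) (use f R in auto)
  have elem: "elem_tensor f e \<in> carrier T" "hnorm T (elem_tensor f e) \<le> hnorm ?R f * hnorm E e"
    if f: "f \<in> carrier ?R" and e: "e \<in> carrier E" for f e
  proof -
    let ?F = "scalarize E (elem_tensor f e)"
    let ?a = "hnorm ?R f" and ?b = "hnorm E e"
    have F: "?F i = f (fst i) * cinner E e (snd i)" if "i \<in> ?I" for i
      using that e by (auto simp: scalarize_def elem_tensor_def E.cinner_scaleC_left split_beta)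
    have psE: "psd_on (carrier E) (\<lambda>x y. of_real (?b\<^sup>2) * cinner E y x - cinner E e x * cnj (cinner E e y))"
      by (rule E.psd_on_moments) (use e in auto)
    have p1: "psd_on ?I (\<lambda>i j. of_real (?a\<^sup>2) * k (fst i) (fst j) - f (fst i) * cnj (f (fst j)))"
      by (rule psd_on_pullback[OF psR[OF f]]) auto
    have p2: "psd_on ?I (\<lambda>i j. of_real (?b\<^sup>2) * cinner E (snd j) (snd i))"
      by (intro psd_on_scale E.psd_on_cinner) (auto simp: less_eq_complex_def)
    have p3: "psd_on ?I (\<lambda>i j. of_real (?b\<^sup>2) * cinner E (snd j) (snd i) - cinner E e (snd i) * cnj (cinner E e (snd j)))"
      by (rule psd_on_pullback[OF psE]) auto
    have "psd_on ?I (\<lambda>i j. (of_real (?a\<^sup>2) * k (fst i) (fst j) - f (fst i) * cnj (f (fst j))) * (of_real (?b\<^sup>2) * cinner E (snd j) (snd i))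
        + cnj (cnj (f (fst i))) * cnj (f (fst j)) * (of_real (?b\<^sup>2) * cinner E (snd j) (snd i) - cinner E e (snd i) * cnj (cinner E e (snd j))))"
      by (rule psd_on_add[OF psd_on_schur_product[OF p1 p2] psd_on_schur_product[OF psd_on_rank_one p3]])
    then have "psd_on ?I (\<lambda>i j. of_real ((?a * ?b)\<^sup>2) * ?K i j - ?F i * cnj (?F j))"
      by (rule psd_on_cong) (simp add: F tensor_kernel_def power_mult_distrib algebra_simps)
    then have "?F \<in> carrier H \<and> hnorm H ?F \<le> ?a * ?b"
      using solve[of "?a * ?b" ?F] f e by (auto simp: scalarize_def split: if_splits)
    then show "elem_tensor f e \<in> carrier T" "hnorm T (elem_tensor f e) \<le> ?a * ?b"
      using e by (simp_all add: carrT normT) (simp add: elem_tensor_def)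
  qed
  have elem_sect: "scalarize E (elem_tensor f e) \<in> carrier H" if "f \<in> carrier ?R" "e \<in> carrier E" for f e
    using elem(1)[OF that] by (simp add: carrT)
  have repro: "cinner T u (elem_tensor (\<lambda>w. k w z) e) = cinner E (u z) e" if "u \<in> carrier T" "e \<in> carrier E" for u z e
    using that v(2)[of "(z, e)" "scalarize E u"] by (simp add: ipT v_sect[symmetric] carrT) (simp add: scalarize_def)
  have dense_R: "\<exists>S c. finite S \<and> hnorm ?R (f - (\<Sum>i\<in>S. c i *\<^sub>C (\<lambda>w. k w i))) < \<epsilon>"
    if f: "f \<in> carrier ?R" and \<epsilon>: "0 < \<epsilon>" for f \<epsilon>
  proof -
    have ps: "psd_on UNIV (\<lambda>z w. of_real ((hnorm ?R f)\<^sup>2) * cinner ?R (\<lambda>x. k x w) (\<lambda>x. k x z) - f z * cnj (f w))"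
      using psR[OF f] R(3)[OF R(2)] by simp
    have "\<exists>u\<in>carrier ?R. (\<forall>i\<in>UNIV. cinner ?R u (\<lambda>x. k x i) = f i) \<and> hnorm ?R u \<le> hnorm ?R f \<and>
        (\<forall>\<epsilon>>0. \<exists>S c. finite S \<and> S \<subseteq> UNIV \<and> hnorm ?R (u - (\<Sum>i\<in>S. c i *\<^sub>C (\<lambda>x. k x i))) < \<epsilon>)"
      by (rule R.moment_problem[OF R(2) R.hnorm_nonneg[OF f] ps])
    then obtain u where u: "u \<in> carrier ?R" "\<And>i. cinner ?R u (\<lambda>x. k x i) = f i"
      "\<And>\<epsilon>. \<epsilon> > 0 \<Longrightarrow> \<exists>S c. finite S \<and> hnorm ?R (u - (\<Sum>i\<in>S. c i *\<^sub>C (\<lambda>x. k x i))) < \<epsilon>" by auto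
    have "u = f" using u(2) R(3)[OF u(1)] by auto
    then show ?thesis using u(3)[OF \<epsilon>] by simp
  qed
  have mult: "cinner T (elem_tensor f e) (elem_tensor f' e') = cinner ?R f f' * cinner E e e'"
    if f: "f \<in> carrier ?R" "f' \<in> carrier ?R" and e: "e \<in> carrier E" "e' \<in> carrier E" for f f' e e'
  proof -
    \<comment> \<open>The error term is bounded and conjugate linear in the second factor and vanishes on kernel
        functions.\<close>
    define D where "D g = cinner T (elem_tensor f e) (elem_tensor g e') - cinner ?R f g * cinner E e e'" for g
    define B where "B = 2 * (hnorm ?R f * hnorm E e * hnorm E e')"
    have B: "0 \<le> B" using f e by (simp add: B_def)
    interpret T: hilbert_space T by (rule hT)
    have Dbound: "cmod (D g) \<le> B * hnorm ?R g" if g: "g \<in> carrier ?R" for g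
    proof -
      have "cmod (cinner T (elem_tensor f e) (elem_tensor g e')) \<le> hnorm T (elem_tensor f e) * hnorm T (elem_tensor g e')"
        by (rule T.Cauchy_Schwarz) (use elem f e g in auto)
      also have "\<dots> \<le> (hnorm ?R f * hnorm E e) * (hnorm ?R g * hnorm E e')"
        by (intro mult_mono elem) (use f e g elem in auto)
      finally have 1: "cmod (cinner T (elem_tensor f e) (elem_tensor g e')) \<le> (hnorm ?R f * hnorm E e) * (hnorm ?R g * hnorm E e')" .
      have 2: "cmod (cinner ?R f g * cinner E e e') \<le> (hnorm ?R f * hnorm ?R g) * (hnorm E e * hnorm E e')"
        unfolding norm_mult by (intro mult_mono R.Cauchy_Schwarz E.Cauchy_Schwarz) (use f e g in auto)
      have "cmod (D g) \<le> (hnorm ?R f * hnorm E e) * (hnorm ?R g * hnorm E e') + (hnorm ?R f * hnorm ?R g) * (hnorm E e * hnorm E e')"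
        unfolding D_def using norm_triangle_ineq4 1 2 by (meson add_mono order_trans)
      then show ?thesis by (simp add: B_def algebra_simps)
    qed
    have small: "cmod (D f') \<le> B * \<epsilon>" if \<epsilon>: "0 < \<epsilon>" for \<epsilon>
    proof -
      obtain S c where S: "finite S" and close: "hnorm ?R (f' - (\<Sum>i\<in>S. c i *\<^sub>C (\<lambda>w. k w i))) < \<epsilon>"
        using dense_R[OF f(2) \<epsilon>] by blast
      define g where "g = (\<Sum>i\<in>S. c i *\<^sub>C (\<lambda>w. k w i))"
      have g: "g \<in> carrier ?R" using R by (auto simp: g_def)
      have sg: "scalarize E (elem_tensor g e') = (\<Sum>i\<in>S. c i *\<^sub>C v (i, e'))"
      proof -
        have "elem_tensor g e' = (\<Sum>i\<in>S. c i *\<^sub>C elem_tensor (\<lambda>w. k w i) e')"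
          by (rule ext) (simp add: g_def elem_tensor_def sum_scaleC_apply scaleC_complex_def
              complex_vector.scale_sum_left scaleC_scaleC)
        then show ?thesis
          using scalarize_sum[OF E S, of "\<lambda>i. elem_tensor (\<lambda>w. k w i) e'" c] e
          by (simp add: v_sect elem_tensor_def)
      qed
      have "cinner T (elem_tensor f e) (elem_tensor g e') = (\<Sum>i\<in>S. cnj (c i) * cinner H (scalarize E (elem_tensor f e)) (v (i, e')))"
        unfolding ipT sg by (rule H.cinner_sum_right[OF S]) (use e v elem_sect[OF f(1) e(1)] in auto)
      also have "\<dots> = (\<Sum>i\<in>S. cnj (c i) * (f i * cinner E e e'))"
        using e v(2)[OF _ elem_sect[OF f(1) e(1)]]
        by (intro sum.cong refl) (simp add: scalarize_def elem_tensor_def E.cinner_scaleC_left)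
      also have "\<dots> = cinner ?R f g * cinner E e e'"
      proof -
        have "cinner ?R f g = (\<Sum>i\<in>S. cnj (c i) * cinner ?R f (\<lambda>w. k w i))"
          unfolding g_def by (rule R.cinner_sum_right[OF S]) (use f R(2) in auto)
        also have "\<dots> = (\<Sum>i\<in>S. cnj (c i) * f i)" using R(3)[OF f(1)] by simp
        finally show ?thesis by (simp add: sum_distrib_right mult.assoc)
      qed
      finally have "D g = 0" by (simp add: D_def)
      moreover have "D (f' - g) = D f' - D g"
      proof -
        have eq: "elem_tensor (f' - g) e' = elem_tensor f' e' - elem_tensor g e'"
          by (auto simp: elem_tensor_def fun_eq_iff complex_vector.scale_left_diff_distrib)
        show ?thesis
          unfolding D_def eq R.cinner_diff_right[OF f(2) g f(1)]
            T.cinner_diff_right[OF elem(1)[OF f(2) e(2)] elem(1)[OF g e(2)] elem(1)[OF f(1) e(1)]]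
          by (simp add: algebra_simps)
      qed
      ultimately have "cmod (D f') = cmod (D (f' - g))" by simp
      also have "\<dots> \<le> B * hnorm ?R (f' - g)" by (rule Dbound) (use f g in auto)
      also have "\<dots> \<le> B * \<epsilon>" using close B by (intro mult_left_mono) (auto simp: g_def)
      finally show ?thesis .
    qed
    have "cmod (D f') \<le> 0"
    proof (rule field_le_epsilon)
      fix r :: real assume r: "0 < r"
      have "cmod (D f') \<le> B * (r / (B + 1))" by (rule small) (use r B in auto)
      also have "\<dots> \<le> r" using r B by (simp add: field_simps)
      finally show "cmod (D f') \<le> 0 + r" by simp
    qed
    then show ?thesis by (simp add: D_def)
  qed
  have dense_T: "\<exists>w\<in>complex_vector.span {elem_tensor f e | f e. f \<in> carrier ?R \<and> e \<in> carrier E}. hnorm T (u - w) < \<epsilon>"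
    if u: "u \<in> carrier T" and \<epsilon>: "0 < \<epsilon>" for u \<epsilon>
  proof -
    have uH: "scalarize E u \<in> carrier H" "\<And>z. u z \<in> carrier E" using u by (auto simp: carrT)
    have "\<exists>S c. finite S \<and> S \<subseteq> ?I \<and> hnorm H (scalarize E u - (\<Sum>i\<in>S. c i *\<^sub>C v i)) < \<epsilon>"
      using solve[of "hnorm H (scalarize E u)" "scalarize E u"] moments[OF uH(1)] uH \<epsilon> H(2) by auto
    then obtain S c where S: "finite S" "S \<subseteq> ?I" and close: "hnorm H (scalarize E u - (\<Sum>i\<in>S. c i *\<^sub>C v i)) < \<epsilon>" by blast
    define t where "t i = elem_tensor (\<lambda>w. k w (fst i)) (snd i)" for i :: "'x \<times> 'e"
    define w where "w = (\<Sum>i\<in>S. c i *\<^sub>C t i)"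
    have t: "t i z \<in> carrier E" "scalarize E (t i) = v i" if "i \<in> S" for i z
      using that S(2) v_sect[of "snd i" "fst i"] by (auto simp: t_def elem_tensor_def)
    have wE: "w z \<in> carrier E" for z
      unfolding w_def sum_scaleC_apply using t by auto
    have "scalarize E w = (\<Sum>i\<in>S. c i *\<^sub>C v i)"
      unfolding w_def by (subst scalarize_sum[OF E S(1)]) (use t in auto)
    then have "hnorm T (u - w) < \<epsilon>"
      using close by (simp add: normT scalarize_diff[OF E uH(2) wE])
    moreover have "w \<in> complex_vector.span {elem_tensor f e | f e. f \<in> carrier ?R \<and> e \<in> carrier E}"
      unfolding w_def
    proof (intro complex_vector.span_sum complex_vector.span_scale complex_vector.span_base)
      fix i assume "i \<in> S"
      then have "snd i \<in> carrier E" using S(2) by auto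
      then show "t i \<in> {elem_tensor f e | f e. f \<in> carrier ?R \<and> e \<in> carrier E}"
        unfolding t_def using R(2) by blast
    qed
    ultimately show ?thesis by blast
  qed
  have "is_rkhs_tensor k E T"
    unfolding is_rkhs_tensor_def
    using hT elem(1) mult dense_T repro by (intro conjI ballI allI impI) (auto simp: carrT)
  then show ?thesis unfolding rkhs_tensor_def by (rule someI)
qed

lemma rkhs_tensor_facts:
  assumes k: "pd_kernel k" and E: "hilbert_space E"
  shows "hilbert_space (rkhs_tensor k E)"
    and "u \<in> carrier (rkhs_tensor k E) \<Longrightarrow> u z \<in> carrier E"
    and "e \<in> carrier E \<Longrightarrow> elem_tensor (\<lambda>w. k w z) e \<in> carrier (rkhs_tensor k E)"
    and "u \<in> carrier (rkhs_tensor k E) \<Longrightarrow> e \<in> carrier E \<Longrightarrow>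
      cinner (rkhs_tensor k E) u (elem_tensor (\<lambda>w. k w z) e) = cinner E (u z) e"
  using is_rkhs_tensor_rkhs_tensor[OF assms] is_rkhs_rkhs[OF k]
  unfolding is_rkhs_tensor_def is_rkhs_def by blast+

lemma cinner_kernel_tensors:
  assumes k: "pd_kernel k" and E: "hilbert_space E" and e: "e \<in> carrier E" "e' \<in> carrier E"
  shows "cinner (rkhs_tensor k E) (elem_tensor (\<lambda>x. k x w) e') (elem_tensor (\<lambda>x. k x z) e) = k z w * cinner E e' e"
  using rkhs_tensor_facts(4)[OF k E rkhs_tensor_facts(3)[OF k E e(2)] e(1)] e
  by (simp add: elem_tensor_def hilbert_space.cinner_scaleC_left[OF E])

text \<open>
  The values of \<open>u\<close> are its inner products with the kernel tensors \<open>k(\<cdot>,z) \<otimes> e\<close>, so membership of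
  \<open>u\<close> in a ball is a moment problem for the latter.
\<close>

lemma rkhs_tensor_ball_iff:
  assumes k: "pd_kernel k" and E: "hilbert_space E" and u: "\<And>z. u z \<in> carrier E" and C: "0 \<le> C"
  shows "u \<in> carrier (rkhs_tensor k E) \<and> hnorm (rkhs_tensor k E) u \<le> C \<longleftrightarrow>
    psd_on (UNIV \<times> carrier E) (\<lambda>i j. of_real (C\<^sup>2) * tensor_kernel k E i j
      - cinner E (u (fst i)) (snd i) * cnj (cinner E (u (fst j)) (snd j)))"
    (is "?l \<longleftrightarrow> psd_on ?I ?K")
proof -
  let ?T = "rkhs_tensor k E"
  note T = rkhs_tensor_facts[OF k E]
  interpret T: hilbert_space ?T by (rule T(1))
  interpret E: hilbert_space E by (rule E)
  define v where "v i = elem_tensor (\<lambda>x. k x (fst i)) (snd i)" for i :: "'a \<times> 'b"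
  have v: "v i \<in> carrier ?T" if "i \<in> ?I" for i using T(3) that by (auto simp: v_def)
  have vv: "cinner ?T (v j) (v i) = tensor_kernel k E i j" if "i \<in> ?I" "j \<in> ?I" for i j
    using cinner_kernel_tensors[OF k E, of "snd i" "snd j"] that by (auto simp: v_def tensor_kernel_def)
  have uv: "cinner ?T w (v i) = cinner E (w (fst i)) (snd i)" if "i \<in> ?I" "w \<in> carrier ?T" for w i
    using T(4)[of w "snd i"] that by (auto simp: v_def)
  show ?thesis
  proof
    assume ?l
    then show "psd_on ?I ?K"
      by (intro psd_on_cong[OF T.psd_on_moments[of ?I v u C]]) (use v vv uv in auto)
  next
    assume psd: "psd_on ?I ?K"
    have ps: "psd_on ?I (\<lambda>i j. of_real (C\<^sup>2) * cinner ?T (v j) (v i)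
        - cinner E (u (fst i)) (snd i) * cnj (cinner E (u (fst j)) (snd j)))"
      by (rule psd_on_cong[OF psd]) (simp add: vv)
    have "\<exists>w\<in>carrier ?T. (\<forall>i\<in>?I. cinner ?T w (v i) = cinner E (u (fst i)) (snd i)) \<and> hnorm ?T w \<le> C"
    proof (rule T.moment_solution)
      show "v i \<in> carrier ?T" if "i \<in> ?I" for i by (rule v[OF that])
    qed (rule C, rule ps)
    then obtain w where w1: "w \<in> carrier ?T"
      and w2: "(\<forall>i\<in>?I. cinner ?T w (v i) = cinner E (u (fst i)) (snd i)) \<and> hnorm ?T w \<le> C" ..
    have w: "w \<in> carrier ?T"
      "\<And>i. i \<in> ?I \<Longrightarrow> cinner ?T w (v i) = cinner E (u (fst i)) (snd i)" "hnorm ?T w \<le> C"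
      using w1 w2 by blast+
    have "w z = u z" for z
    proof -
      have d: "w z - u z \<in> carrier E" using T(2)[OF w(1)] u by simp
      have "cinner E (w z) (w z - u z) = cinner E (u z) (w z - u z)"
        using w(2)[of "(z, w z - u z)"] uv[of "(z, w z - u z)" w] d w(1) by simp
      then have "cinner E (w z - u z) (w z - u z) = 0"
        using E.cinner_diff_left[OF T(2)[OF w(1)] u d] by simp
      then show ?thesis using E.cinner_pos[OF d] by (cases "w z - u z = 0") auto
    qed
    then have "w = u" by auto
    then show ?l using w by blast
  qed
qed

text \<open>
  The kernel on the right is the Gram kernel of the vectors \<open>l(\<cdot>,z) \<otimes> y\<close> minus the Gram kernel of their
  images \<open>k(\<cdot>,z) \<otimes> adj z y\<close> under the adjoint of multiplication by \<open>\<Phi>\<close>. For the converse, the domination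
  of \<open>u\<close> is pulled back along \<open>(z, y) \<mapsto> (z, adj z y)\<close> and added to a multiple of this kernel; the sum
  dominates \<open>\<Phi> u\<close>.
\<close>

theorem contractive_multiplier_iff_psd_on:
  fixes k l :: "'x \<Rightarrow> 'x \<Rightarrow> complex" and E :: "'e::complex_vector hspace" and F :: "'f::complex_vector hspace"
  assumes k: "pd_kernel k" and l: "pd_kernel l" and E: "hilbert_space E" and F: "hilbert_space F"
    and \<Phi>: "\<And>z. \<Phi> z \<in> bounded_ops E F"
    and adjE: "\<And>z y. y \<in> carrier F \<Longrightarrow> adj z y \<in> carrier E"
    and adj: "\<And>z x y. x \<in> carrier E \<Longrightarrow> y \<in> carrier F \<Longrightarrow> cinner F (\<Phi> z x) y = cinner E x (adj z y)"
  shows "contractive_multiplier k E l F \<Phi> \<longleftrightarrow>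
    psd_on (UNIV \<times> carrier F) (\<lambda>i j. tensor_kernel l F i j
      - k (fst i) (fst j) * cinner E (adj (fst j) (snd j)) (adj (fst i) (snd i)))"
    (is "_ \<longleftrightarrow> psd_on ?I ?K")
proof
  let ?T = "rkhs_tensor k E" and ?U = "rkhs_tensor l F"
  note T = rkhs_tensor_facts[OF k E] and U = rkhs_tensor_facts[OF l F]
  interpret T: hilbert_space ?T by (rule T(1))
  interpret U: hilbert_space ?U by (rule U(1))
  interpret E: hilbert_space E by (rule E)
  interpret F: hilbert_space F by (rule F)
  {
    assume contr: "contractive_multiplier k E l F \<Phi>"
    show "psd_on ?I ?K"
      unfolding psd_on_def
    proof (intro allI impI, elim conjE)
      fix S and c :: "'x \<times> 'f \<Rightarrow> complex" assume S: "finite S" "S \<subseteq> ?I"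
      define a where "a i = elem_tensor (\<lambda>x. k x (fst i)) (adj (fst i) (snd i))" for i
      define b where "b i = elem_tensor (\<lambda>x. l x (fst i)) (snd i)" for i :: "'x \<times> 'f"
      have F2: "snd i \<in> carrier F" if "i \<in> S" for i using that S(2) by auto
      have a: "a i \<in> carrier ?T" and b: "b i \<in> carrier ?U" if "i \<in> S" for i
        using T(3) U(3) adjE F2[OF that] by (auto simp: a_def b_def)
      define u where "u = (\<Sum>i\<in>S. c i *\<^sub>C a i)"
      define w where "w = (\<Sum>i\<in>S. c i *\<^sub>C b i)"
      have u: "u \<in> carrier ?T" and w: "w \<in> carrier ?U" using a b by (auto simp: u_def w_def)
      let ?M = "\<lambda>z. \<Phi> z (u z)"
      have M: "?M \<in> carrier ?U" "hnorm ?U ?M \<le> hnorm ?T u"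
        using contr u by (auto simp: contractive_multiplier_def multipliers_def)
      have "cinner ?T u u = (\<Sum>i\<in>S. cnj (c i) * cinner ?T u (a i))"
        by (subst (2) u_def, rule T.cinner_sum_right) (use S a u in auto)
      also have "\<dots> = (\<Sum>i\<in>S. cnj (c i) * cinner ?U ?M (b i))"
        using T(4)[OF u] U(4)[OF M(1)] F2 adjE adj T(2)[OF u]
        by (intro sum.cong refl) (simp add: a_def b_def)
      also have "\<dots> = cinner ?U ?M w"
        unfolding w_def by (rule U.cinner_sum_right[symmetric]) (use S b M in auto)
      finally have uu: "cinner ?T u u = cinner ?U ?M w" .
      have "(hnorm ?T u)\<^sup>2 = cmod (cinner ?U ?M w)"
        unfolding uu[symmetric] T.cinner_self[OF u] by (simp add: norm_power)
      also have "\<dots> \<le> hnorm ?U ?M * hnorm ?U w" by (rule U.Cauchy_Schwarz[OF M(1) w])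
      also have "\<dots> \<le> hnorm ?T u * hnorm ?U w" by (rule mult_right_mono[OF M(2)]) (use w in auto)
      finally have "hnorm ?T u * hnorm ?T u \<le> hnorm ?U w * hnorm ?T u"
        by (simp add: power2_eq_square mult.commute)
      then have "hnorm ?T u \<le> hnorm ?U w"
        using T.hnorm_nonneg[OF u] U.hnorm_nonneg[OF w]
        by (cases "hnorm ?T u = 0") (auto simp: mult_le_cancel_right)
      then have "(hnorm ?T u)\<^sup>2 \<le> (hnorm ?U w)\<^sup>2"
        using T.hnorm_nonneg[OF u] by (intro power_mono)
      then have nn: "0 \<le> cinner ?U w w - cinner ?T u u"
        unfolding T.cinner_self[OF u] U.cinner_self[OF w] of_real_diff[symmetric]
        by (simp only: less_eq_complex_def) simp
      have "sesq_form S (tensor_kernel l F) c c = sesq_form S (\<lambda>i j. cinner ?U (b j) (b i)) c c"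
        by (rule sesq_form_cong) (use F2 cinner_kernel_tensors[OF l F] in \<open>auto simp: b_def tensor_kernel_def\<close>)
      also have "\<dots> = cinner ?U w w"
        unfolding w_def by (rule U.sesq_form_cinner) (use S b in auto)
      finally have 1: "sesq_form S (tensor_kernel l F) c c = cinner ?U w w" .
      have "sesq_form S (\<lambda>i j. k (fst i) (fst j) * cinner E (adj (fst j) (snd j)) (adj (fst i) (snd i))) c c
          = sesq_form S (\<lambda>i j. cinner ?T (a j) (a i)) c c"
        by (rule sesq_form_cong) (use F2 adjE cinner_kernel_tensors[OF k E] in \<open>auto simp: a_def\<close>)
      also have "\<dots> = cinner ?T u u"
        unfolding u_def by (rule T.sesq_form_cinner) (use S a in auto)
      finally show "0 \<le> sesq_form S ?K c c"
        using nn by (simp only: sesq_form_kernel_diff 1)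
    qed
  next
    assume psd: "psd_on ?I ?K"
    have "(\<lambda>z. \<Phi> z (u z)) \<in> carrier ?U \<and> hnorm ?U (\<lambda>z. \<Phi> z (u z)) \<le> hnorm ?T u" if u: "u \<in> carrier ?T" for u
    proof -
      let ?C = "hnorm ?T u"
      have uE: "u z \<in> carrier E" for z using T(2)[OF u] .
      have \<Phi>F: "\<Phi> z (u z) \<in> carrier F" for z using \<Phi> uE by (auto simp: bounded_ops_def)
      have "psd_on (UNIV \<times> carrier E) (\<lambda>i j. of_real (?C\<^sup>2) * tensor_kernel k E i j
          - cinner E (u (fst i)) (snd i) * cnj (cinner E (u (fst j)) (snd j)))"
        using rkhs_tensor_ball_iff[where u = u and C = ?C, OF k E uE T.hnorm_nonneg[OF u]] u by blast
      then have "psd_on ?I (\<lambda>i j. (\<lambda>i j. of_real (?C\<^sup>2) * tensor_kernel k E i j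
          - cinner E (u (fst i)) (snd i) * cnj (cinner E (u (fst j)) (snd j)))
          (fst i, adj (fst i) (snd i)) (fst j, adj (fst j) (snd j)))"
        by (rule psd_on_pullback) (use adjE in auto)
      moreover have "psd_on ?I (\<lambda>i j. of_real (?C\<^sup>2) * ?K i j)"
        by (rule psd_on_scale[OF psd]) (simp add: less_eq_complex_def)
      ultimately have "psd_on ?I (\<lambda>i j. of_real (?C\<^sup>2) * ?K i j + (\<lambda>i j. of_real (?C\<^sup>2) * tensor_kernel k E i j
          - cinner E (u (fst i)) (snd i) * cnj (cinner E (u (fst j)) (snd j)))
          (fst i, adj (fst i) (snd i)) (fst j, adj (fst j) (snd j)))"
        by (rule psd_on_add[rotated])
      then have "psd_on ?I (\<lambda>i j. of_real (?C\<^sup>2) * tensor_kernel l F i j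
          - cinner F (\<Phi> (fst i) (u (fst i))) (snd i) * cnj (cinner F (\<Phi> (fst j) (u (fst j))) (snd j)))"
        by (rule psd_on_cong) (auto simp: adj uE tensor_kernel_def right_diff_distrib)
      then show ?thesis
        using rkhs_tensor_ball_iff[where u = "\<lambda>z. \<Phi> z (u z)" and C = ?C, OF l F \<Phi>F T.hnorm_nonneg[OF u]] by blast
    qed
    then show "contractive_multiplier k E l F \<Phi>"
      using \<Phi> by (auto simp: contractive_multiplier_def multipliers_def)
  }
qed

section \<open>Multipliers acting on tuples\<close>

lemma hnorm_complex_space: "hnorm complex_space x = cmod x"
  by (simp add: hnorm_def complex_space_def complex_norm_square[symmetric] flip: of_real_power)

lemma hilbert_space_complex_space: "hilbert_space complex_space"
proof
  show "complex_vector.subspace (carrier complex_space)"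
    by (simp add: complex_space_def complex_vector.subspace_UNIV)
next
  fix x :: complex assume "x \<noteq> 0"
  then show "0 < Re (cinner complex_space x x)"
    by (simp add: complex_space_def complex_norm_square[symmetric] flip: of_real_power)
next
  fix u :: "nat \<Rightarrow> complex"
  assume "\<forall>\<epsilon>>0. \<exists>M. \<forall>m\<ge>M. \<forall>n\<ge>M. hnorm complex_space (u m - u n) < \<epsilon>"
  then have "Cauchy u" by (intro CauchyI) (simp add: hnorm_complex_space)
  then obtain l where l: "u \<longlonglongrightarrow> l" using Cauchy_convergent convergent_def by blast
  then have "(\<lambda>n. hnorm complex_space (u n - l)) \<longlonglongrightarrow> 0"
    unfolding hnorm_complex_space by (intro tendsto_norm_zero LIM_zero)
  then show "\<exists>x\<in>carrier complex_space. (\<lambda>n. hnorm complex_space (u n - x)) \<longlonglongrightarrow> 0"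
    by (intro bexI[of _ l]) (simp_all add: complex_space_def)
qed (simp_all add: complex_space_def scaleC_complex_def algebra_simps)

lemma cinner_tuple_space: "cinner (tuple_space N E) v w = (\<Sum>i<N. cinner E (v i) (w i))"
  by (simp add: tuple_space_def)

lemma carrier_tuple_space:
  "v \<in> carrier (tuple_space N E) \<longleftrightarrow> (\<forall>i<N. v i \<in> carrier E) \<and> (\<forall>i\<ge>N. v i = 0)"
  by (simp add: tuple_space_def)

lemma hnorm_tuple_space:
  assumes "hilbert_space E" "v \<in> carrier (tuple_space N E)"
  shows "(hnorm (tuple_space N E) v)\<^sup>2 = (\<Sum>i<N. (hnorm E (v i))\<^sup>2)"
    and "hnorm (tuple_space N E) v = sqrt (\<Sum>i<N. (hnorm E (v i))\<^sup>2)"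
proof -
  interpret hilbert_space E by fact
  have "Re (cinner (tuple_space N E) v v) = (\<Sum>i<N. (hnorm E (v i))\<^sup>2)"
    unfolding cinner_tuple_space Re_sum
    by (rule sum.cong) (use assms(2) in \<open>simp_all add: carrier_tuple_space cinner_self del: of_real_power\<close>)
  then show "hnorm (tuple_space N E) v = sqrt (\<Sum>i<N. (hnorm E (v i))\<^sup>2)"
    by (simp add: hnorm_def)
  then show "(hnorm (tuple_space N E) v)\<^sup>2 = (\<Sum>i<N. (hnorm E (v i))\<^sup>2)"
    by (simp add: sum_nonneg)
qed

lemma hilbert_space_tuple_space:
  assumes E: "hilbert_space E"
  shows "hilbert_space (tuple_space N E)"
proof -
  interpret E: hilbert_space E by fact
  let ?T = "tuple_space N E"
  have sub: "complex_vector.subspace (carrier ?T)"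
    by (auto simp: complex_vector.subspace_def carrier_tuple_space scaleC_fun_def)
  have diff: "v - w \<in> carrier ?T" if "v \<in> carrier ?T" "w \<in> carrier ?T" for v w
    using sub that by (rule complex_vector.subspace_diff)
  show ?thesis
  proof
    show "complex_vector.subspace (carrier ?T)" by (rule sub)
  next
    fix x y z assume "x \<in> carrier ?T" "y \<in> carrier ?T" "z \<in> carrier ?T"
    then show "cinner ?T (x + y) z = cinner ?T x z + cinner ?T y z"
      by (simp add: cinner_tuple_space carrier_tuple_space E.cinner_add_left sum.distrib)
  next
    fix x y c assume "x \<in> carrier ?T" "y \<in> carrier ?T"
    then show "cinner ?T (c *\<^sub>C x) y = c * cinner ?T x y"
      by (simp add: cinner_tuple_space carrier_tuple_space E.cinner_scaleC_left scaleC_fun_def sum_distrib_left)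
  next
    fix x y assume "x \<in> carrier ?T" "y \<in> carrier ?T"
    then show "cinner ?T x y = cnj (cinner ?T y x)"
      unfolding cinner_tuple_space cnj_sum
      by (intro sum.cong refl E.cinner_commute) (simp_all add: carrier_tuple_space)
  next
    fix x assume x: "x \<in> carrier ?T" "x \<noteq> 0"
    then obtain i where "x i \<noteq> 0" by (auto simp: fun_eq_iff)
    then have i: "i < N" "x i \<noteq> 0" using x(1) by (auto simp: carrier_tuple_space not_less[symmetric])
    then have "0 < Re (cinner E (x i) (x i))" using x(1) by (simp add: carrier_tuple_space E.cinner_pos)
    also have "\<dots> \<le> (\<Sum>i<N. Re (cinner E (x i) (x i)))"
      by (rule member_le_sum)
        (use i x(1) E.cinner_self_nonneg in \<open>auto simp: carrier_tuple_space less_eq_complex_def\<close>)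
    finally show "0 < Re (cinner ?T x x)" by (simp add: cinner_tuple_space)
  next
    fix u :: "nat \<Rightarrow> nat \<Rightarrow> 'a"
    assume u: "\<And>n. u n \<in> carrier ?T"
      and Cauchy: "\<forall>\<epsilon>>0. \<exists>M. \<forall>m\<ge>M. \<forall>n\<ge>M. hnorm ?T (u m - u n) < \<epsilon>"
    have uE: "u n i \<in> carrier E" if "i < N" for n i using u that by (simp add: carrier_tuple_space)
    have coord: "hnorm E (v i) \<le> hnorm ?T v" if "v \<in> carrier ?T" "i < N" for v i
      unfolding hnorm_tuple_space(2)[OF E that(1)]
      by (rule real_le_rsqrt, rule member_le_sum[of i "{..<N}" "\<lambda>i. (hnorm E (v i))\<^sup>2"]) (use that in auto)
    have "\<exists>x\<in>carrier E. (\<lambda>n. hnorm E (u n i - x)) \<longlonglongrightarrow> 0" if i: "i < N" for i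
    proof (rule E.complete[OF uE[OF i]], intro allI impI)
      fix \<epsilon> :: real assume "0 < \<epsilon>"
      then obtain M where M: "\<forall>m\<ge>M. \<forall>n\<ge>M. hnorm ?T (u m - u n) < \<epsilon>" using Cauchy by blast
      have "hnorm E (u m i - u n i) \<le> hnorm ?T (u m - u n)" for m n
        using coord[OF diff[OF u u] i, of m n] by simp
      then show "\<exists>M. \<forall>m\<ge>M. \<forall>n\<ge>M. hnorm E (u m i - u n i) < \<epsilon>"
        using M by (meson le_less_trans)
    qed
    then obtain l where l: "\<And>i. i < N \<Longrightarrow> l i \<in> carrier E"
      "\<And>i. i < N \<Longrightarrow> (\<lambda>n. hnorm E (u n i - l i)) \<longlonglongrightarrow> 0" by metis
    define x where "x i = (if i < N then l i else 0)" for i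
    have x: "x \<in> carrier ?T" using l by (simp add: x_def carrier_tuple_space)
    have "(\<lambda>n. sqrt (\<Sum>i<N. (hnorm E (u n i - l i))\<^sup>2)) \<longlonglongrightarrow> sqrt (\<Sum>i<N. 0\<^sup>2)"
      by (intro tendsto_intros l) simp
    moreover have "hnorm ?T (u n - x) = sqrt (\<Sum>i<N. (hnorm E (u n i - l i))\<^sup>2)" for n
      unfolding hnorm_tuple_space(2)[OF E diff[OF u x]] by (simp add: x_def)
    ultimately show "\<exists>x\<in>carrier ?T. (\<lambda>n. hnorm ?T (u n - x)) \<longlonglongrightarrow> 0"
      using x by (intro bexI[of _ x]) simp_all
  qed
qed

lemma carrier_direct_sum: "p \<in> carrier (E \<oplus>\<^sub>H F) \<longleftrightarrow> fst p \<in> carrier E \<and> snd p \<in> carrier F"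
  by (cases p) (simp add: direct_sum_def)

lemma cinner_direct_sum: "cinner (E \<oplus>\<^sub>H F) p q = cinner E (fst p) (fst q) + cinner F (snd p) (snd q)"
  by (simp add: direct_sum_def)

lemma hnorm_direct_sum:
  assumes "hilbert_space E" "hilbert_space F" "p \<in> carrier (E \<oplus>\<^sub>H F)"
  shows "(hnorm (E \<oplus>\<^sub>H F) p)\<^sup>2 = (hnorm E (fst p))\<^sup>2 + (hnorm F (snd p))\<^sup>2"
    and "hnorm (E \<oplus>\<^sub>H F) p = sqrt ((hnorm E (fst p))\<^sup>2 + (hnorm F (snd p))\<^sup>2)"
proof -
  have "Re (cinner (E \<oplus>\<^sub>H F) p p) = (hnorm E (fst p))\<^sup>2 + (hnorm F (snd p))\<^sup>2"
    using assms(3) hilbert_space.cinner_self[OF assms(1)] hilbert_space.cinner_self[OF assms(2)]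
    by (simp add: cinner_direct_sum carrier_direct_sum del: of_real_power)
  then show "hnorm (E \<oplus>\<^sub>H F) p = sqrt ((hnorm E (fst p))\<^sup>2 + (hnorm F (snd p))\<^sup>2)"
    by (simp add: hnorm_def)
  then show "(hnorm (E \<oplus>\<^sub>H F) p)\<^sup>2 = (hnorm E (fst p))\<^sup>2 + (hnorm F (snd p))\<^sup>2" by simp
qed

lemma hilbert_space_direct_sum:
  assumes E: "hilbert_space E" and F: "hilbert_space F"
  shows "hilbert_space (E \<oplus>\<^sub>H F)"
proof -
  interpret E: hilbert_space E by fact
  interpret F: hilbert_space F by fact
  let ?T = "E \<oplus>\<^sub>H F"
  have sub: "complex_vector.subspace (carrier ?T)"
    by (auto simp: complex_vector.subspace_def carrier_direct_sum scaleC_prod_def)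
  have diff: "v - w \<in> carrier ?T" if "v \<in> carrier ?T" "w \<in> carrier ?T" for v w
    using sub that by (rule complex_vector.subspace_diff)
  show ?thesis
  proof
    show "complex_vector.subspace (carrier ?T)" by (rule sub)
  next
    fix x y z assume "x \<in> carrier ?T" "y \<in> carrier ?T" "z \<in> carrier ?T"
    then show "cinner ?T (x + y) z = cinner ?T x z + cinner ?T y z"
      by (simp add: cinner_direct_sum carrier_direct_sum E.cinner_add_left F.cinner_add_left)
  next
    fix x y c assume "x \<in> carrier ?T" "y \<in> carrier ?T"
    then show "cinner ?T (c *\<^sub>C x) y = c * cinner ?T x y"
      by (simp add: cinner_direct_sum carrier_direct_sum E.cinner_scaleC_left F.cinner_scaleC_left
          scaleC_prod_def distrib_left)
  next
    fix x y assume "x \<in> carrier ?T" "y \<in> carrier ?T"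
    then show "cinner ?T x y = cnj (cinner ?T y x)"
      unfolding cinner_direct_sum carrier_direct_sum complex_cnj_add
      by (intro arg_cong2[of _ _ _ _ "(+)"] E.cinner_commute F.cinner_commute) auto
  next
    fix x assume x: "x \<in> carrier ?T" "x \<noteq> 0"
    then have "fst x \<noteq> 0 \<or> snd x \<noteq> 0" by (auto simp: prod_eq_iff)
    then have "0 < Re (cinner E (fst x) (fst x)) \<or> 0 < Re (cinner F (snd x) (snd x))"
      using x(1) E.cinner_pos F.cinner_pos by (auto simp: carrier_direct_sum)
    moreover have "0 \<le> Re (cinner E (fst x) (fst x))" "0 \<le> Re (cinner F (snd x) (snd x))"
      using x(1) E.cinner_self_nonneg F.cinner_self_nonneg by (auto simp: carrier_direct_sum less_eq_complex_def)
    ultimately show "0 < Re (cinner ?T x x)" by (auto simp: cinner_direct_sum)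
  next
    fix u :: "nat \<Rightarrow> 'a \<times> 'b"
    assume u: "\<And>n. u n \<in> carrier ?T"
      and Cauchy: "\<forall>\<epsilon>>0. \<exists>M. \<forall>m\<ge>M. \<forall>n\<ge>M. hnorm ?T (u m - u n) < \<epsilon>"
    have u': "fst (u n) \<in> carrier E" "snd (u n) \<in> carrier F" for n using u by (auto simp: carrier_direct_sum)
    have coord: "hnorm E (fst v) \<le> hnorm ?T v" "hnorm F (snd v) \<le> hnorm ?T v" if "v \<in> carrier ?T" for v
      unfolding hnorm_direct_sum(2)[OF E F that] by (simp_all add: real_le_rsqrt)
    have "\<exists>x\<in>carrier E. (\<lambda>n. hnorm E (fst (u n) - x)) \<longlonglongrightarrow> 0"
    proof (rule E.complete[OF u'(1)], intro allI impI)
      fix \<epsilon> :: real assume "0 < \<epsilon>"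
      then obtain M where M: "\<forall>m\<ge>M. \<forall>n\<ge>M. hnorm ?T (u m - u n) < \<epsilon>" using Cauchy by blast
      have "hnorm E (fst (u m) - fst (u n)) \<le> hnorm ?T (u m - u n)" for m n
        using coord(1)[OF diff[OF u u], of m n] by simp
      then show "\<exists>M. \<forall>m\<ge>M. \<forall>n\<ge>M. hnorm E (fst (u m) - fst (u n)) < \<epsilon>"
        using M by (meson le_less_trans)
    qed
    then obtain a where a: "a \<in> carrier E" "(\<lambda>n. hnorm E (fst (u n) - a)) \<longlonglongrightarrow> 0" by blast
    have "\<exists>x\<in>carrier F. (\<lambda>n. hnorm F (snd (u n) - x)) \<longlonglongrightarrow> 0"
    proof (rule F.complete[OF u'(2)], intro allI impI)
      fix \<epsilon> :: real assume "0 < \<epsilon>"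
      then obtain M where M: "\<forall>m\<ge>M. \<forall>n\<ge>M. hnorm ?T (u m - u n) < \<epsilon>" using Cauchy by blast
      have "hnorm F (snd (u m) - snd (u n)) \<le> hnorm ?T (u m - u n)" for m n
        using coord(2)[OF diff[OF u u], of m n] by simp
      then show "\<exists>M. \<forall>m\<ge>M. \<forall>n\<ge>M. hnorm F (snd (u m) - snd (u n)) < \<epsilon>"
        using M by (meson le_less_trans)
    qed
    then obtain b where b: "b \<in> carrier F" "(\<lambda>n. hnorm F (snd (u n) - b)) \<longlonglongrightarrow> 0" by blast
    have x: "(a, b) \<in> carrier ?T" using a b by (simp add: carrier_direct_sum)
    have "(\<lambda>n. sqrt ((hnorm E (fst (u n) - a))\<^sup>2 + (hnorm F (snd (u n) - b))\<^sup>2)) \<longlonglongrightarrow> sqrt (0\<^sup>2 + 0\<^sup>2)"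
      by (intro tendsto_intros a b)
    moreover have "hnorm ?T (u n - (a, b)) = sqrt ((hnorm E (fst (u n) - a))\<^sup>2 + (hnorm F (snd (u n) - b))\<^sup>2)" for n
      unfolding hnorm_direct_sum(2)[OF E F diff[OF u x]] by simp
    ultimately show "\<exists>x\<in>carrier ?T. (\<lambda>n. hnorm ?T (u n - x)) \<longlonglongrightarrow> 0"
      using x by (intro bexI[of _ "(a, b)"]) simp_all
  qed
qed

lemma hilbert_space_complex_tuples: "hilbert_space (\<complex>^N)"
  by (intro hilbert_space_tuple_space hilbert_space_complex_space)

lemma carrier_complex_tuples: "v \<in> carrier (\<complex>^N) \<longleftrightarrow> (\<forall>i\<ge>N. v i = 0)"
  by (simp add: carrier_tuple_space complex_space_def)

lemma cinner_complex_tuples: "cinner (\<complex>^N) v w = (\<Sum>i<N. v i * cnj (w i))"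
  by (simp add: cinner_tuple_space complex_space_def)

definition unit_tuple :: "nat \<Rightarrow> nat \<Rightarrow> complex" where
  "unit_tuple m = (\<lambda>l. if l = m then 1 else 0)"

lemma unit_tuple_carrier: "m < N \<Longrightarrow> unit_tuple m \<in> carrier (\<complex>^N)"
  by (auto simp: carrier_complex_tuples unit_tuple_def)

lemma bounded_ops_expand:
  assumes F: "hilbert_space F" and T: "T \<in> bounded_ops (\<complex>^N) F" and x: "x \<in> carrier (\<complex>^N)"
  shows "T x = (\<Sum>m<N. x m *\<^sub>C T (unit_tuple m))"
proof -
  interpret C: hilbert_space "\<complex>^N" by (rule hilbert_space_complex_tuples)
  interpret F: hilbert_space F by fact
  have add: "T (u + v) = T u + T v" if "u \<in> carrier (\<complex>^N)" "v \<in> carrier (\<complex>^N)" for u v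
    using T that by (simp add: bounded_ops_def)
  have scale: "T (c *\<^sub>C u) = c *\<^sub>C T u" if "u \<in> carrier (\<complex>^N)" for c u
    using T that by (simp add: bounded_ops_def)
  have "T (\<Sum>m\<in>A. x m *\<^sub>C unit_tuple m) = (\<Sum>m\<in>A. x m *\<^sub>C T (unit_tuple m))" if "A \<subseteq> {..<N}" for A
  proof -
    have "finite A" using that finite_subset by blast
    then show ?thesis using that
    proof (induction A rule: finite_induct)
      case empty
      have "T (0 *\<^sub>C 0) = 0 *\<^sub>C T 0" by (rule scale) simp
      then show ?case by (simp only: sum.empty complex_vector.scale_zero_left)
    next
      case (insert a A)
      then have "unit_tuple a \<in> carrier (\<complex>^N)" "(\<Sum>m\<in>A. x m *\<^sub>C unit_tuple m) \<in> carrier (\<complex>^N)"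
        by (auto intro!: C.sum_closed C.scaleC_closed unit_tuple_carrier)
      then have "T (x a *\<^sub>C unit_tuple a + (\<Sum>m\<in>A. x m *\<^sub>C unit_tuple m))
          = x a *\<^sub>C T (unit_tuple a) + T (\<Sum>m\<in>A. x m *\<^sub>C unit_tuple m)"
        by (simp only: add[OF C.scaleC_closed] scale)
      then show ?case using insert by (simp only: sum.insert[OF insert.hyps] insert_subset)
    qed
  qed
  moreover have "x = (\<Sum>m<N. x m *\<^sub>C unit_tuple m)"
  proof
    fix l
    show "x l = (\<Sum>m<N. x m *\<^sub>C unit_tuple m) l"
      using x unfolding sum_scaleC_apply
      by (auto simp: unit_tuple_def scaleC_complex_def carrier_complex_tuples if_distrib cong: if_cong)
  qed
  ultimately show ?thesis by (metis order_refl)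
qed

lemma bounded_ops_combination:
  assumes F: "hilbert_space F" and t: "\<And>m. m < N \<Longrightarrow> t m \<in> carrier F"
  shows "(\<lambda>v. \<Sum>m<N. v m *\<^sub>C t m) \<in> bounded_ops (\<complex>^N) F"
proof -
  interpret F: hilbert_space F by fact
  have "hnorm F (\<Sum>m<N. v m *\<^sub>C t m) \<le> (\<Sum>m<N. hnorm F (t m)) * hnorm (\<complex>^N) v"
    if v: "v \<in> carrier (\<complex>^N)" for v
  proof -
    have le: "cmod (v m) \<le> hnorm (\<complex>^N) v" if "m < N" for m
      unfolding hnorm_tuple_space(2)[OF hilbert_space_complex_space v] hnorm_complex_space
      by (rule real_le_rsqrt, rule member_le_sum[of m "{..<N}" "\<lambda>m. (cmod (v m))\<^sup>2"]) (use that in auto)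
    have "hnorm F (\<Sum>m\<in>A. v m *\<^sub>C t m) \<le> (\<Sum>m\<in>A. hnorm F (t m)) * hnorm (\<complex>^N) v" if "A \<subseteq> {..<N}" for A
    proof -
      have "finite A" using that finite_subset by blast
      then show ?thesis using that
      proof (induction A rule: finite_induct)
        case (insert a A)
        have a: "a < N" "t a \<in> carrier F" using insert t by auto
        have A: "(\<Sum>m\<in>A. v m *\<^sub>C t m) \<in> carrier F"
          using insert t by (auto intro!: F.sum_closed F.scaleC_closed)
        have "hnorm F (\<Sum>m\<in>insert a A. v m *\<^sub>C t m) \<le> hnorm F (v a *\<^sub>C t a) + hnorm F (\<Sum>m\<in>A. v m *\<^sub>C t m)"
          using insert.hyps A a by (simp add: F.hnorm_triangle)
        also have "hnorm F (v a *\<^sub>C t a) \<le> hnorm F (t a) * hnorm (\<complex>^N) v"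
          using mult_right_mono[OF le[OF a(1)] F.hnorm_nonneg[OF a(2)]]
          by (simp only: F.hnorm_scaleC[OF a(2)] mult.commute[of "hnorm F (t a)"])
        finally show ?case using insert by (simp add: distrib_right)
      qed simp
    qed
    then show ?thesis by blast
  qed
  then show ?thesis
    using t unfolding bounded_ops_def
    by (auto intro!: F.sum_closed F.scaleC_closed simp: scaleC_add_left sum.distrib scaleC_fun_def
        scaleC_complex_def complex_vector.scale_sum_right scaleC_scaleC)
qed

text \<open>
  The adjoint of an operator out of \<open>\<complex>\<^sup>N\<close> is given by its values on the unit vectors, and is defined for
  any target \<open>F\<close>.
\<close>

definition tuple_adjoint :: "nat \<Rightarrow> 'f hspace \<Rightarrow> ((nat \<Rightarrow> complex) \<Rightarrow> 'f) \<Rightarrow> 'f \<Rightarrow> nat \<Rightarrow> complex" where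
  "tuple_adjoint N F T y = (\<lambda>m. if m < N then cnj (cinner F (T (unit_tuple m)) y) else 0)"

lemma tuple_adjoint_carrier: "tuple_adjoint N F T y \<in> carrier (\<complex>^N)"
  by (auto simp: carrier_complex_tuples tuple_adjoint_def)

lemma cinner_tuple_adjoint:
  assumes F: "hilbert_space F" and T: "T \<in> bounded_ops (\<complex>^N) F"
    and x: "x \<in> carrier (\<complex>^N)" and y: "y \<in> carrier F"
  shows "cinner F (T x) y = cinner (\<complex>^N) x (tuple_adjoint N F T y)"
proof -
  interpret F: hilbert_space F by fact
  have "T (unit_tuple m) \<in> carrier F" if "m < N" for m
    using T unit_tuple_carrier[OF that] by (auto simp: bounded_ops_def)
  then have "cinner F (T x) y = (\<Sum>m<N. x m * cinner F (T (unit_tuple m)) y)"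
    unfolding bounded_ops_expand[OF F T x] by (intro F.cinner_sum_left) (use y in auto)
  then show ?thesis by (simp add: cinner_complex_tuples tuple_adjoint_def)
qed

theorem contractive_multiplier_tuples_iff:
  assumes k: "pd_kernel k" and l: "pd_kernel l" and F: "hilbert_space F"
    and \<Phi>: "\<And>z. \<Phi> z \<in> bounded_ops (\<complex>^N) F"
  shows "contractive_multiplier k (\<complex>^N) l F \<Phi> \<longleftrightarrow>
    psd_on (UNIV \<times> carrier F) (\<lambda>i j. tensor_kernel l F i j - k (fst i) (fst j)
      * cinner (\<complex>^N) (tuple_adjoint N F (\<Phi> (fst j)) (snd j)) (tuple_adjoint N F (\<Phi> (fst i)) (snd i)))"
  by (rule contractive_multiplier_iff_psd_on[OF k l hilbert_space_complex_tuples F \<Phi>])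
    (simp_all add: tuple_adjoint_carrier cinner_tuple_adjoint[OF F \<Phi>])

lemma contractive_multiplierD: "contractive_multiplier k E l F \<Phi> \<Longrightarrow> \<Phi> z \<in> bounded_ops E F"
  by (auto simp: contractive_multiplier_def multipliers_def)

lemma contractive_multiplier_tuples_psd_on:
  assumes "pd_kernel k" "pd_kernel l" "hilbert_space F" "contractive_multiplier k (\<complex>^N) l F \<Phi>"
  shows "psd_on (UNIV \<times> carrier F) (\<lambda>i j. tensor_kernel l F i j - k (fst i) (fst j)
      * cinner (\<complex>^N) (tuple_adjoint N F (\<Phi> (fst j)) (snd j)) (tuple_adjoint N F (\<Phi> (fst i)) (snd i)))"
  using contractive_multiplier_tuples_iff[where \<Phi> = \<Phi>, OF assms(1-3) contractive_multiplierD[OF assms(4)]] assms(4)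
  by blast

lemma Riesz_representation:
  assumes L: "hilbert_space L" and \<psi>: "\<psi> \<in> bounded_ops L complex_space"
  shows "\<exists>\<gamma>\<in>carrier L. \<forall>u\<in>carrier L. \<psi> u = cinner L u \<gamma>"
proof -
  interpret hilbert_space L by fact
  obtain B where B: "\<And>u. u \<in> carrier L \<Longrightarrow> cmod (\<psi> u) \<le> B * hnorm L u"
  proof -
    have "\<exists>B. \<forall>u\<in>carrier L. cmod (\<psi> u) \<le> B * hnorm L u"
      using \<psi> by (simp add: bounded_ops_def hnorm_complex_space)
    then show ?thesis using that by blast
  qed
  have add: "\<psi> (u + v) = \<psi> u + \<psi> v" if "u \<in> carrier L" "v \<in> carrier L" for u v
    using \<psi> that by (simp add: bounded_ops_def)
  have scale: "\<psi> (c *\<^sub>C u) = c * \<psi> u" if "u \<in> carrier L" for c u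
    using \<psi> that by (simp add: bounded_ops_def scaleC_complex_def)
  let ?C = "max B 0"
  have "psd_on (carrier L) (\<lambda>i j. of_real (?C\<^sup>2) * cinner L j i - cnj (\<psi> i) * cnj (cnj (\<psi> j)))"
    unfolding psd_on_def
  proof (intro allI impI, elim conjE)
    fix S and c :: "'a \<Rightarrow> complex" assume S: "finite S" "S \<subseteq> carrier L"
    let ?w = "\<Sum>i\<in>S. c i *\<^sub>C i"
    have w: "?w \<in> carrier L" using S by (intro sum_closed scaleC_closed) auto
    have \<psi>w: "\<psi> ?w = (\<Sum>i\<in>S. c i * \<psi> i)"
      using S
    proof (induction S rule: finite_induct)
      case empty
      show ?case using scale[of 0 0] by simp
    next
      case (insert a A)
      then have "(\<Sum>i\<in>A. c i *\<^sub>C i) \<in> carrier L" by (intro sum_closed scaleC_closed) auto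
      then show ?case using insert by (simp add: add scale)
    qed
    have 1: "(\<Sum>i\<in>S. cnj (c i) * cnj (\<psi> i)) = cnj (\<psi> ?w)" unfolding \<psi>w by simp
    have 2: "(\<Sum>j\<in>S. cnj (cnj (\<psi> j)) * c j) = \<psi> ?w" unfolding \<psi>w by (simp add: mult.commute)
    have 3: "sesq_form S (\<lambda>i j. cinner L j i) c c = cinner L ?w ?w"
      by (rule sesq_form_cinner) (use S in auto)
    have "cmod (\<psi> ?w) \<le> B * hnorm L ?w" by (rule B[OF w])
    also have "\<dots> \<le> ?C * hnorm L ?w" using w by (intro mult_right_mono) auto
    finally have "(cmod (\<psi> ?w))\<^sup>2 \<le> (?C * hnorm L ?w)\<^sup>2" by (rule power_mono) simp
    then have "(0::complex) \<le> of_real ((?C * hnorm L ?w)\<^sup>2 - (cmod (\<psi> ?w))\<^sup>2)"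
      by (simp only: less_eq_complex_def) simp
    also have "\<dots> = of_real (?C\<^sup>2) * cinner L ?w ?w - cnj (\<psi> ?w) * \<psi> ?w"
      unfolding cinner_self[OF w] mult.commute[of "cnj _"] complex_norm_square[symmetric]
      by (simp add: power_mult_distrib)
    also have "\<dots> = sesq_form S (\<lambda>i j. of_real (?C\<^sup>2) * cinner L j i - cnj (\<psi> i) * cnj (cnj (\<psi> j))) c c"
      unfolding sesq_form_kernel_diff sesq_form_kernel_scale sesq_form_rank_one 1 2 3 ..
    finally show "0 \<le> sesq_form S (\<lambda>i j. of_real (?C\<^sup>2) * cinner L j i - cnj (\<psi> i) * cnj (cnj (\<psi> j))) c c" .
  qed
  then have "\<exists>\<gamma>\<in>carrier L. (\<forall>i\<in>carrier L. cinner L \<gamma> i = cnj (\<psi> i)) \<and> hnorm L \<gamma> \<le> ?C"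
    by (intro moment_solution[where v = "\<lambda>i. i"]) auto
  then obtain \<gamma> where \<gamma>: "\<gamma> \<in> carrier L" "\<forall>i\<in>carrier L. cinner L \<gamma> i = cnj (\<psi> i)" by blast
  have "\<psi> u = cinner L u \<gamma>" if "u \<in> carrier L" for u
    using cinner_commute[OF that \<gamma>(1)] \<gamma>(2) that by simp
  then show ?thesis using \<gamma>(1) by blast
qed

text \<open>
  The uniqueness needed for the definite description in \<open>hadjoint\<close> comes from positivity of the inner
  product.
\<close>

lemma hadjoint_functional:
  assumes L: "hilbert_space L" and \<gamma>: "\<gamma> \<in> carrier L" "\<And>u. u \<in> carrier L \<Longrightarrow> \<psi> u = cinner L u \<gamma>"
  shows "hadjoint L complex_space \<psi> c = c *\<^sub>C \<gamma>"
proof -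
  interpret hilbert_space L by fact
  have eq: "cinner complex_space (\<psi> u) c = cinner L u (c *\<^sub>C \<gamma>)" if "u \<in> carrier L" for u
    using that \<gamma> by (simp add: complex_space_def cinner_scaleC_right mult.commute)
  show ?thesis
    unfolding hadjoint_def
  proof (rule the_equality)
    show "c *\<^sub>C \<gamma> \<in> carrier L \<and> (\<forall>u\<in>carrier L. cinner L u (c *\<^sub>C \<gamma>) = cinner complex_space (\<psi> u) c)"
      using eq \<gamma>(1) by simp
    fix x assume x: "x \<in> carrier L \<and> (\<forall>u\<in>carrier L. cinner L u x = cinner complex_space (\<psi> u) c)"
    let ?d = "x - c *\<^sub>C \<gamma>"
    have d: "?d \<in> carrier L" using x \<gamma>(1) by simp
    have "cinner L ?d ?d = cinner L ?d x - cinner L ?d (c *\<^sub>C \<gamma>)"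
      by (rule cinner_diff_right) (use x \<gamma>(1) d in auto)
    also have "\<dots> = 0" using x eq[OF d] d by simp
    finally show "x = c *\<^sub>C \<gamma>" using cinner_pos[OF d] by (cases "?d = 0") auto
  qed
qed

section \<open>The complete Pick property\<close>

lemma mat_adjoint_index:
  assumes "A \<in> carrier_mat n m" "i < m" "j < n"
  shows "mat_adjoint A $$ (i, j) = cnj (A $$ (j, i))"
  using assms by (simp add: mat_adjoint_def mat_of_rows_index cols_def)

text \<open>
  A row is interpolated as the first row of a square matrix \<open>W\<^sub>i\<close> whose other rows vanish: then
  \<open>I - W\<^sub>i W\<^sub>j\<^sup>*\<close> is diagonal with entries \<open>1 - gram w\<close> and \<open>1, \<dots>, 1\<close>, and positivity for the rows
  gives positivity for the matrices. The first row of the interpolating multiplier at the new point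
  is the new row.
\<close>

lemma complete_pick_row_extension:
  fixes s :: "'x \<Rightarrow> 'x \<Rightarrow> complex" and w :: "'x \<Rightarrow> nat \<Rightarrow> complex"
  assumes cp: "complete_pick_kernel s" and S: "finite S"
    and psd: "psd_on S (\<lambda>x y. s x y * (1 - gram N w x y))"
  shows "\<exists>M w'. (\<forall>x\<in>S. \<forall>y\<in>S. gram M w' x y = gram N w x y) \<and>
    psd_on (insert a S) (\<lambda>x y. s x y * (1 - gram M w' x y))"
proof (cases "S = {}")
  case True
  have s: "psd_on UNIV s" using cp by (simp add: complete_pick_kernel_def pd_kernel_iff_psd_on)
  have "psd_on (insert a S) (\<lambda>x y. s x y * (1 - gram 0 w x y))"
    using psd_on_subset[OF s, of "insert a S"] by (simp add: gram_def)
  then show ?thesis using True by blast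
next
  case False
  have pk: "pd_kernel s" using cp by (simp add: complete_pick_kernel_def)
  then have s: "psd_on UNIV s" by (simp add: pd_kernel_iff_psd_on)
  define n where "n = card S"
  have n: "n \<ge> 1" using False S by (simp add: n_def Suc_le_eq card_gt_0_iff)
  obtain z where z: "bij_betw z {..<n} S"
    using ex_bij_betw_nat_finite[OF S] by (auto simp: atLeast0LessThan n_def)
  \<comment> \<open>One additional column of zeros provides matrices of size at least \<open>1\<close> even if \<open>N = 0\<close>.\<close>
  define M where "M = Suc N"
  define W where "W i = mat M M (\<lambda>(p, q). if p = 0 \<and> q < N then cnj (w (z i) q) else 0)" for i
  have WW: "(W i * mat_adjoint (W j)) $$ (p, q) = (if p = 0 \<and> q = 0 then gram N w (z i) (z j) else 0)"
    if pq: "p < M" "q < M" for i j p q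
  proof -
    have W: "W i \<in> carrier_mat M M" for i by (simp add: W_def)
    have Wa: "mat_adjoint (W j) \<in> carrier_mat M M" by (rule carrier_matI) (simp_all add: mat_adjoint_def W_def)
    have "(W i * mat_adjoint (W j)) $$ (p, q) = (\<Sum>m<M. W i $$ (p, m) * mat_adjoint (W j) $$ (m, q))"
      using W[of i] Wa pq by (simp add: scalar_prod_def atLeast0LessThan)
    also have "\<dots> = (\<Sum>m<M. W i $$ (p, m) * cnj (W j $$ (q, m)))"
      using mat_adjoint_index[OF W] pq by simp
    also have "\<dots> = (\<Sum>m<N. W i $$ (p, m) * cnj (W j $$ (q, m)))"
      using pq by (simp add: M_def W_def)
    also have "\<dots> = (if p = 0 \<and> q = 0 then gram N w (z i) (z j) else 0)"
      using pq by (auto simp: W_def M_def gram_def intro!: sum.neutral sum.cong)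
    finally show ?thesis .
  qed
  have blk: "psd_on ({..<n} \<times> {..<M}) (\<lambda>(i, p) (j, q).
      (s (z i) (z j) \<cdot>\<^sub>m (1\<^sub>m M - W i * mat_adjoint (W j))) $$ (p, q))"
  proof -
    let ?e = "\<lambda>m (a :: nat \<times> nat). if snd a = m then 1 else 0 :: complex"
    have "psd_on {..<n} (\<lambda>i j. s (z i) (z j) * (1 - gram N w (z i) (z j)))"
      by (rule psd_on_pullback[OF psd]) (use z in \<open>auto simp: bij_betw_def\<close>)
    then have 1: "psd_on ({..<n} \<times> {..<M}) (\<lambda>a b. s (z (fst a)) (z (fst b)) * (1 - gram N w (z (fst a)) (z (fst b))))"
      by (rule psd_on_pullback) auto
    have 2: "psd_on ({..<n} \<times> {..<M}) (\<lambda>a b. s (z (fst a)) (z (fst b)))"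
      by (rule psd_on_pullback[OF s]) simp
    have "psd_on ({..<n} \<times> {..<M}) (\<lambda>a b. cnj (?e 0 a) * ?e 0 b * (s (z (fst a)) (z (fst b)) * (1 - gram N w (z (fst a)) (z (fst b))))
        + (\<Sum>m\<in>{1..<M}. cnj (?e m a) * ?e m b * s (z (fst a)) (z (fst b))))"
      by (rule psd_on_add[OF psd_on_schur_product[OF psd_on_rank_one 1]
            psd_on_sum[OF psd_on_schur_product[OF psd_on_rank_one 2]]])
    then show ?thesis
    proof (rule psd_on_cong)
      fix a b assume ab: "a \<in> {..<n} \<times> {..<M}" "b \<in> {..<n} \<times> {..<M}"
      obtain i p j q where e: "a = (i, p)" "b = (j, q)" by fastforce
      have *: "i \<in> {..<n}" "p \<in> {..<M}" "j \<in> {..<n}" "q \<in> {..<M}" using ab e by auto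
      have "(\<Sum>m\<in>{1..<M}. cnj (?e m (i, p)) * ?e m (j, q) * s (z i) (z j)) = (if p = q \<and> p \<noteq> 0 then s (z i) (z j) else 0)"
      proof -
        have "(\<Sum>m\<in>{1..<M}. cnj (?e m (i, p)) * ?e m (j, q) * s (z i) (z j))
            = (\<Sum>m\<in>{1..<M}. if m = p then (if p = q then s (z i) (z j) else 0) else 0)"
          by (rule sum.cong) auto
        then show ?thesis using * by auto
      qed
      moreover have "(s (z i) (z j) \<cdot>\<^sub>m (1\<^sub>m M - W i * mat_adjoint (W j))) $$ (p, q)
          = s (z i) (z j) * ((if p = q then 1 else 0) - (if p = 0 \<and> q = 0 then gram N w (z i) (z j) else 0))"
        using * WW[of p q i j] by (simp add: W_def mat_adjoint_def)
      ultimately show "cnj (?e 0 a) * ?e 0 b * (s (z (fst a)) (z (fst b)) * (1 - gram N w (z (fst a)) (z (fst b))))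
          + (\<Sum>m\<in>{1..<M}. cnj (?e m a) * ?e m b * s (z (fst a)) (z (fst b)))
        = (\<lambda>(i, p) (j, q). (s (z i) (z j) \<cdot>\<^sub>m (1\<^sub>m M - W i * mat_adjoint (W j))) $$ (p, q)) a b"
        unfolding e by auto
    qed
  qed
  have "psd_on {..<n * M} (\<lambda>a b. (\<lambda>(i, p) (j, q).
      (s (z i) (z j) \<cdot>\<^sub>m (1\<^sub>m M - W i * mat_adjoint (W j))) $$ (p, q)) (a div M, a mod M) (b div M, b mod M))"
    by (rule psd_on_pullback[OF blk]) (auto simp: M_def less_mult_imp_div_less)
  then have "psd_mat (block_mat n M (\<lambda>i j. s (z i) (z j) \<cdot>\<^sub>m (1\<^sub>m M - W i * mat_adjoint (W j))))"
    unfolding block_mat_def psd_mat_iff_psd_on by simp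
  moreover have "\<forall>i<n. W i \<in> carrier_mat M M" by (simp add: W_def)
  moreover have "M \<ge> 1" by (simp add: M_def)
  ultimately have "\<exists>\<Phi>. contractive_multiplier s (\<complex>^M) s (\<complex>^M) \<Phi> \<and> (\<forall>i<n. mat_of_op M (\<Phi> (z i)) = W i)"
    using cp n by (simp add: complete_pick_kernel_def)
  then obtain \<Phi> where \<Phi>: "contractive_multiplier s (\<complex>^M) s (\<complex>^M) \<Phi>"
    and \<Phi>W: "\<forall>i<n. mat_of_op M (\<Phi> (z i)) = W i"
    by blast
  define w' where "w' x = tuple_adjoint M (\<complex>^M) (\<Phi> x) (unit_tuple 0)" for x
  have gr: "gram M w' x y = gram N w x y" if xy: "x \<in> S" "y \<in> S" for x y
  proof -
    have w'w: "w' x m = (if m < N then w x m else 0)" if x: "x \<in> S" and m: "m < M" for x m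
    proof -
      obtain i where i: "i < n" "x = z i" using z x by (auto simp: bij_betw_def)
      have "\<Phi> x (unit_tuple m) 0 = mat_of_op M (\<Phi> (z i)) $$ (0, m)"
        using m by (simp add: mat_of_op_def unit_tuple_def i M_def)
      also have "\<dots> = W i $$ (0, m)" using \<Phi>W i by simp
      also have "\<dots> = (if m < N then cnj (w x m) else 0)" using m by (simp add: W_def i M_def)
      finally have e: "\<Phi> x (unit_tuple m) 0 = (if m < N then cnj (w x m) else 0)" .
      have "cinner (\<complex>^M) v (unit_tuple 0) = v 0" for v
        by (simp add: cinner_complex_tuples unit_tuple_def M_def if_distrib cong: if_cong)
      then show ?thesis using m e by (simp add: w'_def tuple_adjoint_def)
    qed
    have "gram M w' x y = (\<Sum>m<N. cnj (w' x m) * w' y m)"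
      using xy by (simp add: gram_def M_def w'w)
    then show ?thesis using xy by (simp add: gram_def w'w M_def)
  qed
  have "psd_on (UNIV \<times> carrier (\<complex>^M)) (\<lambda>i j. tensor_kernel s (\<complex>^M) i j - s (fst i) (fst j)
      * cinner (\<complex>^M) (tuple_adjoint M (\<complex>^M) (\<Phi> (fst j)) (snd j)) (tuple_adjoint M (\<complex>^M) (\<Phi> (fst i)) (snd i)))"
    by (rule contractive_multiplier_tuples_psd_on[OF pk pk hilbert_space_complex_tuples \<Phi>])
  from psd_on_pullback[OF this, of UNIV "\<lambda>x. (x, unit_tuple 0)"]
  have "psd_on UNIV (\<lambda>x y. tensor_kernel s (\<complex>^M) (x, unit_tuple 0) (y, unit_tuple 0) - s (fst (x, unit_tuple 0 :: nat \<Rightarrow> complex)) (fst (y, unit_tuple 0 :: nat \<Rightarrow> complex))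
      * cinner (\<complex>^M) (tuple_adjoint M (\<complex>^M) (\<Phi> (fst (y, unit_tuple 0 :: nat \<Rightarrow> complex))) (snd (y, unit_tuple 0)))
          (tuple_adjoint M (\<complex>^M) (\<Phi> (fst (x, unit_tuple 0 :: nat \<Rightarrow> complex))) (snd (x, unit_tuple 0))))"
    using unit_tuple_carrier[of 0 M] by (simp add: M_def)
  then have "psd_on UNIV (\<lambda>x y. s x y * (1 - gram M w' x y))"
  proof (rule psd_on_cong)
    fix x y :: 'x
    have "tensor_kernel s (\<complex>^M) (x, unit_tuple 0) (y, unit_tuple 0) = s x y"
      by (simp add: tensor_kernel_def cinner_complex_tuples unit_tuple_def M_def if_distrib cong: if_cong)
    then show "tensor_kernel s (\<complex>^M) (x, unit_tuple 0) (y, unit_tuple 0) - s (fst (x, unit_tuple 0 :: nat \<Rightarrow> complex)) (fst (y, unit_tuple 0 :: nat \<Rightarrow> complex))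
      * cinner (\<complex>^M) (tuple_adjoint M (\<complex>^M) (\<Phi> (fst (y, unit_tuple 0 :: nat \<Rightarrow> complex))) (snd (y, unit_tuple 0)))
          (tuple_adjoint M (\<complex>^M) (\<Phi> (fst (x, unit_tuple 0 :: nat \<Rightarrow> complex))) (snd (x, unit_tuple 0)))
      = s x y * (1 - gram M w' x y)"
      by (simp add: w'_def gram_def cinner_complex_tuples right_diff_distrib mult.commute)
  qed
  then have "psd_on (insert a S) (\<lambda>x y. s x y * (1 - gram M w' x y))" by (rule psd_on_subset) simp
  then show ?thesis using gr by blast
qed

corollary complete_pick_psd_on_pick_defect:
  assumes "complete_pick_kernel s" "\<And>z w. s z w \<noteq> 0"
  shows "psd_on UNIV (pick_defect s a)"
  by (rule psd_on_pick_defect)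
    (use assms complete_pick_row_extension[OF assms(1)] in \<open>auto simp: complete_pick_kernel_def pd_kernel_iff_psd_on\<close>)

section \<open>Leech factorization and the parametrization of contractive multipliers\<close>

text \<open>
  The sought operators are obtained through their adjoints. Interpolation takes place on the disjoint
  union of the prescribed pairs \<open>(z, x)\<close>, with vector \<open>A z x\<close> and value \<open>R z x\<close>, and of all pairs
  \<open>(z, \<kappa>)\<close>, with vector \<open>\<kappa>\<close> and unknown value \<open>F z \<kappa> = \<Phi>(z)\<^sup>* \<kappa>\<close>. At a fixed \<open>z\<close> positivity forces
  the values at \<open>Inl (z, x)\<close> and at \<open>Inr (z, A z x)\<close> to agree, because the vectors do. It also bounds
  the coordinates of \<open>F z\<close>, so each of them is represented by a vector \<open>\<phi> z m\<close>, the image of the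
  \<open>m\<close>-th unit vector under \<open>\<Phi>(z)\<close>.
\<close>

theorem Leech_factorization:
  fixes s :: "'x \<Rightarrow> 'x \<Rightarrow> complex" and K :: "'k::complex_vector hspace"
    and A :: "'x \<Rightarrow> (nat \<Rightarrow> complex) \<Rightarrow> 'k" and R :: "'x \<Rightarrow> (nat \<Rightarrow> complex) \<Rightarrow> (nat \<Rightarrow> complex)"
  assumes cp: "complete_pick_kernel s" and nz: "\<And>z w. s z w \<noteq> 0" and K: "hilbert_space K"
    and A: "\<And>z x. x \<in> D \<Longrightarrow> A z x \<in> carrier K"
    and R: "\<And>z x. x \<in> D \<Longrightarrow> R z x \<in> carrier (\<complex>^N)"
    and psd: "psd_on (UNIV \<times> D) (\<lambda>i j. s (fst i) (fst j) *
      (cinner K (A (fst j) (snd j)) (A (fst i) (snd i))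
        - cinner (\<complex>^N) (R (fst j) (snd j)) (R (fst i) (snd i))))"
  shows "\<exists>\<Phi>. contractive_multiplier s (\<complex>^N) s K \<Phi> \<and>
    (\<forall>z. \<forall>x\<in>D. tuple_adjoint N K (\<Phi> z) (A z x) = R z x)"
proof -
  interpret K: hilbert_space K by fact
  have pk: "pd_kernel s" using cp by (simp add: complete_pick_kernel_def)
  then have s: "psd_on UNIV s" by (simp add: pd_kernel_iff_psd_on)
  have szz: "0 \<le> 1 / s z z" for z
    using psd_on_diag[OF s, of z] by (auto simp: less_eq_complex_def Re_divide Im_divide)
  define Y0 :: "('x \<times> (nat \<Rightarrow> complex) + 'x \<times> 'k) set" where "Y0 = Inl ` (UNIV \<times> D)"
  define Y :: "('x \<times> (nat \<Rightarrow> complex) + 'x \<times> 'k) set" where "Y = Y0 \<union> Inr ` (UNIV \<times> carrier K)"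
  define p :: "'x \<times> (nat \<Rightarrow> complex) + 'x \<times> 'k \<Rightarrow> 'x" where "p y = (case y of Inl q \<Rightarrow> fst q | Inr q \<Rightarrow> fst q)" for y
  define V :: "'x \<times> (nat \<Rightarrow> complex) + 'x \<times> 'k \<Rightarrow> 'k" where "V y = (case y of Inl q \<Rightarrow> A (fst q) (snd q) | Inr q \<Rightarrow> snd q)" for y
  define f where "f y = (case y of Inl q \<Rightarrow> R (fst q) (snd q) | Inr q \<Rightarrow> (\<lambda>_. 0))" for y :: "'x \<times> (nat \<Rightarrow> complex) + 'x \<times> 'k"
  have V: "V y \<in> carrier K" if "y \<in> Y" for y using that A by (auto simp: Y_def Y0_def V_def)
  have ps0: "psd_on Y0 (\<lambda>i j. s (p i) (p j) * (cinner K (V j) (V i) - gram N f i j))"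
  proof -
    have "psd_on Y0 (\<lambda>i j. s (fst (projl i)) (fst (projl j)) *
      (cinner K (A (fst (projl j)) (snd (projl j))) (A (fst (projl i)) (snd (projl i)))
        - cinner (\<complex>^N) (R (fst (projl j)) (snd (projl j))) (R (fst (projl i)) (snd (projl i)))))"
      by (rule psd_on_pullback[OF psd]) (auto simp: Y0_def)
    then show ?thesis
      by (rule psd_on_cong) (auto simp: Y0_def p_def V_def f_def gram_def cinner_complex_tuples mult.commute)
  qed
  have gY: "psd_on Y (\<lambda>i j. cinner K (V j) (V i))"
    using V by (rule K.psd_on_cinner)
  have Y0Y: "Y0 \<subseteq> Y" by (auto simp: Y_def)
  obtain f' where f': "\<forall>i\<in>Y0. \<forall>n<N. f' i n = f i n"
    and ps: "psd_on Y (\<lambda>i j. s (p i) (p j) * (cinner K (V j) (V i) - gram N f' i j))"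
    using tangential_pick_interpolation[OF s nz complete_pick_psd_on_pick_defect[OF cp nz] gY Y0Y ps0] by blast
  define F where "F z \<kappa> m = f' (Inr (z, \<kappa>)) m" for z \<kappa> m
  have fibre: "psd_on {y \<in> Y. p y = z} (\<lambda>i j. cinner K (V j) (V i) - gram N f' i j)" for z
  proof -
    have "psd_on {y \<in> Y. p y = z} (\<lambda>i j. 1 / s z z * (s (p i) (p j) * (cinner K (V j) (V i) - gram N f' i j)))"
      by (rule psd_on_scale[OF psd_on_subset[OF ps] szz]) auto
    then show ?thesis by (rule psd_on_cong) (auto simp: nz)
  qed
  have agree: "F z (A z x) m = R z x m" if x: "x \<in> D" and m: "m < N" for z x m
  proof -
    let ?a = "Inl (z, x) :: 'x \<times> (nat \<Rightarrow> complex) + 'x \<times> 'k" and ?b = "Inr (z, A z x) :: 'x \<times> (nat \<Rightarrow> complex) + 'x \<times> 'k"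
    have ab: "?a \<in> Y0" "{?a, ?b} \<subseteq> {y \<in> Y. p y = z}" using x A by (auto simp: Y_def Y0_def p_def)
    \<comment> \<open>The difference of the two equal vectors is a null combination.\<close>
    let ?c = "\<lambda>y. if y = ?a then 1 else - 1 :: complex"
    have "0 \<le> sesq_form {?a, ?b} (\<lambda>i j. cinner K (V j) (V i) - gram N f' i j) ?c ?c"
      by (rule psd_onD[OF fibre[of z] _ ab(2)]) simp
    also have "\<dots> = - (gram N f' ?a ?a - gram N f' ?a ?b - gram N f' ?b ?a + gram N f' ?b ?b)"
      by (simp add: sesq_form_def V_def)
    also have "\<dots> = - (\<Sum>n<N. cnj (f' ?a n - f' ?b n) * (f' ?a n - f' ?b n))"
      by (simp add: gram_def sum_subtractf sum.distrib algebra_simps)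
    also have "\<dots> = of_real (- (\<Sum>n<N. (cmod (f' ?a n - f' ?b n))\<^sup>2))"
      by (simp add: complex_norm_square mult.commute del: of_real_power)
    finally have "(\<Sum>n<N. (cmod (f' ?a n - f' ?b n))\<^sup>2) \<le> 0" by (simp add: less_eq_complex_def)
    then have "(\<Sum>n<N. (cmod (f' ?a n - f' ?b n))\<^sup>2) = 0" by (simp add: sum_nonneg eq_iff)
    then have "(cmod (f' ?a m - f' ?b m))\<^sup>2 = 0" using m by (simp add: sum_nonneg_eq_0_iff)
    moreover have "f' ?a m = R z x m" using f' ab(1) m by (simp add: f_def)
    ultimately show ?thesis by (simp add: F_def)
  qed
  have "\<exists>\<phi>\<in>carrier K. (\<forall>\<kappa>\<in>carrier K. cinner K \<phi> \<kappa> = cnj (F z \<kappa> m)) \<and> hnorm K \<phi> \<le> 1" if m: "m < N" for z m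
  proof (rule K.moment_solution)
    have "psd_on (carrier K) (\<lambda>\<kappa> \<mu>. cinner K (V (Inr (z, \<mu>))) (V (Inr (z, \<kappa>))) - gram N f' (Inr (z, \<kappa>)) (Inr (z, \<mu>)))"
      by (rule psd_on_pullback[OF fibre]) (auto simp: Y_def p_def)
    then have "psd_on (carrier K) (\<lambda>\<kappa> \<mu>. cinner K \<mu> \<kappa> - gram N (F z) \<kappa> \<mu>)"
      by (simp add: V_def gram_def F_def)
    moreover have "psd_on (carrier K) (\<lambda>\<kappa> \<mu>. \<Sum>n\<in>{..<N} - {m}. cnj (F z \<kappa> n) * F z \<mu> n)"
      by (intro psd_on_sum psd_on_rank_one)
    ultimately have "psd_on (carrier K) (\<lambda>\<kappa> \<mu>. (cinner K \<mu> \<kappa> - gram N (F z) \<kappa> \<mu>) + (\<Sum>n\<in>{..<N} - {m}. cnj (F z \<kappa> n) * F z \<mu> n))"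
      by (rule psd_on_add)
    then show "psd_on (carrier K) (\<lambda>\<kappa> \<mu>. of_real (1\<^sup>2) * cinner K \<mu> \<kappa> - cnj (F z \<kappa> m) * cnj (cnj (F z \<mu> m)))"
      by (rule psd_on_cong) (use m in \<open>simp add: gram_def sum.remove[of "{..<N}" m]\<close>)
  qed auto
  then have "\<forall>z m. \<exists>\<phi>. m < N \<longrightarrow> \<phi> \<in> carrier K \<and> (\<forall>\<kappa>\<in>carrier K. cinner K \<phi> \<kappa> = cnj (F z \<kappa> m))"
    by blast
  then obtain \<phi> where \<phi>: "\<And>z m. m < N \<Longrightarrow> \<phi> z m \<in> carrier K"
    "\<And>z m \<kappa>. m < N \<Longrightarrow> \<kappa> \<in> carrier K \<Longrightarrow> cinner K (\<phi> z m) \<kappa> = cnj (F z \<kappa> m)" by metis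
  define \<Phi> where "\<Phi> z v = (\<Sum>m<N. v m *\<^sub>C \<phi> z m)" for z v
  have bd: "\<Phi> z \<in> bounded_ops (\<complex>^N) K" for z
    unfolding \<Phi>_def by (rule bounded_ops_combination[OF K]) (rule \<phi>(1))
  have unit: "\<Phi> z (unit_tuple m) = \<phi> z m" if "m < N" for z m
  proof -
    have "\<Phi> z (unit_tuple m) = (\<Sum>n<N. if n = m then \<phi> z n else 0)"
      unfolding \<Phi>_def by (rule sum.cong) (auto simp: unit_tuple_def scaleC_one)
    then show ?thesis using that by simp
  qed
  have adj: "tuple_adjoint N K (\<Phi> z) \<kappa> m = (if m < N then F z \<kappa> m else 0)" if "\<kappa> \<in> carrier K" for z \<kappa> m
    using that by (simp add: tuple_adjoint_def unit \<phi>)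
  have "psd_on (UNIV \<times> carrier K) (\<lambda>i j. s (p (Inr i)) (p (Inr j)) * (cinner K (V (Inr j)) (V (Inr i)) - gram N f' (Inr i) (Inr j)))"
    by (rule psd_on_pullback[OF ps]) (auto simp: Y_def)
  then have "psd_on (UNIV \<times> carrier K) (\<lambda>i j. tensor_kernel s K i j - s (fst i) (fst j)
      * cinner (\<complex>^N) (tuple_adjoint N K (\<Phi> (fst j)) (snd j)) (tuple_adjoint N K (\<Phi> (fst i)) (snd i)))"
    by (rule psd_on_cong)
      (auto simp: tensor_kernel_def p_def V_def gram_def cinner_complex_tuples adj F_def right_diff_distrib mult.commute)
  then have "contractive_multiplier s (\<complex>^N) s K \<Phi>"
    using contractive_multiplier_tuples_iff[where \<Phi> = \<Phi>, OF pk pk K bd] by blast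
  moreover have "tuple_adjoint N K (\<Phi> z) (A z x) = R z x" if "x \<in> D" for z x
  proof
    fix m
    show "tuple_adjoint N K (\<Phi> z) (A z x) m = R z x m"
      using adj[OF A[OF that]] agree[OF that] R[OF that] by (auto simp: carrier_complex_tuples)
  qed
  ultimately show ?thesis by blast
qed

text \<open>
  The diagonal of the kernel of \<open>contractive_multiplier_iff_psd_on\<close> shows that \<open>\<Phi>(z)\<^sup>*\<close> is a contraction.
\<close>

lemma contractive_multiplier_pointwise:
  assumes s: "pd_kernel s" and F: "hilbert_space F" and nz: "s z z \<noteq> 0"
    and \<Phi>: "contractive_multiplier s (\<complex>^N) s F \<Phi>" and x: "x \<in> carrier (\<complex>^N)"
  shows "hnorm F (\<Phi> z x) \<le> hnorm (\<complex>^N) x"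
proof -
  interpret F: hilbert_space F by fact
  interpret C: hilbert_space "\<complex>^N" by (rule hilbert_space_complex_tuples)
  let ?y = "\<Phi> z x" and ?a = "tuple_adjoint N F (\<Phi> z) (\<Phi> z x)"
  have bd: "\<Phi> z \<in> bounded_ops (\<complex>^N) F" by (rule contractive_multiplierD[OF \<Phi>])
  then have y: "?y \<in> carrier F" using x by (auto simp: bounded_ops_def)
  have szz: "0 < Re (s z z)" "Im (s z z) = 0"
    using psd_on_diag[of UNIV s z] s nz by (auto simp: pd_kernel_iff_psd_on less_eq_complex_def complex_eq_iff)
  have "0 \<le> s z z * cinner F ?y ?y - s z z * cinner (\<complex>^N) ?a ?a"
    using psd_on_diag[OF contractive_multiplier_tuples_psd_on[OF s s F \<Phi>], of "(z, ?y)"] y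
    by (simp add: tensor_kernel_def)
  also have "\<dots> = s z z * of_real ((hnorm F ?y)\<^sup>2 - (hnorm (\<complex>^N) ?a)\<^sup>2)"
    unfolding F.cinner_self[OF y] C.cinner_self[OF tuple_adjoint_carrier] by (simp add: right_diff_distrib)
  finally have "(hnorm (\<complex>^N) ?a)\<^sup>2 \<le> (hnorm F ?y)\<^sup>2"
    using szz by (simp add: less_eq_complex_def zero_le_mult_iff)
  then have le: "hnorm (\<complex>^N) ?a \<le> hnorm F ?y" by (rule power2_le_imp_le) (rule F.hnorm_nonneg[OF y])
  have "(hnorm F ?y)\<^sup>2 = cmod (cinner (\<complex>^N) x ?a)"
    unfolding cinner_tuple_adjoint[OF F bd x y, symmetric] F.cinner_self[OF y] by (simp add: norm_power)
  also have "\<dots> \<le> hnorm (\<complex>^N) x * hnorm (\<complex>^N) ?a" by (rule C.Cauchy_Schwarz[OF x tuple_adjoint_carrier])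
  also have "\<dots> \<le> hnorm (\<complex>^N) x * hnorm F ?y" using le x by (intro mult_left_mono) auto
  finally have "hnorm F ?y * hnorm F ?y \<le> hnorm (\<complex>^N) x * hnorm F ?y" by (simp add: power2_eq_square)
  then show ?thesis
    using F.hnorm_nonneg[OF y] C.hnorm_nonneg[OF x]
    by (cases "hnorm F ?y = 0") (auto simp: mult_le_cancel_right)
qed

lemma op_of_mat_bounded: "op_of_mat N A \<in> bounded_ops (\<complex>^N) (\<complex>^N)"
proof -
  have "(\<lambda>v. \<Sum>m<N. v m *\<^sub>C (\<lambda>i. if i < N then A $$ (i, m) else 0)) \<in> bounded_ops (\<complex>^N) (\<complex>^N)"
    by (rule bounded_ops_combination[OF hilbert_space_complex_tuples]) (simp add: carrier_complex_tuples)
  moreover have "(\<lambda>v. \<Sum>m<N. v m *\<^sub>C (\<lambda>i. if i < N then A $$ (i, m) else 0)) = op_of_mat N A"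
    by (intro ext) (simp add: op_of_mat_def sum_scaleC_apply scaleC_complex_def mult.commute)
  ultimately show ?thesis by simp
qed

lemma tuple_adjoint_op_of_mat:
  "tuple_adjoint N (\<complex>^N) (op_of_mat N A) x = (\<lambda>m. if m < N then \<Sum>i<N. cnj (A $$ (i, m)) * x i else 0)"
proof -
  have "op_of_mat N A (unit_tuple m) i = A $$ (i, m)" if "m < N" "i < N" for m i
    using that by (simp add: op_of_mat_def unit_tuple_def if_distrib cong: if_cong)
  then show ?thesis by (auto simp: tuple_adjoint_def cinner_complex_tuples fun_eq_iff)
qed

text \<open>
  The adjoint of the row operator \<open>[I \<otimes> G, R (I \<otimes> \<Psi>)]\<close>, where \<open>G\<close> and \<open>\<Psi>\<close> are the functionals
  represented by \<open>\<gamma>\<close> and \<open>\<psi>\<close>.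
\<close>

definition row_adjoint :: "nat \<Rightarrow> 'b::complex_vector \<Rightarrow> 'a::complex_vector \<Rightarrow> complex mat \<Rightarrow>
    (nat \<Rightarrow> complex) \<Rightarrow> (nat \<Rightarrow> 'b) \<times> (nat \<Rightarrow> 'a)" where
  "row_adjoint N \<gamma> \<psi> R x = ((\<lambda>i. if i < N then x i *\<^sub>C \<gamma> else 0),
    (\<lambda>i. if i < N then tuple_adjoint N (\<complex>^N) (op_of_mat N R) x i *\<^sub>C \<psi> else 0))"

lemma row_adjoint_carrier:
  assumes "hilbert_space L1" "hilbert_space L2" "\<psi> \<in> carrier L1" "\<gamma> \<in> carrier L2"
  shows "row_adjoint N \<gamma> \<psi> R x \<in> carrier (tuple_space N L2 \<oplus>\<^sub>H tuple_space N L1)"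
  using hilbert_space.scaleC_closed[OF assms(1,3)] hilbert_space.scaleC_closed[OF assms(2,4)]
  by (simp add: row_adjoint_def carrier_direct_sum carrier_tuple_space)

lemma cinner_row_adjoint:
  assumes L1: "hilbert_space L1" and L2: "hilbert_space L2"
    and \<psi>: "\<psi> \<in> carrier L1" "\<psi>' \<in> carrier L1" and \<gamma>: "\<gamma> \<in> carrier L2" "\<gamma>' \<in> carrier L2"
  shows "cinner (tuple_space N L2 \<oplus>\<^sub>H tuple_space N L1) (row_adjoint N \<gamma>' \<psi>' R' y) (row_adjoint N \<gamma> \<psi> R x)
    = cinner L2 \<gamma>' \<gamma> * cinner (\<complex>^N) y x
      + cinner L1 \<psi>' \<psi> * cinner (\<complex>^N) (tuple_adjoint N (\<complex>^N) (op_of_mat N R') y) (tuple_adjoint N (\<complex>^N) (op_of_mat N R) x)"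
proof -
  interpret L1: hilbert_space L1 by fact
  interpret L2: hilbert_space L2 by fact
  show ?thesis
    using \<psi> \<gamma>
    by (simp add: cinner_direct_sum row_adjoint_def cinner_tuple_space[of N L1] cinner_tuple_space[of N L2]
        cinner_complex_tuples L1.cinner_scaleC_left L1.cinner_scaleC_right
        L2.cinner_scaleC_left L2.cinner_scaleC_right sum_distrib_left mult_ac)
qed

lemma tuple_adjoint_row_adjoint:
  fixes T1 :: "(nat \<Rightarrow> complex) \<Rightarrow> nat \<Rightarrow> 'b::complex_vector" and T2 :: "(nat \<Rightarrow> complex) \<Rightarrow> nat \<Rightarrow> 'a::complex_vector"
  assumes L1: "hilbert_space L1" and L2: "hilbert_space L2" and \<psi>: "\<psi> \<in> carrier L1" and \<gamma>: "\<gamma> \<in> carrier L2"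
    and P: "\<And>u. u \<in> carrier L1 \<Longrightarrow> P u = cinner L1 u \<psi>" and Q: "\<And>u. u \<in> carrier L2 \<Longrightarrow> Q u = cinner L2 u \<gamma>"
    and T: "(\<lambda>v. (T1 v, T2 v)) \<in> bounded_ops (\<complex>^N) (tuple_space N L2 \<oplus>\<^sub>H tuple_space N L1)"
    and R: "R \<in> carrier_mat N N" and m: "m < N"
  defines "M1 \<equiv> mat_of_op N (ampliation N Q \<circ> T1)" and "M2 \<equiv> mat_of_op N (ampliation N P \<circ> T2)"
  shows "tuple_adjoint N (tuple_space N L2 \<oplus>\<^sub>H tuple_space N L1) (\<lambda>v. (T1 v, T2 v)) (row_adjoint N \<gamma> \<psi> R x) m
    = (\<Sum>i<N. cnj ((M1 + R * M2) $$ (i, m)) * x i)"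
proof -
  interpret L1: hilbert_space L1 by fact
  interpret L2: hilbert_space L2 by fact
  let ?K = "tuple_space N L2 \<oplus>\<^sub>H tuple_space N L1" and ?e = "unit_tuple m"
  let ?r = "tuple_adjoint N (\<complex>^N) (op_of_mat N R) x"
  have "(T1 ?e, T2 ?e) \<in> carrier ?K" using T unit_tuple_carrier[OF m] by (auto simp: bounded_ops_def)
  then have c: "T1 ?e i \<in> carrier L2" "T2 ?e i \<in> carrier L1" if "i < N" for i
    using that by (auto simp: carrier_direct_sum carrier_tuple_space)
  have M1: "M1 $$ (i, m) = Q (T1 ?e i)" and M2: "M2 $$ (i, m) = P (T2 ?e i)" if "i < N" for i
    using that m by (simp_all add: M1_def M2_def mat_of_op_def ampliation_def unit_tuple_def)
  have RM: "(M1 + R * M2) $$ (i, m) = M1 $$ (i, m) + (\<Sum>l<N. R $$ (i, l) * M2 $$ (l, m))" if "i < N" for i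
    using that m R by (simp add: M1_def M2_def mat_of_op_def scalar_prod_def atLeast0LessThan)
  have "cinner ?K (T1 ?e, T2 ?e) (row_adjoint N \<gamma> \<psi> R x)
      = (\<Sum>i<N. cnj (x i) * Q (T1 ?e i)) + (\<Sum>l<N. cnj (?r l) * P (T2 ?e l))"
    using c \<psi> \<gamma>
    by (simp add: cinner_direct_sum row_adjoint_def cinner_tuple_space[of N L1] cinner_tuple_space[of N L2]
        L1.cinner_scaleC_right L2.cinner_scaleC_right P Q)
  also have "(\<Sum>l<N. cnj (?r l) * P (T2 ?e l)) = (\<Sum>l<N. \<Sum>i<N. cnj (x i) * (R $$ (i, l) * M2 $$ (l, m)))"
    by (simp add: tuple_adjoint_op_of_mat M2 sum_distrib_left sum_distrib_right mult_ac)
  also have "\<dots> = (\<Sum>i<N. cnj (x i) * (\<Sum>l<N. R $$ (i, l) * M2 $$ (l, m)))"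
    unfolding sum_distrib_left by (rule sum.swap)
  also have "(\<Sum>i<N. cnj (x i) * Q (T1 ?e i)) + \<dots> = (\<Sum>i<N. cnj (x i) * (M1 + R * M2) $$ (i, m))"
    unfolding sum.distrib[symmetric] by (rule sum.cong) (simp_all add: RM M1 distrib_left)
  finally show ?thesis using m by (simp add: tuple_adjoint_def mult.commute)
qed

text \<open>
  With \<open>A = [I \<otimes> Q, R (I \<otimes> P)]\<close> this is the equivalence of \<open>\<Phi>\<^sup>* A\<^sup>* = R\<^sup>*\<close> and \<open>A \<Phi> = R\<close>, the latter written
  out for the two blocks of \<open>\<Phi>\<close>.
\<close>

lemma tuple_adjoint_row_adjoint_iff:
  fixes T1 :: "(nat \<Rightarrow> complex) \<Rightarrow> nat \<Rightarrow> 'b::complex_vector" and T2 :: "(nat \<Rightarrow> complex) \<Rightarrow> nat \<Rightarrow> 'a::complex_vector"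
  assumes L1: "hilbert_space L1" and L2: "hilbert_space L2" and \<psi>: "\<psi> \<in> carrier L1" and \<gamma>: "\<gamma> \<in> carrier L2"
    and P: "\<And>u. u \<in> carrier L1 \<Longrightarrow> P u = cinner L1 u \<psi>" and Q: "\<And>u. u \<in> carrier L2 \<Longrightarrow> Q u = cinner L2 u \<gamma>"
    and T: "(\<lambda>v. (T1 v, T2 v)) \<in> bounded_ops (\<complex>^N) (tuple_space N L2 \<oplus>\<^sub>H tuple_space N L1)"
    and R: "R \<in> carrier_mat N N"
  defines "M1 \<equiv> mat_of_op N (ampliation N Q \<circ> T1)" and "M2 \<equiv> mat_of_op N (ampliation N P \<circ> T2)"
  shows "(\<forall>x\<in>carrier (\<complex>^N). tuple_adjoint N (tuple_space N L2 \<oplus>\<^sub>H tuple_space N L1) (\<lambda>v. (T1 v, T2 v))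
      (row_adjoint N \<gamma> \<psi> R x) = tuple_adjoint N (\<complex>^N) (op_of_mat N R) x) \<longleftrightarrow> M1 + R * M2 = R"
proof -
  let ?K = "tuple_space N L2 \<oplus>\<^sub>H tuple_space N L1"
  let ?l = "\<lambda>x. tuple_adjoint N ?K (\<lambda>v. (T1 v, T2 v)) (row_adjoint N \<gamma> \<psi> R x)"
  let ?r = "\<lambda>x. tuple_adjoint N (\<complex>^N) (op_of_mat N R) x"
  have l: "?l x m = (\<Sum>i<N. cnj ((M1 + R * M2) $$ (i, m)) * x i)" if "m < N" for x m
    unfolding M1_def M2_def by (rule tuple_adjoint_row_adjoint[OF L1 L2 \<psi> \<gamma> P Q T R that])
  have r: "?r x m = (\<Sum>i<N. cnj (R $$ (i, m)) * x i)" if "m < N" for x m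
    using that by (simp add: tuple_adjoint_op_of_mat)
  have out: "?l x m = 0" "?r x m = 0" if "\<not> m < N" for x m
    using that by (simp_all add: tuple_adjoint_def)
  have dim: "M1 + R * M2 \<in> carrier_mat N N" using R by (auto simp: M1_def M2_def mat_of_op_def)
  show ?thesis
  proof
    assume eq: "M1 + R * M2 = R"
    have "?l x m = ?r x m" for x m
      using l[of m x] r[of m x] out[of m x] eq by (cases "m < N") auto
    then show "\<forall>x\<in>carrier (\<complex>^N). ?l x = ?r x" by blast
  next
    assume eq: "\<forall>x\<in>carrier (\<complex>^N). ?l x = ?r x"
    show "M1 + R * M2 = R"
    proof (rule eq_matI)
      fix i m assume "i < dim_row R" "m < dim_col R"
      then have im: "i < N" "m < N" using R by auto
      have "?l (unit_tuple i) m = ?r (unit_tuple i) m"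
        using eq unit_tuple_carrier[OF im(1)] by simp
      then have "cnj ((M1 + R * M2) $$ (i, m)) = cnj (R $$ (i, m))"
        using im unfolding l[OF im(2)] r[OF im(2)] by (simp add: unit_tuple_def if_distrib cong: if_cong)
      then show "(M1 + R * M2) $$ (i, m) = R $$ (i, m)" by simp
    qed (use dim R in auto)
  qed
qed

lemma mat_inverse_exists:
  fixes A :: "complex mat"
  assumes A: "A \<in> carrier_mat N N" and inj: "\<And>v. v \<in> carrier_vec N \<Longrightarrow> A *\<^sub>v v = 0\<^sub>v N \<Longrightarrow> v = 0\<^sub>v N"
  shows "\<exists>B. mat_inverse A = Some B \<and> A * B = 1\<^sub>m N \<and> B * A = 1\<^sub>m N \<and> B \<in> carrier_mat N N"
proof -
  have "det A \<noteq> 0" using det_0_iff_vec_prod_zero_field[OF A] inj by blast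
  then have "A \<in> Units (ring_mat TYPE(complex) N ())" by (rule det_non_zero_imp_unit[OF A])
  then obtain B where B: "mat_inverse A = Some B" using mat_inverse(1)[OF A, where b = "()"] by (cases "mat_inverse A") auto
  then show ?thesis using mat_inverse(2)[OF A B] by blast
qed

text \<open>
  A vector fixed by \<open>(I \<otimes> P) T\<^sub>2\<close> satisfies \<open>\<parallel>x\<parallel> \<le> \<parallel>\<psi>\<parallel> \<parallel>T\<^sub>2 x\<parallel> \<le> \<parallel>\<psi>\<parallel> \<parallel>x\<parallel>\<close>.
\<close>

lemma injective_one_minus_strict_contraction:
  fixes T2 :: "(nat \<Rightarrow> complex) \<Rightarrow> nat \<Rightarrow> 'a::complex_vector"
  assumes L1: "hilbert_space L1" and \<psi>: "\<psi> \<in> carrier L1" "hnorm L1 \<psi> < 1"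
    and P: "\<And>u. u \<in> carrier L1 \<Longrightarrow> P u = cinner L1 u \<psi>"
    and T2: "T2 \<in> bounded_ops (\<complex>^N) (tuple_space N L1)"
    and contr: "\<And>x. x \<in> carrier (\<complex>^N) \<Longrightarrow> hnorm (tuple_space N L1) (T2 x) \<le> hnorm (\<complex>^N) x"
    and v: "v \<in> carrier_vec N" "(1\<^sub>m N - mat_of_op N (ampliation N P \<circ> T2)) *\<^sub>v v = 0\<^sub>v N"
  shows "v = 0\<^sub>v N"
proof -
  interpret L1: hilbert_space L1 by fact
  let ?T = "tuple_space N L1"
  have hT: "hilbert_space ?T" by (rule hilbert_space_tuple_space[OF L1])
  define M where "M = mat_of_op N (ampliation N P \<circ> T2)"
  define x where "x i = (if i < N then v $ i else 0)" for i
  have x: "x \<in> carrier (\<complex>^N)" by (simp add: x_def carrier_complex_tuples)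
  have M: "M \<in> carrier_mat N N" by (simp add: M_def mat_of_op_def)
  have t: "T2 (unit_tuple m) i \<in> carrier L1" if "m < N" "i < N" for m i
    using T2 unit_tuple_carrier[OF that(1)] that(2) by (auto simp: bounded_ops_def carrier_tuple_space)
  have T2x: "T2 x \<in> carrier ?T" using T2 x by (auto simp: bounded_ops_def)
  have fix1: "P (T2 x i) = x i" if i: "i < N" for i
  proof -
    have "T2 x i = (\<Sum>m<N. x m *\<^sub>C T2 (unit_tuple m) i)"
      unfolding bounded_ops_expand[OF hT T2 x] sum_scaleC_apply ..
    moreover have "(\<Sum>m<N. x m *\<^sub>C T2 (unit_tuple m) i) \<in> carrier L1"
      using t i by (intro L1.sum_closed L1.scaleC_closed) auto
    ultimately have "P (T2 x i) = cinner L1 (\<Sum>m<N. x m *\<^sub>C T2 (unit_tuple m) i) \<psi>" using P by simp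
    also have "\<dots> = (\<Sum>m<N. x m * cinner L1 (T2 (unit_tuple m) i) \<psi>)"
      by (rule L1.cinner_sum_left) (use t i \<psi> in auto)
    also have "\<dots> = (\<Sum>m<N. M $$ (i, m) * v $ m)"
      using t i P by (intro sum.cong refl)
        (simp add: M_def mat_of_op_def ampliation_def unit_tuple_def x_def mult.commute)
    also have "\<dots> = (M *\<^sub>v v) $ i"
      using M v(1) i by (simp add: scalar_prod_def atLeast0LessThan)
    also have "\<dots> = v $ i"
    proof -
      have "(1\<^sub>m N - M) *\<^sub>v v = v - M *\<^sub>v v"
        using minus_mult_distrib_mat_vec[OF one_carrier_mat M v(1)] v(1) by simp
      then have "v - M *\<^sub>v v = 0\<^sub>v N" using v(2) unfolding M_def by (rule subst)
      then have "(v - M *\<^sub>v v) $ i = 0\<^sub>v N $ i" by (rule arg_cong)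
      then show ?thesis using v(1) M i by simp
    qed
    finally show ?thesis using i by (simp add: x_def)
  qed
  have "(hnorm (\<complex>^N) x)\<^sup>2 = (\<Sum>i<N. (cmod (P (T2 x i)))\<^sup>2)"
    unfolding hnorm_tuple_space(1)[OF hilbert_space_complex_space x] hnorm_complex_space
    by (rule sum.cong) (simp_all add: fix1)
  also have "\<dots> \<le> (\<Sum>i<N. (hnorm L1 (T2 x i) * hnorm L1 \<psi>)\<^sup>2)"
    using T2x P \<psi>(1) by (intro sum_mono power_mono) (auto simp: carrier_tuple_space L1.Cauchy_Schwarz)
  also have "\<dots> = (hnorm ?T (T2 x))\<^sup>2 * (hnorm L1 \<psi>)\<^sup>2"
    unfolding hnorm_tuple_space(1)[OF L1 T2x] by (simp add: power_mult_distrib sum_distrib_right)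
  also have "\<dots> \<le> (hnorm (\<complex>^N) x)\<^sup>2 * (hnorm L1 \<psi>)\<^sup>2"
    using contr[OF x] hilbert_space.hnorm_nonneg[OF hT T2x] by (intro mult_right_mono power_mono) auto
  finally have le: "(hnorm (\<complex>^N) x)\<^sup>2 * (1 - (hnorm L1 \<psi>)\<^sup>2) \<le> 0" by (simp add: algebra_simps)
  have "(hnorm L1 \<psi>)\<^sup>2 < 1" using \<psi>(2) L1.hnorm_nonneg[OF \<psi>(1)] by (simp add: abs_square_less_1)
  then have "(hnorm (\<complex>^N) x)\<^sup>2 = 0" using le by (simp add: mult_le_0_iff)
  then have "x = 0"
    using hilbert_space.hnorm_eq_zero_iff[OF hilbert_space_complex_tuples x] by simp
  then have "v $ i = 0" if "i < N" for i using that by (auto simp: x_def fun_eq_iff dest: spec[of _ i])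
  then show ?thesis using v(1) by (intro eq_vecI) auto
qed

theorem corollary4p1:
  fixes k l s h g :: "'x \<Rightarrow> 'x \<Rightarrow> complex"
    and L1 :: "'a::complex_vector hspace" and L2 :: "'b::complex_vector hspace"
    and \<Psi> :: "'x \<Rightarrow> 'a \<Rightarrow> complex" and G :: "'x \<Rightarrow> 'b \<Rightarrow> complex"
    and N :: nat and R :: "'x \<Rightarrow> complex mat"
  assumes "pd_kernel k" and "pd_kernel l"
    and "\<And>z. k z z \<noteq> 0" and "\<And>z. l z z \<noteq> 0"
    and "strong_shimorin_certificate k l s"
    and "pd_kernel h" and "pd_kernel g"
    and "\<And>z w. k z w = (1 - h z w) * s z w" and "\<And>z w. l z w = s z w * g z w"
    and "\<And>z w. k z w \<noteq> 0" and "\<And>z w. s z w \<noteq> 0"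
    and "hilbert_space L1" and "hilbert_space L2"
    and "\<And>z. \<Psi> z \<in> bounded_ops L1 complex_space"
    and "\<And>z. G z \<in> bounded_ops L2 complex_space"
    and "\<And>z w c. \<Psi> z (hadjoint L1 complex_space (\<Psi> w) c) = h z w * c"
    and "\<And>z w c. G z (hadjoint L2 complex_space (G w) c) = g z w * c"
    and "N \<ge> 1"
    and "\<And>z. R z \<in> carrier_mat N N"
  shows "contractive_multiplier k (\<complex>^N) l (\<complex>^N) (\<lambda>z. op_of_mat N (R z)) \<longleftrightarrow>
    (\<exists>\<Phi>1 \<Phi>2.
      contractive_multiplier s (\<complex>^N) s (tuple_space N L2 \<oplus>\<^sub>H tuple_space N L1)
        (\<lambda>z v. (\<Phi>1 z v, \<Phi>2 z v)) \<and>
      (\<forall>z. \<exists>B. mat_inverse (1\<^sub>m N - mat_of_op N (ampliation N (\<Psi> z) \<circ> \<Phi>2 z)) = Some B \<and>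
           R z = mat_of_op N (ampliation N (G z) \<circ> \<Phi>1 z) * B))"
proof -
  let ?K = "tuple_space N L2 \<oplus>\<^sub>H tuple_space N L1"
  note k = assms(1) and l = assms(2) and L1 = assms(12) and L2 = assms(13) and R = assms(19)
  have cp: "complete_pick_kernel s" using assms(5) by (simp add: strong_shimorin_certificate_def)
  then have s: "pd_kernel s" by (simp add: complete_pick_kernel_def)
  have K: "hilbert_space ?K"
    by (intro hilbert_space_direct_sum hilbert_space_tuple_space L1 L2)
  interpret L1: hilbert_space L1 by (rule L1)
  interpret L2: hilbert_space L2 by (rule L2)
  have "\<exists>\<psi>\<in>carrier L1. \<forall>u\<in>carrier L1. \<Psi> z u = cinner L1 u \<psi>" for z
    by (rule Riesz_representation[OF L1 assms(14)])
  then obtain \<psi> where \<psi>: "\<And>z. \<psi> z \<in> carrier L1" "\<And>z u. u \<in> carrier L1 \<Longrightarrow> \<Psi> z u = cinner L1 u (\<psi> z)"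
    by metis
  have "\<exists>\<gamma>\<in>carrier L2. \<forall>u\<in>carrier L2. G z u = cinner L2 u \<gamma>" for z
    by (rule Riesz_representation[OF L2 assms(15)])
  then obtain \<gamma> where \<gamma>: "\<And>z. \<gamma> z \<in> carrier L2" "\<And>z u. u \<in> carrier L2 \<Longrightarrow> G z u = cinner L2 u (\<gamma> z)"
    by metis
  have h: "h z w = cinner L1 (\<psi> w) (\<psi> z)" for z w
    using assms(16)[of z w 1] hadjoint_functional[OF L1 \<psi>(1) \<psi>(2), of w 1] \<psi>(1) by (simp add: \<psi>(2) scaleC_one)
  have g: "g z w = cinner L2 (\<gamma> w) (\<gamma> z)" for z w
    using assms(17)[of z w 1] hadjoint_functional[OF L2 \<gamma>(1) \<gamma>(2), of w 1] \<gamma>(1) by (simp add: \<gamma>(2) scaleC_one)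
  \<comment> \<open>On the diagonal \<open>k = (1 - \<parallel>\<psi>\<parallel>\<^sup>2) s\<close>, where both kernels are positive.\<close>
  have \<psi>1: "hnorm L1 (\<psi> z) < 1" for z
  proof -
    have "0 \<le> k z z" "0 \<le> s z z"
      using k s psd_on_diag[of UNIV k z] psd_on_diag[of UNIV s z] by (simp_all add: pd_kernel_iff_psd_on)
    moreover have "k z z = of_real (1 - (hnorm L1 (\<psi> z))\<^sup>2) * s z z"
      using assms(8)[of z z] h[of z z] L1.cinner_self[OF \<psi>(1)[of z]] by simp
    ultimately have "0 < (1 - (hnorm L1 (\<psi> z))\<^sup>2) * Re (s z z)" "0 \<le> Re (s z z)"
      using assms(10)[of z z] by (auto simp: less_eq_complex_def complex_eq_iff less_le)
    then have "(hnorm L1 (\<psi> z))\<^sup>2 < 1" by (simp add: zero_less_mult_iff)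
    then show ?thesis by (simp add: abs_square_less_1)
  qed
  let ?Ra = "\<lambda>z. tuple_adjoint N (\<complex>^N) (op_of_mat N (R z))"
  let ?A = "\<lambda>z. row_adjoint N (\<gamma> z) (\<psi> z) (R z)"
  have A: "?A z x \<in> carrier ?K" for z x
    by (rule row_adjoint_carrier[OF L1 L2 \<psi>(1) \<gamma>(1)])
  \<comment> \<open>The kernel \<open>l I - k R R\<^sup>*\<close> of the multiplier condition for \<open>R\<close> is \<open>s (A A\<^sup>* - R R\<^sup>*)\<close>.\<close>
  have kernel_eq: "tensor_kernel l (\<complex>^N) i j - k (fst i) (fst j) * cinner (\<complex>^N) (?Ra (fst j) (snd j)) (?Ra (fst i) (snd i))
    = s (fst i) (fst j) * (cinner ?K (?A (fst j) (snd j)) (?A (fst i) (snd i))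
        - cinner (\<complex>^N) (?Ra (fst j) (snd j)) (?Ra (fst i) (snd i)))" for i j
    unfolding cinner_row_adjoint[OF L1 L2 \<psi>(1) \<psi>(1) \<gamma>(1) \<gamma>(1)] h[symmetric] g[symmetric] tensor_kernel_def assms(8,9)
    by (simp add: algebra_simps)
  have R_iff: "contractive_multiplier k (\<complex>^N) l (\<complex>^N) (\<lambda>z. op_of_mat N (R z)) \<longleftrightarrow>
    psd_on (UNIV \<times> carrier (\<complex>^N)) (\<lambda>i j. s (fst i) (fst j) * (cinner ?K (?A (fst j) (snd j)) (?A (fst i) (snd i))
        - cinner (\<complex>^N) (?Ra (fst j) (snd j)) (?Ra (fst i) (snd i))))"
    unfolding kernel_eq[symmetric]
    by (rule contractive_multiplier_tuples_iff[OF k l hilbert_space_complex_tuples op_of_mat_bounded])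
  let ?M1 = "\<lambda>\<Phi>1 z. mat_of_op N (ampliation N (G z) \<circ> \<Phi>1 z)"
  let ?M2 = "\<lambda>\<Phi>2 z. mat_of_op N (ampliation N (\<Psi> z) \<circ> \<Phi>2 z)"
  have Mc: "?M1 \<Phi>1 z \<in> carrier_mat N N" "?M2 \<Phi>2 z \<in> carrier_mat N N" for \<Phi>1 \<Phi>2 z
    by (simp_all add: mat_of_op_def)
  have alg: "?M1 \<Phi>1 z + R z * ?M2 \<Phi>2 z = R z \<longleftrightarrow> R z * (1\<^sub>m N - ?M2 \<Phi>2 z) = ?M1 \<Phi>1 z" for \<Phi>1 \<Phi>2 z
  proof -
    have "R z * (1\<^sub>m N - ?M2 \<Phi>2 z) = R z - R z * ?M2 \<Phi>2 z"
      using mult_minus_distrib_mat[OF R one_carrier_mat Mc(2)] R[of z] by simp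
    moreover have "?M1 \<Phi>1 z + X = R z \<longleftrightarrow> R z - X = ?M1 \<Phi>1 z" if "X \<in> carrier_mat N N" for X
      using that R[of z] Mc(1)[of z \<Phi>1] by (auto simp: mat_eq_iff algebra_simps)
    ultimately show ?thesis using mult_carrier_mat[OF R Mc(2)] by simp
  qed
  have iff: "(\<forall>x\<in>carrier (\<complex>^N). tuple_adjoint N ?K (\<lambda>v. (T1 v, T2 v)) (?A z x) = ?Ra z x)
      \<longleftrightarrow> mat_of_op N (ampliation N (G z) \<circ> T1) + R z * mat_of_op N (ampliation N (\<Psi> z) \<circ> T2) = R z"
    if "(\<lambda>v. (T1 v, T2 v)) \<in> bounded_ops (\<complex>^N) ?K" for T1 T2 z
    by (rule tuple_adjoint_row_adjoint_iff[OF L1 L2 \<psi>(1) \<gamma>(1)]) (simp_all add: \<psi>(2) \<gamma>(2) that R)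
  show ?thesis
  proof
    assume "contractive_multiplier k (\<complex>^N) l (\<complex>^N) (\<lambda>z. op_of_mat N (R z))"
    then have "psd_on (UNIV \<times> carrier (\<complex>^N)) (\<lambda>i j. s (fst i) (fst j) * (cinner ?K (?A (fst j) (snd j)) (?A (fst i) (snd i))
        - cinner (\<complex>^N) (?Ra (fst j) (snd j)) (?Ra (fst i) (snd i))))"
      by (simp only: R_iff)
    then have "\<exists>\<Phi>. contractive_multiplier s (\<complex>^N) s ?K \<Phi> \<and>
        (\<forall>z. \<forall>x\<in>carrier (\<complex>^N). tuple_adjoint N ?K (\<Phi> z) (?A z x) = ?Ra z x)"
      by (intro Leech_factorization[OF cp assms(11) K] A tuple_adjoint_carrier)
    then obtain \<Phi> where \<Phi>: "contractive_multiplier s (\<complex>^N) s ?K \<Phi>"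
      and adj: "\<And>z. \<forall>x\<in>carrier (\<complex>^N). tuple_adjoint N ?K (\<Phi> z) (?A z x) = ?Ra z x" by blast
    define \<Phi>1 where "\<Phi>1 z v = fst (\<Phi> z v)" for z v
    define \<Phi>2 where "\<Phi>2 z v = snd (\<Phi> z v)" for z v
    have \<Phi>12: "\<Phi> = (\<lambda>z v. (\<Phi>1 z v, \<Phi>2 z v))" by (simp add: \<Phi>1_def \<Phi>2_def)
    have bd: "(\<lambda>v. (\<Phi>1 z v, \<Phi>2 z v)) \<in> bounded_ops (\<complex>^N) ?K" for z
      using contractive_multiplierD[OF \<Phi>, of z] by (simp add: \<Phi>12)
    have "\<exists>B. mat_inverse (1\<^sub>m N - ?M2 \<Phi>2 z) = Some B \<and> R z = ?M1 \<Phi>1 z * B" for z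
    proof -
      have "?M1 \<Phi>1 z + R z * ?M2 \<Phi>2 z = R z"
        using iff[OF bd] adj[of z] unfolding \<Phi>12 by blast
      then have M: "R z * (1\<^sub>m N - ?M2 \<Phi>2 z) = ?M1 \<Phi>1 z" by (simp only: alg)
      have le: "hnorm (tuple_space N L1) (\<Phi>2 z x) \<le> hnorm (\<complex>^N) x" if x: "x \<in> carrier (\<complex>^N)" for x
      proof -
        have y: "\<Phi> z x \<in> carrier ?K" using contractive_multiplierD[OF \<Phi>, of z] x by (auto simp: bounded_ops_def)
        have "(hnorm (tuple_space N L1) (\<Phi>2 z x))\<^sup>2 \<le> (hnorm ?K (\<Phi> z x))\<^sup>2"
          unfolding hnorm_direct_sum(1)[OF hilbert_space_tuple_space[OF L2] hilbert_space_tuple_space[OF L1] y]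
          by (simp add: \<Phi>2_def)
        then have "hnorm (tuple_space N L1) (\<Phi>2 z x) \<le> hnorm ?K (\<Phi> z x)"
          by (rule power2_le_imp_le) (rule hilbert_space.hnorm_nonneg[OF K y])
        also have "\<dots> \<le> hnorm (\<complex>^N) x" by (rule contractive_multiplier_pointwise[OF s K assms(11) \<Phi> x])
        finally show ?thesis .
      qed
      have bd2: "\<Phi>2 z \<in> bounded_ops (\<complex>^N) (tuple_space N L1)"
        unfolding bounded_ops_def
        using bd[of z] le
        by (auto simp: bounded_ops_def carrier_direct_sum scaleC_prod_def intro!: exI[of _ 1])
      have "\<exists>B. mat_inverse (1\<^sub>m N - ?M2 \<Phi>2 z) = Some B \<and> (1\<^sub>m N - ?M2 \<Phi>2 z) * B = 1\<^sub>m N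
          \<and> B * (1\<^sub>m N - ?M2 \<Phi>2 z) = 1\<^sub>m N \<and> B \<in> carrier_mat N N"
      proof (rule mat_inverse_exists)
        show "1\<^sub>m N - ?M2 \<Phi>2 z \<in> carrier_mat N N" using Mc(2) by (simp add: minus_carrier_mat)
        show "v = 0\<^sub>v N" if "v \<in> carrier_vec N" "(1\<^sub>m N - ?M2 \<Phi>2 z) *\<^sub>v v = 0\<^sub>v N" for v
          by (rule injective_one_minus_strict_contraction[OF L1 \<psi>(1) \<psi>1 \<psi>(2) bd2 le that])
      qed
      then obtain B where B: "mat_inverse (1\<^sub>m N - ?M2 \<Phi>2 z) = Some B"
        "(1\<^sub>m N - ?M2 \<Phi>2 z) * B = 1\<^sub>m N" "B \<in> carrier_mat N N" by blast
      have "?M1 \<Phi>1 z * B = R z * ((1\<^sub>m N - ?M2 \<Phi>2 z) * B)"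
        unfolding M[symmetric] by (rule assoc_mult_mat[OF R _ B(3)]) (rule minus_carrier_mat[OF Mc(2)])
      then have "R z = ?M1 \<Phi>1 z * B" using B(2) R[of z] by simp
      then show ?thesis using B(1) by blast
    qed
    then show "\<exists>\<Phi>1 \<Phi>2. contractive_multiplier s (\<complex>^N) s ?K (\<lambda>z v. (\<Phi>1 z v, \<Phi>2 z v)) \<and>
      (\<forall>z. \<exists>B. mat_inverse (1\<^sub>m N - ?M2 \<Phi>2 z) = Some B \<and> R z = ?M1 \<Phi>1 z * B)"
      using \<Phi> unfolding \<Phi>12 by blast
  next
    assume "\<exists>\<Phi>1 \<Phi>2. contractive_multiplier s (\<complex>^N) s ?K (\<lambda>z v. (\<Phi>1 z v, \<Phi>2 z v)) \<and>
      (\<forall>z. \<exists>B. mat_inverse (1\<^sub>m N - ?M2 \<Phi>2 z) = Some B \<and> R z = ?M1 \<Phi>1 z * B)"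
    then obtain \<Phi>1 \<Phi>2 where \<Phi>: "contractive_multiplier s (\<complex>^N) s ?K (\<lambda>z v. (\<Phi>1 z v, \<Phi>2 z v))"
      and B: "\<And>z. \<exists>B. mat_inverse (1\<^sub>m N - ?M2 \<Phi>2 z) = Some B \<and> R z = ?M1 \<Phi>1 z * B" by blast
    have adj: "tuple_adjoint N ?K (\<lambda>v. (\<Phi>1 z v, \<Phi>2 z v)) (?A z x) = ?Ra z x" if "x \<in> carrier (\<complex>^N)" for z x
    proof -
      have D: "1\<^sub>m N - ?M2 \<Phi>2 z \<in> carrier_mat N N" by (rule minus_carrier_mat[OF Mc(2)])
      obtain B where B: "mat_inverse (1\<^sub>m N - ?M2 \<Phi>2 z) = Some B" "R z = ?M1 \<Phi>1 z * B" using B by blast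
      have inv: "B * (1\<^sub>m N - ?M2 \<Phi>2 z) = 1\<^sub>m N" "B \<in> carrier_mat N N" using mat_inverse(2)[OF D B(1)] by auto
      have "R z * (1\<^sub>m N - ?M2 \<Phi>2 z) = ?M1 \<Phi>1 z * (B * (1\<^sub>m N - ?M2 \<Phi>2 z))"
        unfolding B(2) by (rule assoc_mult_mat[OF Mc(1) inv(2) D])
      also have "\<dots> = ?M1 \<Phi>1 z" using Mc(1)[of z \<Phi>1] by (simp add: inv(1))
      finally have "?M1 \<Phi>1 z + R z * ?M2 \<Phi>2 z = R z" by (simp only: alg)
      then show ?thesis
        using iff[OF contractive_multiplierD[OF \<Phi>]] that by blast
    qed
    have "psd_on (UNIV \<times> carrier (\<complex>^N)) (\<lambda>i j.
      (\<lambda>i j. tensor_kernel s ?K i j - s (fst i) (fst j)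
        * cinner (\<complex>^N) (tuple_adjoint N ?K (\<lambda>v. (\<Phi>1 (fst j) v, \<Phi>2 (fst j) v)) (snd j))
            (tuple_adjoint N ?K (\<lambda>v. (\<Phi>1 (fst i) v, \<Phi>2 (fst i) v)) (snd i)))
      (fst i, ?A (fst i) (snd i)) (fst j, ?A (fst j) (snd j)))"
      by (rule psd_on_pullback[OF contractive_multiplier_tuples_psd_on[OF s s K \<Phi>]]) (simp add: A)
    then have "psd_on (UNIV \<times> carrier (\<complex>^N)) (\<lambda>i j. s (fst i) (fst j) * (cinner ?K (?A (fst j) (snd j)) (?A (fst i) (snd i))
        - cinner (\<complex>^N) (?Ra (fst j) (snd j)) (?Ra (fst i) (snd i))))"
      by (rule psd_on_cong) (auto simp: adj tensor_kernel_def right_diff_distrib)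
    then show "contractive_multiplier k (\<complex>^N) l (\<complex>^N) (\<lambda>z. op_of_mat N (R z))"
      by (simp only: R_iff)
  qed
qed

end
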